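(* Assume: (A1) $\psi$ is proper, closed and convex, $\mathrm{dom}(F)\neq\emptyset$, and $F^\star:=\inf_x F(x)>-\infty$; (A2) $\mathbb{E}_\xi[\|\nabla f_\xi(x)-\nabla f_\xi(y)\|^2]\le L^2\|x-y\|^2$ for all $x,y\in\mathrm{dom}(F)$, with $L\in(0,\infty)$; (A3) $\mathbb{E}_\xi[\|\nabla f_\xi(x)-\nabla f(x)\|^2]\le\sigma^2$ for all $x\in\mathrm{dom}(F)$, with $\sigma\in[0,\infty)$. Let $\tilde b\in\mathbb{N}_+$ be the initial batch size at every stage, $\beta_t=\beta:=1-\frac1{[\tilde b(m+1)]^{1/2}}\in(0,1)$, $\eta_t=\eta\in(0,\frac1L)$, $\delta:=\frac2\eta-2L$, and $$\gamma_m:=\frac{\delta}{L},\qquad \gamma_t:=\frac{\delta}{L+L(1+L^2\eta^2)\big[\beta^2\gamma_{t+1}+\beta^4\gamma_{t+2}+\cdots+\beta^{2(m-t)}\gamma_m\big]},\quad t=0,\dots,m-1,$$ where $\eta$ is such that $\gamma_t\in(0,1]$ for all $t$ (i.e. $\delta\le L$). Let $\Sigma_m:=\sum_{t=0}^m\gamma_t$. Let $\{x_t^{(s)}\}_{t=0,\dots,m}^{s=1,\dots,S}$ be generated by the restarting algorithm ProxHSGD-RS (see context) applied to $\min_xF(x)$ from $\overline{x}^{(0)}$, and let $\overline{x}_T$ be chosen at random from these iterates with $\mathbb{P}(\overline{x}_T=x_t^{(s)})=\frac{\gamma_t}{S\Sigma_m}$. Then: (a) $$\mathbb{E}\big[\|\mathcal{G}_\eta(\overline{x}_T)\|^2\big]\le\frac{8\sqrt2\,\tilde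 b^{1/4}\big(L+\sqrt{L\delta}\big)}{L\delta\eta^2S(m+1)^{3/4}}\big[F(\overline{x}^{(0)})-F^\star\big]+\frac{8\sigma^2}{L^2\eta^2[\tilde b(m+1)]^{1/2}}.$$ (b) For some constant $c_1\ge\frac1{m+1}$ and any $\varepsilon>0$, choose $$\tilde b:=\frac{16c_1}{L^2\eta^2}\cdot\frac{\max\{1,\sigma^2\}}{\varepsilon^2},\qquad m+1:=\frac{16}{c_1L^2\eta^2}\cdot\frac{\max\{1,\sigma^2\}}{\varepsilon^2}.$$ Then, to guarantee $\mathbb{E}[\|\mathcal{G}_\eta(\overline{x}_T)\|^2]\le\varepsilon^2$, at most $$S:=\Big\lfloor\frac{4\sqrt2\,c_1\big(L+\sqrt{L\delta}\big)}{\delta\eta\varepsilon}\big[F(\overline{x}^{(0)})-F^\star\big]\Big\rfloor$$ outer iterations are needed. Consequently, the total number $\mathcal{T}_{\nabla f}$ of stochastic gradient evaluations and the total number $\mathcal{T}_{\mathrm{prox}}$ of proximal operations $\mathrm{prox}_{\eta\psi}$ do not exceed, respectively, $$\mathcal{T}_{\nabla f}:=\frac{64\sqrt2(c_1^2+3)(L+\sqrt{L\delta})\max\{1,\sigma\}}{L^2\eta^3\delta\varepsilon^3}\big[F(\overline{x}^{(0)})-F^\star\big]=\mathcal{O}\Big(\frac{\max\{\sigma,1\}}{\varepsilon^3}\Big),$$ $$\mathcal{T}_{\mathrm{prox}}:=\frac{64\sqrt2(L+\sqrt{L\delta})\max\{1,\sigma\}}{L^2\eta^3\delta\varepsilon^3}\big[F(\overline{x}^{(0)})-F^\star\big]=\mathcal{O}\Big(\frac{\max\{\sigma,1\}}{\varepsilon^3}\Big),$$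 where the $\mathcal{O}$ hides factors independent of $\sigma$ and $\varepsilon$.
   Context: Problem: minimize $F(x):=f(x)+\psi(x)$ over $x\in\mathbb{R}^p$, where $f(x)=\mathbb{E}_{\xi\sim\mathbb{P}}[f_\xi(x)]$, each $f_\xi:\mathbb{R}^p\to\mathbb{R}$ is smooth (possibly nonconvex), stochastic gradients are unbiased ($\mathbb{E}_\xi[\nabla f_\xi(x)]=\nabla f(x)$), and $\psi:\mathbb{R}^p\to\mathbb{R}\cup\{+\infty\}$. Proximal operator: $\mathrm{prox}_{\eta\psi}(x):=\arg\min_u\{\eta\psi(u)+\frac12\|u-x\|^2\}$. Gradient mapping: $\mathcal{G}_\eta(x):=\frac1\eta\big(x-\mathrm{prox}_{\eta\psi}(x-\eta\nabla f(x))\big)$. ProxHSGD algorithm (started from a point $x_0\in\mathrm{dom}(F)$, with $\tilde b\in\mathbb{N}_+$, $\beta_t\in(0,1)$, $\gamma_t\in(0,1]$, $\eta_t>0$): compute $v_0:=\frac1{\tilde b}\sum_{\tilde\xi_i\in\widetilde{\mathcal{B}}}\nabla f_{\tilde\xi_i}(x_0)$ with $\widetilde{\mathcal B}$ a fresh batch of $\tilde b$ i.i.d. samples of $\xi$; set $\widehat{x}_1:=\mathrm{prox}_{\eta_0\psi}(x_0-\eta_0v_0)$ and $x_1:=(1-\gamma_0)x_0+\gamma_0\widehat{x}_1$. For $t=1,\dots,m$: draw two independent samples $\xi_t,\zeta_t$ of $\xi$, independent of the past; set $$v_t:=\beta_{t-1}v_{t-1}+\beta_{t-1}[\nabla f_{\xi_t}(x_t)-\nabla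 f_{\xi_t}(x_{t-1})]+(1-\beta_{t-1})\nabla f_{\zeta_t}(x_t);$$ set $\widehat{x}_{t+1}:=\mathrm{prox}_{\eta_t\psi}(x_t-\eta_tv_t)$ and $x_{t+1}:=(1-\gamma_t)x_t+\gamma_t\widehat{x}_{t+1}$. ProxHSGD-RS (restarting algorithm): given $\overline{x}^{(0)}\in\mathrm{dom}(F)$, for $s=1,\dots,S$ run ProxHSGD from $x_0^{(s)}:=\overline{x}^{(s-1)}$, producing $x_0^{(s)},\dots,x_{m+1}^{(s)}$, and set $\overline{x}^{(s)}:=x_{m+1}^{(s)}$ (the last iterate). $\mathbb{E}[\cdot]$ is expectation over all randomness, including the independent random choice of $\overline{x}_T$. Convention on counts in (b): integer rounding is ignored, i.e. $\tilde b$, $m+1$ and $S$ are identified with real numbers; the number of stochastic gradient evaluations is counted as $[\tilde b+3(m+1)]S$ and the number of proximal operations as $(m+1)S$, where $S$ is the number of outer iterations needed. *)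

theory Defs
  imports "HOL-Probability.Probability" "HOL-Library.Landau_Symbols"
begin

definition grad :: "('a::euclidean_space \<Rightarrow> real) \<Rightarrow> 'a \<Rightarrow> 'a" where
  "grad h x = (THE D. GDERIV h x :> D)"

definition continuously_differentiable :: "('a::euclidean_space \<Rightarrow> real) \<Rightarrow> bool" where
  "continuously_differentiable h \<longleftrightarrow>
     (\<forall>x. h differentiable (at x)) \<and> continuous_on UNIV (grad h)"

definition eff_dom :: "('a \<Rightarrow> ereal) \<Rightarrow> 'a set" where
  "eff_dom h = {x. h x < \<infinity>}"

definition epi :: "('a \<Rightarrow> ereal) \<Rightarrow> ('a \<times> real) set" where
  "epi h = {(x, r). h x \<le> ereal r}"

definition proper_closed_convex :: "('a::euclidean_space \<Rightarrow> ereal) \<Rightarrow> bool" where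
  "proper_closed_convex h \<longleftrightarrow>
     (\<forall>x. h x \<noteq> -\<infinity>) \<and> eff_dom h \<noteq> {} \<and> closed (epi h) \<and> convex (epi h)"

definition prox :: "('a::euclidean_space \<Rightarrow> ereal) \<Rightarrow> 'a \<Rightarrow> 'a" where
  "prox h x = arg_min (\<lambda>u. h u + ereal ((norm (u - x))\<^sup>2 / 2)) (\<lambda>_. True)"

definition gradient_mapping ::
    "('a::euclidean_space \<Rightarrow> real) \<Rightarrow> ('a \<Rightarrow> ereal) \<Rightarrow> real \<Rightarrow> 'a \<Rightarrow> 'a" where
  "gradient_mapping f \<psi> \<eta> x =
     (1 / \<eta>) *\<^sub>R (x - prox (\<lambda>u. ereal \<eta> * \<psi> u) (x - \<eta> *\<^sub>R grad f x))"

text \<open>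
  One run of ProxHSGD from \<open>x0\<close> on a realization of the samples: \<open>bt i\<close> for \<open>i < b\<close> is the initial
  batch, \<open>xi t\<close> and \<open>zeta t\<close> for \<open>1 \<le> t \<le> m\<close> are the samples drawn at iteration \<open>t\<close>.
\<close>

definition prox_hsgd ::
    "('w \<Rightarrow> 'a::euclidean_space \<Rightarrow> real) \<Rightarrow> ('a \<Rightarrow> ereal) \<Rightarrow> nat \<Rightarrow> nat \<Rightarrow>
     (nat \<Rightarrow> real) \<Rightarrow> (nat \<Rightarrow> real) \<Rightarrow> (nat \<Rightarrow> real) \<Rightarrow>
     (nat \<Rightarrow> 'w) \<Rightarrow> (nat \<Rightarrow> 'w) \<Rightarrow> (nat \<Rightarrow> 'w) \<Rightarrow> 'a \<Rightarrow> (nat \<Rightarrow> 'a) \<Rightarrow> bool" where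
  "prox_hsgd fs \<psi> b m \<beta> \<gamma> \<eta> bt xi zeta x0 x \<longleftrightarrow>
     (\<exists>v xhat.
        x 0 = x0 \<and>
        v 0 = (1 / real b) *\<^sub>R (\<Sum>i<b. grad (fs (bt i)) x0) \<and>
        (\<forall>t\<in>{1..m}.
           v t = \<beta> (t - 1) *\<^sub>R v (t - 1)
               + \<beta> (t - 1) *\<^sub>R (grad (fs (xi t)) (x t) - grad (fs (xi t)) (x (t - 1)))
               + (1 - \<beta> (t - 1)) *\<^sub>R grad (fs (zeta t)) (x t)) \<and>
        (\<forall>t\<in>{0..m}.
           xhat (t + 1) = prox (\<lambda>u. ereal (\<eta> t) * \<psi> u) (x t - \<eta> t *\<^sub>R v t) \<and>
           x (t + 1) = (1 - \<gamma> t) *\<^sub>R x t + \<gamma> t *\<^sub>R xhat (t + 1)))"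

text \<open>The first argument of each constructor is the stage.\<close>

datatype sample_index = Batch nat nat | Xi nat nat | Zeta nat nat

definition sample_indices :: "nat \<Rightarrow> nat \<Rightarrow> nat \<Rightarrow> sample_index set" where
  "sample_indices S b m =
     {Batch s i | s i. s \<in> {1..S} \<and> i < b} \<union>
     {Xi s t | s t. s \<in> {1..S} \<and> t \<in> {1..m}} \<union>
     {Zeta s t | s t. s \<in> {1..S} \<and> t \<in> {1..m}}"

definition prox_hsgd_rs ::
    "('w \<Rightarrow> 'a::euclidean_space \<Rightarrow> real) \<Rightarrow> ('a \<Rightarrow> ereal) \<Rightarrow> nat \<Rightarrow> nat \<Rightarrow> nat \<Rightarrow>
     (nat \<Rightarrow> real) \<Rightarrow> (nat \<Rightarrow> real) \<Rightarrow> (nat \<Rightarrow> real) \<Rightarrow>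
     (sample_index \<Rightarrow> 'w) \<Rightarrow> 'a \<Rightarrow> (nat \<Rightarrow> nat \<Rightarrow> 'a) \<Rightarrow> bool" where
  "prox_hsgd_rs fs \<psi> S b m \<beta> \<gamma> \<eta> X x0 x \<longleftrightarrow>
     (\<exists>xbar.
        xbar 0 = x0 \<and>
        (\<forall>s\<in>{1..S}.
           prox_hsgd fs \<psi> b m \<beta> \<gamma> \<eta>
             (\<lambda>i. X (Batch s i)) (\<lambda>t. X (Xi s t)) (\<lambda>t. X (Zeta s t)) (xbar (s - 1)) (x s) \<and>
           xbar s = x s (m + 1)))"

text \<open>
  \<open>x s t \<omega>\<close> is the iterate \<open>x\<^sub>t\<close> of stage \<open>s\<close>, and the output of the run is
  \<open>x (fst (T \<omega>)) (snd (T \<omega>)) \<omega>\<close>, where the random pair \<open>T = (s, t)\<close> is independent of all samples.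
\<close>

definition prox_hsgd_rs_run ::
    "'o measure \<Rightarrow> 'w measure \<Rightarrow> ('w \<Rightarrow> 'a::euclidean_space \<Rightarrow> real) \<Rightarrow> ('a \<Rightarrow> ereal) \<Rightarrow>
     nat \<Rightarrow> nat \<Rightarrow> nat \<Rightarrow> (nat \<Rightarrow> real) \<Rightarrow> (nat \<Rightarrow> real) \<Rightarrow> (nat \<Rightarrow> real) \<Rightarrow> 'a \<Rightarrow>
     (sample_index \<Rightarrow> 'o \<Rightarrow> 'w) \<Rightarrow> (nat \<Rightarrow> nat \<Rightarrow> 'o \<Rightarrow> 'a) \<Rightarrow> ('o \<Rightarrow> nat \<times> nat) \<Rightarrow> bool" where
  "prox_hsgd_rs_run M P fs \<psi> S b m \<beta> \<gamma> \<eta> x0 X x T \<longleftrightarrow>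
     prob_space M \<and>
     prob_space.indep_vars M (\<lambda>_. P) X (sample_indices S b m) \<and>
     (\<forall>i\<in>sample_indices S b m. distr M P (X i) = P) \<and>
     (\<forall>\<omega>\<in>space M. prox_hsgd_rs fs \<psi> S b m \<beta> \<gamma> \<eta> (\<lambda>i. X i \<omega>) x0 (\<lambda>s t. x s t \<omega>)) \<and>
     T \<in> measurable M (count_space UNIV) \<and>
     prob_space.indep_set M
       {T -` A \<inter> space M | A. A \<in> sets (count_space UNIV)}
       {(\<lambda>\<omega>. \<lambda>i\<in>sample_indices S b m. X i \<omega>) -` B \<inter> space M | B.
          B \<in> sets (PiM (sample_indices S b m) (\<lambda>_. P))} \<and>
     (\<forall>s\<in>{1..S}. \<forall>t\<in>{0..m}.
        measure M {\<omega> \<in> space M. T \<omega> = (s, t)} = \<gamma> t / (real S * (\<Sum>j=0..m. \<gamma> j)))"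

text \<open>An extended nonnegative integral, so that an upper bound entails integrability.\<close>

definition expected_sq_gradient_mapping ::
    "'o measure \<Rightarrow> ('a::euclidean_space \<Rightarrow> real) \<Rightarrow> ('a \<Rightarrow> ereal) \<Rightarrow> real \<Rightarrow>
     (nat \<Rightarrow> nat \<Rightarrow> 'o \<Rightarrow> 'a) \<Rightarrow> ('o \<Rightarrow> nat \<times> nat) \<Rightarrow> ennreal" where
  "expected_sq_gradient_mapping M f \<psi> \<eta> x T =
     (\<integral>\<^sup>+ \<omega>. ennreal ((norm (gradient_mapping f \<psi> \<eta> (x (fst (T \<omega>)) (snd (T \<omega>)) \<omega>)))\<^sup>2) \<partial>M)"

text \<open>
  The prescribed (real-valued, unrounded) batch size, epoch length \<open>m + 1\<close>, number of stages and
  complexity bounds; \<open>\<Delta>\<close> stands for the initial gap in objective value.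
\<close>

definition batch_choice :: "real \<Rightarrow> real \<Rightarrow> real \<Rightarrow> real \<Rightarrow> real \<Rightarrow> real" where
  "batch_choice c1 L \<eta> \<sigma> \<epsilon> = 16 * c1 / (L\<^sup>2 * \<eta>\<^sup>2) * (max 1 (\<sigma>\<^sup>2) / \<epsilon>\<^sup>2)"

definition epoch_choice :: "real \<Rightarrow> real \<Rightarrow> real \<Rightarrow> real \<Rightarrow> real \<Rightarrow> real" where
  "epoch_choice c1 L \<eta> \<sigma> \<epsilon> = 16 / (c1 * L\<^sup>2 * \<eta>\<^sup>2) * (max 1 (\<sigma>\<^sup>2) / \<epsilon>\<^sup>2)"

definition outer_bound :: "real \<Rightarrow> real \<Rightarrow> real \<Rightarrow> real \<Rightarrow> real \<Rightarrow> real \<Rightarrow> real" where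
  "outer_bound c1 L \<eta> \<delta> \<Delta> \<epsilon> = 4 * sqrt 2 * c1 * (L + sqrt (L * \<delta>)) / (\<delta> * \<eta> * \<epsilon>) * \<Delta>"

definition T_grad :: "real \<Rightarrow> real \<Rightarrow> real \<Rightarrow> real \<Rightarrow> real \<Rightarrow> real \<Rightarrow> real \<Rightarrow> real" where
  "T_grad c1 L \<eta> \<delta> \<Delta> \<sigma> \<epsilon> =
     64 * sqrt 2 * (c1\<^sup>2 + 3) * (L + sqrt (L * \<delta>)) * max 1 \<sigma> / (L\<^sup>2 * \<eta>^3 * \<delta> * \<epsilon>^3) * \<Delta>"

definition T_prox :: "real \<Rightarrow> real \<Rightarrow> real \<Rightarrow> real \<Rightarrow> real \<Rightarrow> real \<Rightarrow> real" where
  "T_prox L \<eta> \<delta> \<Delta> \<sigma> \<epsilon> =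
     64 * sqrt 2 * (L + sqrt (L * \<delta>)) * max 1 \<sigma> / (L\<^sup>2 * \<eta>^3 * \<delta> * \<epsilon>^3) * \<Delta>"

end

theory Submission
  imports Defs
begin

text \<open>
  Write \<open>e\<^sub>t = v\<^sub>t - \<nabla>f(x\<^sub>t)\<close>. Strong convexity of the prox objective and the descent lemma bound
  \<open>F(x\<^sub>t\<^sub>+\<^sub>1) - F(x\<^sub>t)\<close> by a negative multiple of the squared prox step plus a multiple of
  \<open>\<parallel>e\<^sub>t\<parallel>\<^sup>2\<close>. As \<open>\<xi>\<^sub>t\<close> and \<open>\<zeta>\<^sub>t\<close> are independent of the past, the three parts of
  \<open>e\<^sub>t\<close> are uncorrelated, so its second moment contracts by the factor \<open>\<beta>\<^sup>2\<close> up to the squared step and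
  the noise. The step sizes \<open>\<gamma>\<^sub>t\<close> are exactly those for which \<open>F\<close> plus a discounted multiple of
  \<open>\<parallel>e\<^sub>t\<parallel>\<^sup>2\<close> decreases in expectation, by a fixed multiple of the squared gradient mapping.

  The step sizes need not be monotone in \<open>t\<close>, so their sum and the discounted noise are estimated by
  an invariant interval of the recursion for the discounted tails of the step sizes.
\<close>

section \<open>Step sizes\<close>

text \<open>The choice of \<beta> means (1 - \<beta>)^2 * b * (m + 1) = 1 and balances two noise
  sources. The batch variance \<sigma>^2 / b is weighted by the tail at 0, of order at most h / (1 -
  \<beta>) for a common lower bound h of the step sizes. The noise (1 - \<beta>)^2 \<sigma>^2 of
  each update is weighted by the sum of the later tails, at most the sum of the steps over 1 -
  \<beta>^2. Both contributions are of order (1 - \<beta>) times the sum of the steps. As h is at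
  least of order sqrt (1 - \<beta>) = (b (m + 1)) powr (-1/4), the same identity produces the
  exponents 1/4 and 3/4 in the rate.

  Integrability of the objective along the run is not given. Error bounds are therefore proved for
  extended integrals, and integrability follows inductively from pathwise descent and the lower
  bound of \<open>F\<close>. Conditioning on the past is replaced by Fubini for one fresh sample
  against the history.

  For the complexity claim, the outer bound divided by \<open>max 1 \<sigma>\<close> already
  measures the stages needed; without this division the cost would grow like \<sigma>^2 instead of
  \<sigma>.\<close>

definition discounted_tail :: "real \<Rightarrow> (nat \<Rightarrow> real) \<Rightarrow> nat \<Rightarrow> nat \<Rightarrow> real" where
  "discounted_tail \<beta> \<gamma> m t = (\<Sum>j=t..m. \<beta> ^ (2 * (j - t)) * \<gamma> j)"

lemma discounted_tail_Suc_eq_0: "discounted_tail \<beta> \<gamma> m (Suc m) = 0"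
  by (simp add: discounted_tail_def)

lemma discounted_tail_shift:
  "\<beta>\<^sup>2 * discounted_tail \<beta> \<gamma> m (Suc t) = (\<Sum>j=t+1..m. \<beta> ^ (2 * (j - t)) * \<gamma> j)"
proof -
  have "\<beta>\<^sup>2 * (\<beta> ^ (2 * (j - Suc t)) * \<gamma> j) = \<beta> ^ (2 * (j - t)) * \<gamma> j" if "j \<in> {Suc t..m}" for j
  proof -
    have "2 * (j - t) = 2 + 2 * (j - Suc t)" using that by auto
    then show ?thesis by (simp add: power_add power2_eq_square)
  qed
  then show ?thesis
    unfolding discounted_tail_def sum_distrib_left by (intro sum.cong) auto
qed

lemma discounted_tail_rec:
  assumes "t \<le> m"
  shows "discounted_tail \<beta> \<gamma> m t = \<gamma> t + \<beta>\<^sup>2 * discounted_tail \<beta> \<gamma> m (Suc t)"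
proof -
  have "{t..m} = insert t {t+1..m}" using assms by auto
  then have "discounted_tail \<beta> \<gamma> m t = \<gamma> t + (\<Sum>j=t+1..m. \<beta> ^ (2 * (j - t)) * \<gamma> j)"
    unfolding discounted_tail_def by simp
  then show ?thesis by (simp add: discounted_tail_shift)
qed

lemma discounted_tail_nonneg:
  assumes "\<And>t. t \<le> m \<Longrightarrow> 0 \<le> \<gamma> t" "0 \<le> \<beta>"
  shows "0 \<le> discounted_tail \<beta> \<gamma> m t"
  unfolding discounted_tail_def using assms by (intro sum_nonneg) auto

text \<open>Summation by parts in the tail recursion. Since the tail at 0 is nonnegative, it bounds
  the sum of the later tails, the total weight of the update noise, by the sum of the steps over 1 -
  \<beta>^2.\<close>

lemma sum_discounted_tail:
  "(\<Sum>t\<le>m. \<gamma> t) = discounted_tail \<beta> \<gamma> m 0 + (1 - \<beta>\<^sup>2) * (\<Sum>t\<le>m. discounted_tail \<beta> \<gamma> m (Suc t))"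
proof -
  let ?Y = "discounted_tail \<beta> \<gamma> m"
  have "(\<Sum>t\<le>m. \<gamma> t) = (\<Sum>t\<le>m. ?Y t - \<beta>\<^sup>2 * ?Y (Suc t))"
    by (rule sum.cong) (auto simp: discounted_tail_rec)
  also have "\<dots> = (\<Sum>t\<le>m. (?Y t - ?Y (Suc t)) + (1 - \<beta>\<^sup>2) * ?Y (Suc t))"
    by (simp add: algebra_simps)
  also have "\<dots> = (?Y 0 - ?Y (Suc m)) + (1 - \<beta>\<^sup>2) * (\<Sum>t\<le>m. ?Y (Suc t))"
    by (simp add: sum.distrib sum_distrib_left sum_telescope del: sum.atMost_Suc)
  finally show ?thesis by (simp add: discounted_tail_Suc_eq_0)
qed

text \<open>
  The tails \<open>s\<close> obey the reverse recursion \<open>s \<mapsto> \<beta>\<^sup>2 (s + a / (1 + \<kappa> s))\<close>; the interval \<open>[0, B]\<close> is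
  invariant under it as soon as both end points are mapped below \<open>B\<close>, because the map is convex.
\<close>

lemma step_recursion_invariant_bound:
  fixes a \<kappa> \<beta> :: real
  assumes a: "0 < a" "a \<le> 1" and k: "1 \<le> \<kappa>" "\<kappa> \<le> 2" and b: "0 < \<beta>" "\<beta> < 1"
  obtains B where "\<beta>\<^sup>2 * a \<le> B" "\<beta>\<^sup>2 * a \<le> (1 - \<beta>\<^sup>2) * B * (1 + \<kappa> * B)"
    "(1 - \<beta>\<^sup>2) * B * (1 + \<kappa> * B) \<le> (1 + 2 * \<beta>) * (\<beta>\<^sup>2 * a)"
    "1 + \<kappa> * B \<le> (1 + sqrt a) / sqrt (1 - \<beta>)"
proof -
  \<comment> \<open>The right end \<open>B\<close> is mapped below \<open>B\<close> iff \<beta>^2 a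
    \<le> \<open>p B\<close>, and the left end 0 is mapped to \<beta>^2 a. The smallest admissible
    \<open>B\<close> is taken: \<beta>^2 a itself if \<open>p\<close> is large enough there,
    otherwise the root of \<open>p B\<close> = \<beta>^2 a.\<close>
  define p where "p = (\<lambda>B. (1 - \<beta>\<^sup>2) * B * (1 + \<kappa> * B))"
  have b2: "\<beta>\<^sup>2 < 1" "0 < \<beta>\<^sup>2" "\<beta>\<^sup>2 \<le> \<beta>"
    using b by (auto simp: power_less_one_iff) (simp add: power2_eq_square mult_left_le)
  have q: "0 < sqrt (1 - \<beta>)" "sqrt (1 - \<beta>) \<le> 1" using b by auto
  then have one: "1 \<le> 1 / sqrt (1 - \<beta>)" by simp
  have sa: "a \<le> sqrt a" using a by (simp add: real_le_rsqrt power2_eq_square mult_left_le)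
  show thesis
  proof (cases "\<beta>\<^sup>2 * a \<le> p (\<beta>\<^sup>2 * a)")
    case True
    have ka: "\<kappa> * a \<le> 2" using mult_mono[of \<kappa> 2 a 1] a k by simp
    have "(1 - \<beta>\<^sup>2) * (1 + \<kappa> * (\<beta>\<^sup>2 * a)) \<le> (1 - \<beta>\<^sup>2) * (1 + 2 * \<beta>\<^sup>2)"
      using ka b2 by (intro mult_left_mono) (auto simp: mult.left_commute[of \<kappa>])
    also have "\<dots> \<le> 1 + \<beta>\<^sup>2" by (simp add: algebra_simps)
    also have "\<dots> \<le> 1 + 2 * \<beta>" using b2 b by simp
    finally have 1: "(1 - \<beta>\<^sup>2) * (1 + \<kappa> * (\<beta>\<^sup>2 * a)) * (\<beta>\<^sup>2 * a) \<le> (1 + 2 * \<beta>) * (\<beta>\<^sup>2 * a)"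
      using a by (intro mult_right_mono) auto
    \<comment> \<open>The squared form of 2 \<beta>^2 sqrt (1 - \<beta>) \<le> 1. By \<beta>^4 \<le>
      \<beta> it reduces to 4 \<beta> (1 - \<beta>) \<le> 1, that is (2 \<beta> - 1)^2 \<ge>
      0.\<close>
    have "(2 * sqrt a * \<beta>\<^sup>2 * sqrt (1 - \<beta>))\<^sup>2 = a * (4 * \<beta>\<^sup>2 * \<beta>\<^sup>2 * (1 - \<beta>))"
      using a b by (simp add: power_mult_distrib)
    also have "\<dots> \<le> a * 1"
    proof (intro mult_left_mono)
      have "\<beta>\<^sup>2 * \<beta>\<^sup>2 \<le> \<beta> * 1" using b b2(1,3) by (intro mult_mono) auto
      then have "4 * (\<beta>\<^sup>2 * \<beta>\<^sup>2) * (1 - \<beta>) \<le> 4 * \<beta> * (1 - \<beta>)"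
        using b by (intro mult_right_mono) auto
      also have "\<dots> \<le> 1" using zero_le_power2[of "2 * \<beta> - 1"] by (simp add: power2_eq_square algebra_simps)
      finally show "4 * \<beta>\<^sup>2 * \<beta>\<^sup>2 * (1 - \<beta>) \<le> 1" by (simp add: mult.assoc)
    qed (use a in auto)
    finally have "2 * sqrt a * \<beta>\<^sup>2 * sqrt (1 - \<beta>) \<le> sqrt a" by (simp add: real_le_rsqrt)
    then have 2: "2 * sqrt a * \<beta>\<^sup>2 \<le> sqrt a / sqrt (1 - \<beta>)"
      using q(1) by (simp only: pos_le_divide_eq)
    have "\<kappa> * (\<beta>\<^sup>2 * a) \<le> 2 * (\<beta>\<^sup>2 * sqrt a)" using k a sa by (intro mult_mono) auto
    with 2 have 3: "1 + \<kappa> * (\<beta>\<^sup>2 * a) \<le> (1 + sqrt a) / sqrt (1 - \<beta>)"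
      using one by (simp add: add_divide_distrib mult.commute mult.left_commute)
    show thesis
      by (rule that[of "\<beta>\<^sup>2 * a"]) (use True 1 3 in \<open>auto simp: p_def mult_ac\<close>)
  next
    case False
    \<comment> \<open>The root of the linear part of \<open>p\<close> B = \<beta>^2 a. The quadratic
      part only adds to \<open>p u\<close>, so \<open>u\<close> is a right end for the intermediate
      value theorem.\<close>
    define u where "u = \<beta>\<^sup>2 * a / (1 - \<beta>\<^sup>2)"
    have u: "\<beta>\<^sup>2 * a \<le> u" "(1 - \<beta>\<^sup>2) * u = \<beta>\<^sup>2 * a" "0 \<le> u"
      using b2 a by (auto simp: u_def field_simps mult_left_le_one_le)
    have "\<beta>\<^sup>2 * a * 1 \<le> \<beta>\<^sup>2 * a * (1 + \<kappa> * u)"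
      using u k a by (intro mult_left_mono) auto
    then have "\<beta>\<^sup>2 * a \<le> p u" using u by (simp add: p_def)
    moreover have "continuous_on {\<beta>\<^sup>2 * a..u} p" unfolding p_def by (intro continuous_intros)
    ultimately obtain B where B: "\<beta>\<^sup>2 * a \<le> B" "B \<le> u" "p B = \<beta>\<^sup>2 * a"
      using IVT'[of p "\<beta>\<^sup>2 * a" "\<beta>\<^sup>2 * a" u] False u by auto
    have B0: "0 \<le> B" using B(1) a by (smt (verit) zero_le_mult_iff zero_le_power2)
    have "0 \<le> \<kappa> * (1 - \<beta>\<^sup>2) * B" using B0 k b2 by simp
    moreover have "\<kappa> * p B = (\<kappa> * B)\<^sup>2 * (1 - \<beta>\<^sup>2) + \<kappa> * (1 - \<beta>\<^sup>2) * B"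
      by (simp add: p_def power2_eq_square algebra_simps)
    \<comment> \<open>Only the quadratic part of \<open>p\<close> is kept. With \<kappa> \<le> 2 and
      2 \<beta>^2 \<le> 1 + \<beta>, the factor 1 + \<beta> of 1 - \<beta>^2 cancels, leaving
      (\<kappa> B)^2 \<le> a / (1 - \<beta>).\<close>
    ultimately have "(\<kappa> * B)\<^sup>2 * (1 - \<beta>\<^sup>2) \<le> \<kappa> * p B" by linarith
    also have "\<dots> \<le> 2 * (\<beta>\<^sup>2 * a)" using B(3) a k by (simp add: mult_right_mono)
    also have "\<dots> \<le> (1 + \<beta>) * a"
    proof -
      have "2 * \<beta>\<^sup>2 \<le> 1 + \<beta>" using b2 b by simp
      then have "2 * \<beta>\<^sup>2 * a \<le> (1 + \<beta>) * a" using a by (intro mult_right_mono) auto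
      then show ?thesis by simp
    qed
    finally have "((\<kappa> * B)\<^sup>2 * (1 - \<beta>)) * (1 + \<beta>) \<le> a * (1 + \<beta>)"
      by (simp add: power2_eq_square algebra_simps)
    then have "(\<kappa> * B)\<^sup>2 * (1 - \<beta>) \<le> a" using b by simp
    then have "(\<kappa> * B)\<^sup>2 \<le> a / (1 - \<beta>)" using b by (simp add: field_simps)
    then have "\<kappa> * B \<le> sqrt (a / (1 - \<beta>))" by (rule real_le_rsqrt)
    then have 3: "1 + \<kappa> * B \<le> (1 + sqrt a) / sqrt (1 - \<beta>)"
      using one by (simp add: add_divide_distrib real_sqrt_divide)
    have "1 * (\<beta>\<^sup>2 * a) \<le> (1 + 2 * \<beta>) * (\<beta>\<^sup>2 * a)" using b a by (intro mult_right_mono) auto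
    then show thesis
      by (intro that[of B]) (use B 3 in \<open>auto simp: p_def\<close>)
  qed
qed

text \<open>The tails times \<beta>^2 never leave [0, B], so h = a / (1 + \<kappa> B) lies below
  every step. The last conclusion measures the weight of the initial error by the same h: the upper
  bound on (1 - \<beta>^2) B (1 + \<kappa> B) is divided by \<beta>^2 (1 + \<kappa> B).\<close>

lemma step_sizes_lower_bound:
  fixes a \<kappa> \<beta> :: real
  assumes a: "0 < a" "a \<le> 1" and k: "1 \<le> \<kappa>" "\<kappa> \<le> 2" and b: "0 < \<beta>" "\<beta> < 1"
    and g0: "\<And>t. t \<le> m \<Longrightarrow> 0 < \<gamma> t"
    and g: "\<And>t. t \<le> m \<Longrightarrow> \<gamma> t = a / (1 + \<kappa> * (\<beta>\<^sup>2 * discounted_tail \<beta> \<gamma> m (Suc t)))"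
  obtains h where "0 < h" "\<And>t. t \<le> m \<Longrightarrow> h \<le> \<gamma> t" "a * sqrt (1 - \<beta>) / (1 + sqrt a) \<le> h"
    "(1 - \<beta>\<^sup>2) * discounted_tail \<beta> \<gamma> m 0 \<le> (1 + 2 * \<beta>) * h"
proof -
  obtain B where B: "\<beta>\<^sup>2 * a \<le> B" "\<beta>\<^sup>2 * a \<le> (1 - \<beta>\<^sup>2) * B * (1 + \<kappa> * B)"
    "(1 - \<beta>\<^sup>2) * B * (1 + \<kappa> * B) \<le> (1 + 2 * \<beta>) * (\<beta>\<^sup>2 * a)"
    "1 + \<kappa> * B \<le> (1 + sqrt a) / sqrt (1 - \<beta>)"
    using step_recursion_invariant_bound[OF a k b] by blast
  have B0: "0 < B" using B(1) a b by (smt (verit) zero_less_mult_iff zero_less_power2)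
  have b2: "\<beta>\<^sup>2 < 1" "0 < \<beta>\<^sup>2" using b by (auto simp: power_less_one_iff)
  let ?Y = "discounted_tail \<beta> \<gamma> m"
  have Y0: "0 \<le> ?Y t" for t using discounted_tail_nonneg[of m \<gamma> \<beta> t] g0 b by (force intro: less_imp_le)
  have inv: "\<beta>\<^sup>2 * (s + a / (1 + \<kappa> * s)) \<le> B" if s: "0 \<le> s" "s \<le> B" for s
  proof -
    have pos: "0 < 1 + \<kappa> * s" using s k by (simp add: add_pos_nonneg)
    have "\<beta>\<^sup>2 * (s * (1 + \<kappa> * s) + a) \<le> B * (1 + \<kappa> * s)"
    proof -
      \<comment> \<open>Q(s) = B (1 + \<kappa> s) - \<beta>^2 (s (1 + \<kappa> s) + a) is concave in
        s. Hence B Q(s) is the chord (B - s) Q(0) + s Q(B) plus a curvature term; \<open>e0\<close>,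
        \<open>e1\<close>, \<open>e2\<close> are these three nonnegative summands.\<close>
      have e0: "0 \<le> (B - s) * (B - \<beta>\<^sup>2 * a)" using s B by simp
      have e1: "0 \<le> s * ((1 - \<beta>\<^sup>2) * B * (1 + \<kappa> * B) - \<beta>\<^sup>2 * a)" using s B by simp
      have e2: "0 \<le> \<beta>\<^sup>2 * \<kappa> * (s * (B - s) * B)" using s B0 k b2 by simp
      have "B * (B * (1 + \<kappa> * s) - \<beta>\<^sup>2 * (s * (1 + \<kappa> * s) + a)) =
         (B - s) * (B - \<beta>\<^sup>2 * a) + s * ((1 - \<beta>\<^sup>2) * B * (1 + \<kappa> * B) - \<beta>\<^sup>2 * a)
          + \<beta>\<^sup>2 * \<kappa> * (s * (B - s) * B)"
        by (simp add: algebra_simps)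
      then have "0 \<le> B * (B * (1 + \<kappa> * s) - \<beta>\<^sup>2 * (s * (1 + \<kappa> * s) + a))"
        using e0 e1 e2 by linarith
      then show ?thesis using B0 by (simp add: zero_le_mult_iff)
    qed
    then show ?thesis using pos by (simp add: field_simps)
  qed
  \<comment> \<open>Downward induction from the empty tail at \<open>Suc m\<close>, since each tail
    is computed from the next one.\<close>
  have tail: "\<beta>\<^sup>2 * ?Y t \<le> B" if "t \<le> Suc m" for t
    using that
  proof (induction rule: inc_induct)
    case base
    then show ?case using B0 by (simp add: discounted_tail_Suc_eq_0)
  next
    case (step t)
    then have t: "t \<le> m" by simp
    have "?Y t = a / (1 + \<kappa> * (\<beta>\<^sup>2 * ?Y (Suc t))) + \<beta>\<^sup>2 * ?Y (Suc t)"
      using discounted_tail_rec[OF t, of \<beta> \<gamma>] g[OF t] by simp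
    then show ?case using inv[of "\<beta>\<^sup>2 * ?Y (Suc t)"] step.IH Y0[of "Suc t"] by (simp add: add.commute)
  qed
  define h where "h = a / (1 + \<kappa> * B)"
  have kB: "0 < 1 + \<kappa> * B" using k B0 by (simp add: add_pos_nonneg)
  show thesis
  proof (rule that[of h])
    show "0 < h" using a kB by (simp add: h_def)
    show "h \<le> \<gamma> t" if "t \<le> m" for t
    proof -
      have "0 \<le> \<kappa> * (\<beta>\<^sup>2 * ?Y (Suc t))" using k Y0[of "Suc t"] by simp
      moreover have "\<kappa> * (\<beta>\<^sup>2 * ?Y (Suc t)) \<le> \<kappa> * B" using tail[of "Suc t"] that k by (intro mult_left_mono) auto
      ultimately show ?thesis unfolding h_def g[OF that] using a
        by (intro divide_left_mono) (auto simp: add_pos_nonneg)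
    qed
    have "a / ((1 + sqrt a) / sqrt (1 - \<beta>)) \<le> h"
      unfolding h_def using a kB B(4) b by (intro divide_left_mono) (auto intro!: mult_pos_pos divide_pos_pos add_pos_nonneg)
    then show "a * sqrt (1 - \<beta>) / (1 + sqrt a) \<le> h" by simp
    have "(1 - \<beta>\<^sup>2) * (\<beta>\<^sup>2 * ?Y 0) * (1 + \<kappa> * B) \<le> (1 - \<beta>\<^sup>2) * B * (1 + \<kappa> * B)"
      using tail[of 0] b2 kB by (intro mult_right_mono mult_left_mono) auto
    also have "\<dots> \<le> (1 + 2 * \<beta>) * (\<beta>\<^sup>2 * a)" by (rule B(3))
    finally have "\<beta>\<^sup>2 * ((1 - \<beta>\<^sup>2) * ?Y 0 * (1 + \<kappa> * B)) \<le> \<beta>\<^sup>2 * ((1 + 2 * \<beta>) * a)"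
      by (simp add: mult_ac)
    then have "(1 - \<beta>\<^sup>2) * ?Y 0 * (1 + \<kappa> * B) \<le> (1 + 2 * \<beta>) * a" using b2 by simp
    then show "(1 - \<beta>\<^sup>2) * ?Y 0 \<le> (1 + 2 * \<beta>) * h"
      unfolding h_def using kB by (simp add: pos_le_divide_eq)
  qed
qed

text \<open>
  The potential \<open>V t + w t * E t\<close> decreases, where the weights \<open>w t\<close>, multiples of the discounted
  tails, are the solution of the backward recursion that makes the coefficient of \<open>D t\<close> vanish
  beyond what is needed to pay for \<open>G t\<close>.
\<close>

lemma stage_descent:
  fixes V E D G :: "nat \<Rightarrow> real"
  assumes L: "0 < L" and eta: "0 < \<eta>" and b: "0 < \<beta>" "\<beta> < 1"
    and g0: "\<And>t. t \<le> m \<Longrightarrow> 0 < \<gamma> t"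
    and g: "\<And>t. t \<le> m \<Longrightarrow> L * \<gamma> t * (1 + \<kappa> * (\<beta>\<^sup>2 * discounted_tail \<beta> \<gamma> m (Suc t))) = \<delta>"
    and k: "\<kappa> = 1 + L\<^sup>2 * \<eta>\<^sup>2"
    and V: "\<And>t. t \<le> m \<Longrightarrow> V (Suc t) + \<gamma> t / 2 * (\<delta> + L - L * \<gamma> t) * D t \<le> V t + \<gamma> t / (2 * L) * E t"
    and G: "\<And>t. t \<le> m \<Longrightarrow> \<eta>\<^sup>2 * G t \<le> 2 * D t + 2 * \<eta>\<^sup>2 * E t"
    and E: "\<And>t. t < m \<Longrightarrow> E (Suc t) \<le> \<beta>\<^sup>2 * E t + \<beta>\<^sup>2 * L\<^sup>2 * (\<gamma> t)\<^sup>2 * D t + \<nu>"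
  shows "L * \<eta>\<^sup>2 / 4 * (\<Sum>t\<le>m. \<gamma> t * G t) + V (Suc m)
     \<le> V 0 + \<kappa> / (2 * L) * (discounted_tail \<beta> \<gamma> m 0 * E 0 + \<nu> * (\<Sum>t\<le>m. discounted_tail \<beta> \<gamma> m (Suc t)))"
proof -
  let ?Y = "discounted_tail \<beta> \<gamma> m"
  have Y0: "0 \<le> ?Y t" for t using discounted_tail_nonneg[of m \<gamma> \<beta> t] g0 b by (force intro: less_imp_le)
  have k1: "1 \<le> \<kappa>" using k by simp
  have step: "L * \<eta>\<^sup>2 / 4 * (\<gamma> t * G t) + V (Suc t) + \<kappa> / (2 * L) * (?Y (Suc t) * E (Suc t))
     \<le> V t + \<kappa> / (2 * L) * (?Y t * E t) + \<kappa> / (2 * L) * (\<nu> * ?Y (Suc t))" if t: "t \<le> m" for t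
  proof -
    let ?R = "\<beta>\<^sup>2 * E t + \<beta>\<^sup>2 * L\<^sup>2 * (\<gamma> t)\<^sup>2 * D t + \<nu>"
    have "?Y (Suc t) * E (Suc t) \<le> ?Y (Suc t) * ?R"
    \<comment> \<open>At \<open>t = m\<close> the weight \<open>?Y (Suc m)\<close> is 0, so no bound
      on \<open>E (Suc m)\<close> enters: a stage has no estimator with that index.\<close>
    proof (cases "t < m")
      case True
      then show ?thesis using E Y0 by (intro mult_left_mono) auto
    next
      case False
      then show ?thesis using t discounted_tail_Suc_eq_0[of \<beta> \<gamma> m] by simp
    qed
    then have 1: "\<kappa> / (2 * L) * (?Y (Suc t) * E (Suc t)) \<le> \<kappa> / (2 * L) * (?Y (Suc t) * ?R)"
      by (rule mult_left_mono) (use k1 L in auto)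
    have 2: "L / 4 * \<gamma> t * (\<eta>\<^sup>2 * G t) \<le> L / 4 * \<gamma> t * (2 * D t + 2 * \<eta>\<^sup>2 * E t)"
      using G[OF t] g0[OF t] L by (intro mult_left_mono) auto
    have 3: "\<kappa> / (2 * L) * (?Y t * E t) =
        \<kappa> / (2 * L) * (\<gamma> t * E t) + \<kappa> / (2 * L) * (?Y (Suc t) * (\<beta>\<^sup>2 * E t))"
      using discounted_tail_rec[OF t, of \<beta> \<gamma>] by (simp add: algebra_simps)
    \<comment> \<open>The origin of \<kappa> = 1 + L^2 \<eta>^2: the 1 pays for the error in the
      descent of \<open>V\<close>, the other summand for the error in the bound on
      \<open>G\<close>.\<close>
    have 4: "\<kappa> / (2 * L) * (\<gamma> t * E t) = \<gamma> t / (2 * L) * E t + L / 4 * \<gamma> t * (2 * \<eta>\<^sup>2 * E t)"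
      using L by (simp add: k field_simps power2_eq_square)
    \<comment> \<open>The step size equation \<open>g\<close> splits the available multiple of
      \<open>D t\<close> exactly into the growth of the next error and the part of
      \<open>G t\<close> due to the prox step.\<close>
    have "\<gamma> t / 2 * (\<delta> + L - L * \<gamma> t) * D t =
       \<gamma> t / 2 * (L * \<gamma> t * (1 + \<kappa> * (\<beta>\<^sup>2 * ?Y (Suc t))) + L - L * \<gamma> t) * D t"
      using g[OF t] by simp
    also have "\<dots> = \<kappa> / (2 * L) * (?Y (Suc t) * (\<beta>\<^sup>2 * L\<^sup>2 * (\<gamma> t)\<^sup>2 * D t)) + L / 4 * \<gamma> t * (2 * D t)"
      using L by (simp add: field_simps power2_eq_square)
    finally have 5: "\<gamma> t / 2 * (\<delta> + L - L * \<gamma> t) * D t =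
        \<kappa> / (2 * L) * (?Y (Suc t) * (\<beta>\<^sup>2 * L\<^sup>2 * (\<gamma> t)\<^sup>2 * D t)) + L / 4 * \<gamma> t * (2 * D t)" .
    have 6: "\<kappa> / (2 * L) * (?Y (Suc t) * ?R) = \<kappa> / (2 * L) * (?Y (Suc t) * (\<beta>\<^sup>2 * E t))
       + \<kappa> / (2 * L) * (?Y (Suc t) * (\<beta>\<^sup>2 * L\<^sup>2 * (\<gamma> t)\<^sup>2 * D t)) + \<kappa> / (2 * L) * (\<nu> * ?Y (Suc t))"
      by (simp only: distrib_left mult_ac)
    have 7: "L * \<eta>\<^sup>2 / 4 * (\<gamma> t * G t) = L / 4 * \<gamma> t * (\<eta>\<^sup>2 * G t)" by simp
    have 8: "L / 4 * \<gamma> t * (2 * D t + 2 * \<eta>\<^sup>2 * E t) =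
       L / 4 * \<gamma> t * (2 * D t) + L / 4 * \<gamma> t * (2 * \<eta>\<^sup>2 * E t)" by (simp only: distrib_left)
    show ?thesis
      using V[OF t] 1 2 3 4 5 6 7 8 by linarith
  qed
  have "L * \<eta>\<^sup>2 / 4 * (\<Sum>t<n. \<gamma> t * G t) + V n + \<kappa> / (2 * L) * (?Y n * E n)
     \<le> V 0 + \<kappa> / (2 * L) * (?Y 0 * E 0) + \<kappa> / (2 * L) * (\<nu> * (\<Sum>t<n. ?Y (Suc t)))" if "n \<le> Suc m" for n
    using that
  proof (induction n)
    case 0
    show ?case by simp
  next
    case (Suc n)
    then show ?case using step[of n] by (simp add: distrib_left)
  qed
  from this[of "Suc m"] show ?thesis
    by (simp add: discounted_tail_Suc_eq_0 lessThan_Suc_atMost distrib_left del: sum.lessThan_Suc sum.atMost_Suc)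
qed

section \<open>Gradients and the proximal operator\<close>

text \<open>\<open>grad\<close> is a definite description, so existence and uniqueness are both
  shown: the Riesz vector of the derivative in the standard basis, and testing two candidates
  against their difference.\<close>

lemma gderiv_grad:
  fixes h :: "'a::euclidean_space \<Rightarrow> real"
  assumes "h differentiable (at x)"
  shows "GDERIV h x :> grad h x"
proof -
  obtain h' where h': "(h has_derivative h') (at x)"
    using assms by (auto simp: differentiable_def)
  interpret bounded_linear h' using h' by (rule has_derivative_bounded_linear)
  have "h' u = inner u (\<Sum>i\<in>Basis. h' i *\<^sub>R i)" for u
  proof -
    have "h' u = h' (\<Sum>i\<in>Basis. inner u i *\<^sub>R i)" by (simp add: euclidean_representation)
    also have "\<dots> = (\<Sum>i\<in>Basis. inner u i * h' i)" by (simp add: sum scaleR)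
    finally show ?thesis by (simp add: inner_sum_right mult.commute)
  qed
  then have D: "GDERIV h x :> (\<Sum>i\<in>Basis. h' i *\<^sub>R i)"
    using h' unfolding gderiv_def by (metis (no_types, lifting) ext)
  moreover have "d = e" if "GDERIV h x :> d" "GDERIV h x :> e" for d e
  proof -
    have "(\<lambda>u. inner u d) = (\<lambda>u. inner u e)"
      using that unfolding gderiv_def by (rule has_derivative_unique)
    then have "inner u d = inner u e" for u by metis
    then have "inner (d - e) (d - e) = 0" by (metis inner_diff_right right_minus_eq)
    then show ?thesis by simp
  qed
  ultimately show ?thesis unfolding grad_def by (metis theI)
qed

text \<open>The Lipschitz bound is available on a convex set only, later the domain of \<psi>. The
  defect along the segment from x to y has nonpositive derivative, which avoids integrating the
  gradient.\<close>

lemma descent_lemma: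
  fixes f :: "'a::euclidean_space \<Rightarrow> real"
  assumes f: "\<And>x. f differentiable (at x)"
    and D: "convex D" "x \<in> D" "y \<in> D"
    and lip: "\<And>u v. u \<in> D \<Longrightarrow> v \<in> D \<Longrightarrow> norm (grad f u - grad f v) \<le> L * norm (u - v)"
  shows "f y \<le> f x + inner (grad f x) (y - x) + L / 2 * (norm (y - x))\<^sup>2"
proof -
  define d where "d = y - x"
  define g where "g t = f (x + t *\<^sub>R d) - t * inner (grad f x) d - L / 2 * t\<^sup>2 * (norm d)\<^sup>2" for t
  have "g 1 \<le> g 0"
  proof (rule DERIV_nonpos_imp_nonincreasing[of 0 1 g])
    fix t :: real assume t: "0 \<le> t" "t \<le> 1"
    define z where "z = x + t *\<^sub>R d"
    have "z = (1 - t) *\<^sub>R x + t *\<^sub>R y" by (simp add: z_def d_def algebra_simps)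
    then have z: "z \<in> D" using D t by (simp add: convexD_alt)
    have "((\<lambda>t. f (x + t *\<^sub>R d)) has_derivative (\<lambda>h. inner (h *\<^sub>R d) (grad f z))) (at t)"
      using gderiv_grad[OF f, of z] unfolding gderiv_def z_def
      by (rule has_derivative_compose[rotated]) (auto intro!: derivative_eq_intros)
    then have "((\<lambda>t. f (x + t *\<^sub>R d)) has_real_derivative inner (grad f z) d) (at t)"
      unfolding has_field_derivative_def by (rule has_derivative_eq_rhs) (auto simp: inner_commute mult.commute)
    then have "(g has_real_derivative inner (grad f z) d - inner (grad f x) d - L * t * (norm d)\<^sup>2) (at t)"
      unfolding g_def by (auto intro!: derivative_eq_intros)
    moreover have "inner (grad f z - grad f x) d \<le> L * t * (norm d)\<^sup>2"
    proof -
      have "inner (grad f z - grad f x) d \<le> norm (grad f z - grad f x) * norm d" by (rule norm_cauchy_schwarz)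
      also have "\<dots> \<le> L * norm (z - x) * norm d" using lip[OF z D(2)] by (rule mult_right_mono) simp
      also have "\<dots> = L * t * (norm d)\<^sup>2" using t by (simp add: z_def power2_eq_square)
      finally show ?thesis .
    qed
    ultimately show "\<exists>l. (g has_real_derivative l) (at t) \<and> l \<le> 0"
      by (auto simp: inner_diff_left)
  qed simp
  then show ?thesis by (simp add: g_def d_def)
qed

section \<open>The proximal map: existence, optimality condition, nonexpansiveness, descent\<close>

locale prox_setup =
  fixes \<psi> :: "'a::euclidean_space \<Rightarrow> ereal" and \<eta> :: real
  assumes pcc: "proper_closed_convex \<psi>" and eta_pos: "0 < \<eta>"
begin

text \<open>Real arithmetic replaces that of \<open>ereal\<close>. Off the domain the value is the
  meaningless \<open>real_of_ereal \<infinity>\<close> = 0, so the inequalities below carry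
  membership in \<open>eff_dom \<psi>\<close>.\<close>

definition \<psi>r :: "'a \<Rightarrow> real" where "\<psi>r x = real_of_ereal (\<psi> x)"

abbreviation pr :: "'a \<Rightarrow> 'a" where "pr \<equiv> prox (\<lambda>u. ereal \<eta> * \<psi> u)"

lemma psi_eq_psir: "x \<in> eff_dom \<psi> \<Longrightarrow> \<psi> x = ereal (\<psi>r x)"
  using pcc by (auto simp: \<psi>r_def proper_closed_convex_def eff_dom_def ereal_real)

lemma epi_psir: "x \<in> eff_dom \<psi> \<Longrightarrow> (x, r) \<in> epi \<psi> \<longleftrightarrow> \<psi>r x \<le> r"
  by (simp add: epi_def psi_eq_psir)

lemma epi_imp_dom: "(x, r) \<in> epi \<psi> \<Longrightarrow> x \<in> eff_dom \<psi>"
  by (auto simp: epi_def eff_dom_def)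

lemma psir_convex:
  assumes "x \<in> eff_dom \<psi>" "y \<in> eff_dom \<psi>" "0 \<le> t" "t \<le> 1"
  shows "(1 - t) *\<^sub>R x + t *\<^sub>R y \<in> eff_dom \<psi>"
    and "\<psi>r ((1 - t) *\<^sub>R x + t *\<^sub>R y) \<le> (1 - t) * \<psi>r x + t * \<psi>r y"
proof -
  have "convex (epi \<psi>)" using pcc by (simp add: proper_closed_convex_def)
  moreover have "(x, \<psi>r x) \<in> epi \<psi>" "(y, \<psi>r y) \<in> epi \<psi>" using assms epi_psir by auto
  ultimately have "(1 - t) *\<^sub>R (x, \<psi>r x) + t *\<^sub>R (y, \<psi>r y) \<in> epi \<psi>"
    using assms(3,4) by (intro convexD_alt) auto
  then have *: "((1 - t) *\<^sub>R x + t *\<^sub>R y, (1 - t) * \<psi>r x + t * \<psi>r y) \<in> epi \<psi>" by simp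
  then show "(1 - t) *\<^sub>R x + t *\<^sub>R y \<in> eff_dom \<psi>" by (rule epi_imp_dom)
  with * show "\<psi>r ((1 - t) *\<^sub>R x + t *\<^sub>R y) \<le> (1 - t) * \<psi>r x + t * \<psi>r y" by (simp add: epi_psir)
qed

lemma convex_dom: "convex (eff_dom \<psi>)"
  using psir_convex(1) by (simp add: convex_alt)

text \<open>A hyperplane separates the closed convex epigraph from a point one unit below the graph.
  It is not vertical: lifting that point by 1 crosses it, so the last coefficient is positive and
  can be divided out. The minorant makes the prox objective coercive.\<close>

lemma affine_minorant:
  "\<exists>a c. \<forall>x r. (x, r) \<in> epi \<psi> \<longrightarrow> c - inner a x \<le> r"
proof -
  obtain x1 where x1: "x1 \<in> eff_dom \<psi>" using pcc by (auto simp: proper_closed_convex_def)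
  have "(x1, \<psi>r x1 - 1) \<notin> epi \<psi>" using x1 by (simp add: epi_psir)
  then obtain z c where z: "inner z (x1, \<psi>r x1 - 1) < c" "\<And>w. w \<in> epi \<psi> \<Longrightarrow> inner z w > c"
    using separating_hyperplane_closed_point[of "epi \<psi>" "(x1, \<psi>r x1 - 1)"] pcc
    unfolding proper_closed_convex_def by blast
  obtain a s where [simp]: "z = (a, s)" by (cases z)
  have "inner z (x1, \<psi>r x1) > c" using z(2)[of "(x1, \<psi>r x1)"] x1 by (simp add: epi_psir)
  with z(1) have s: "0 < s" by (simp add: right_diff_distrib)
  show ?thesis
  proof (intro exI allI impI)
    fix x r assume "(x, r) \<in> epi \<psi>"
    then have "c < inner a x + s * r" using z(2) by fastforce
    then show "c / s - inner (a /\<^sub>R s) x \<le> r"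
      using s by (simp add: field_simps)
  qed
qed

text \<open>\<psi> is only lower semicontinuous, so the minimization is moved to the epigraph: there
  the objective is the continuous \<open>g\<close>, the constraint set is closed, and coercivity
  makes a sublevel set compact.\<close>

lemma prox_objective_min_exists:
  obtains p where "p \<in> eff_dom \<psi>"
    "\<And>u. u \<in> eff_dom \<psi> \<Longrightarrow> \<eta> * \<psi>r p + (norm (p - y))\<^sup>2 / 2 \<le> \<eta> * \<psi>r u + (norm (u - y))\<^sup>2 / 2"
proof -
  obtain x1 where x1: "x1 \<in> eff_dom \<psi>" using pcc by (auto simp: proper_closed_convex_def)
  obtain a c where ac: "\<forall>x r. (x, r) \<in> epi \<psi> \<longrightarrow> c - inner a x \<le> r"
    using affine_minorant by (elim exE)
  define g where "g = (\<lambda>z::'a \<times> real. \<eta> * snd z + (norm (fst z - y))\<^sup>2 / 2)"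
  define C where "C = g (x1, \<psi>r x1)"
  define K where "K = epi \<psi> \<inter> {z. g z \<le> C}"
  define A where "A = \<eta> * norm a"
  define K0 where "K0 = C - \<eta> * c + A * norm y"
  \<comment> \<open>Chosen so that n^2 / 2 \<le> K0 + A n forces n \<le> R.\<close>
  define R where "R = 1 + 2 * \<bar>K0\<bar> + 2 * A"
  have cont: "continuous_on UNIV g" unfolding g_def by (intro continuous_intros) auto
  have "closed K" unfolding K_def
    using pcc cont by (intro closed_Int closed_Collect_le) (auto simp: proper_closed_convex_def)
  moreover have "K \<subseteq> cball y R \<times> {c - norm a * (R + norm y)..C / \<eta>}"
  proof
    fix z assume z: "z \<in> K"
    obtain u r where ur: "z = (u, r)" by (cases z)
    define n where "n = norm (u - y)"
    have A: "0 \<le> A" using eta_pos by (simp add: A_def)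
    have e: "c - inner a u \<le> r" using z ur ac by (auto simp: K_def)
    have gC: "\<eta> * r + n\<^sup>2 / 2 \<le> C" using z ur by (auto simp: K_def g_def n_def)
    have au: "inner a u \<le> norm a * (n + norm y)"
    proof -
      have "inner a u \<le> norm a * norm u" by (rule norm_cauchy_schwarz)
      also have "\<dots> \<le> norm a * (n + norm y)"
        unfolding n_def by (intro mult_left_mono) (auto intro: norm_triangle_sub simp: add.commute)
      finally show ?thesis .
    qed
    have "\<eta> * (c - norm a * (n + norm y)) \<le> \<eta> * r"
      using e au eta_pos by (intro mult_left_mono) auto
    then have q: "n\<^sup>2 / 2 \<le> K0 + A * n" using gC by (simp add: K0_def A_def algebra_simps)
    have n: "n \<le> R"
    proof (rule ccontr)
      assume "\<not> n \<le> R"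
      then have n1: "n > 1 + 2 * \<bar>K0\<bar> + 2 * A" by (simp add: R_def)
      then have "n * (2 * \<bar>K0\<bar> + 2 * A) < n * n" using A by (intro mult_strict_left_mono) auto
      moreover have "1 * \<bar>K0\<bar> \<le> n * \<bar>K0\<bar>" using n1 A by (intro mult_right_mono) auto
      ultimately show False using q by (simp add: power2_eq_square algebra_simps)
    qed
    have "norm a * (n + norm y) \<le> norm a * (R + norm y)" using n by (intro mult_left_mono) auto
    then have "c - norm a * (R + norm y) \<le> r" using e au by linarith
    moreover have "r \<le> C / \<eta>"
    proof -
      have "0 \<le> n\<^sup>2 / 2" by simp
      then have "\<eta> * r \<le> C" using gC by linarith
      then show ?thesis using eta_pos by (simp add: field_simps)
    qed
    ultimately show "z \<in> cball y R \<times> {c - norm a * (R + norm y)..C / \<eta>}"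
      using n by (simp add: ur n_def dist_norm norm_minus_commute)
  qed
  moreover have "compact (cball y R \<times> {c - norm a * (R + norm y)..C / \<eta>})"
    by (intro compact_Times) auto
  ultimately have "compact K" by (metis closed_Int_compact inf.absorb_iff1)
  moreover have x1K: "(x1, \<psi>r x1) \<in> K" using x1 by (simp add: K_def C_def epi_psir)
  ultimately obtain z where z: "z \<in> K" "\<And>w. w \<in> K \<Longrightarrow> g z \<le> g w"
    using continuous_attains_inf[of K g] continuous_on_subset[OF cont, of K] by blast
  obtain p r where pr: "z = (p, r)" by (cases z)
  have pe: "(p, r) \<in> epi \<psi>" using z pr by (simp add: K_def)
  have p: "p \<in> eff_dom \<psi>" using pe by (rule epi_imp_dom)
  show thesis
  proof (rule that[OF p])
    fix u assume u: "u \<in> eff_dom \<psi>"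
    have "\<psi>r p \<le> r" using pe p epi_psir by simp
    then have "g (p, \<psi>r p) \<le> g z" using eta_pos by (simp add: g_def pr)
    also have "g z \<le> g (u, \<psi>r u)"
    proof (cases "g (u, \<psi>r u) \<le> C")
      case True
      then show ?thesis using u by (intro z(2)) (simp add: K_def epi_psir)
    next
      case False
      then show ?thesis using z(2)[OF x1K] by (simp add: C_def)
    qed
    finally show "\<eta> * \<psi>r p + (norm (p - y))\<^sup>2 / 2 \<le> \<eta> * \<psi>r u + (norm (u - y))\<^sup>2 / 2"
      by (simp add: g_def)
  qed
qed

lemma prox_objective_eq:
  "u \<in> eff_dom \<psi> \<Longrightarrow>
     ereal \<eta> * \<psi> u + ereal ((norm (u - y))\<^sup>2 / 2) = ereal (\<eta> * \<psi>r u + (norm (u - y))\<^sup>2 / 2)"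
  by (simp add: psi_eq_psir)

lemma prox_objective_top:
  "u \<notin> eff_dom \<psi> \<Longrightarrow> ereal \<eta> * \<psi> u + ereal ((norm (u - y))\<^sup>2 / 2) = \<infinity>"
  using eta_pos by (simp add: eff_dom_def)

text \<open>\<open>arg_min\<close> is a Hilbert choice and carries information only once a minimizer
  exists. The objective is infinite off the domain, so the chosen point lies inside.\<close>

lemma pr_minimizes:
  shows pr_in_dom: "pr y \<in> eff_dom \<psi>"
    and pr_min: "u \<in> eff_dom \<psi> \<Longrightarrow>
      \<eta> * \<psi>r (pr y) + (norm (pr y - y))\<^sup>2 / 2 \<le> \<eta> * \<psi>r u + (norm (u - y))\<^sup>2 / 2"
proof -
  let ?g = "\<lambda>u. ereal \<eta> * \<psi> u + ereal ((norm (u - y))\<^sup>2 / 2)"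
  obtain p where p: "p \<in> eff_dom \<psi>"
    "\<And>u. u \<in> eff_dom \<psi> \<Longrightarrow> \<eta> * \<psi>r p + (norm (p - y))\<^sup>2 / 2 \<le> \<eta> * \<psi>r u + (norm (u - y))\<^sup>2 / 2"
    using prox_objective_min_exists[of y] by blast
  have "?g p \<le> ?g u" for u
    by (cases "u \<in> eff_dom \<psi>") (use p in \<open>simp_all add: prox_objective_eq prox_objective_top\<close>)
  then have "is_arg_min ?g (\<lambda>_. True) p" by (auto simp: is_arg_min_def not_less)
  then have "is_arg_min ?g (\<lambda>_. True) (pr y)"
    unfolding prox_def arg_min_def by (rule someI)
  then have min: "?g (pr y) \<le> ?g u" for u by (auto simp: is_arg_min_def not_less)
  show dom: "pr y \<in> eff_dom \<psi>"
    using min[of p] p(1) prox_objective_top[of "pr y" y] prox_objective_eq[of p y] by force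
  show "\<eta> * \<psi>r (pr y) + (norm (pr y - y))\<^sup>2 / 2 \<le> \<eta> * \<psi>r u + (norm (u - y))\<^sup>2 / 2" if "u \<in> eff_dom \<psi>"
    using min[of u] by (simp add: prox_objective_eq[OF that] prox_objective_eq[OF dom])
qed

text \<open>First-order optimality without subdifferentials: the minimizer is compared with points
  of the segment towards u, the inequality is divided by t, and a small t contradicts a negative
  first-order term.\<close>

lemma pr_variational:
  assumes u: "u \<in> eff_dom \<psi>"
  shows "inner (y - pr y) (u - pr y) \<le> \<eta> * (\<psi>r u - \<psi>r (pr y))"
proof (rule ccontr)
  define p where "p = pr y"
  define i where "i = inner (y - p) (u - p)"
  define X where "X = \<eta> * (\<psi>r u - \<psi>r p) - i"
  define c where "c = (norm (u - p))\<^sup>2 / 2"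
  assume "\<not> ?thesis"
  then have X: "X < 0" by (simp add: X_def p_def i_def)
  have p: "p \<in> eff_dom \<psi>" by (simp add: p_def pr_in_dom)
  have key: "0 \<le> X + t * c" if t: "0 < t" "t \<le> 1" for t
  proof -
    let ?w = "(1 - t) *\<^sub>R p + t *\<^sub>R u"
    have "\<eta> * \<psi>r p + (norm (p - y))\<^sup>2 / 2 \<le> \<eta> * \<psi>r ?w + (norm (?w - y))\<^sup>2 / 2"
      using pr_min[of ?w y] psir_convex(1)[OF p u] t by (simp add: p_def)
    also have "\<dots> \<le> \<eta> * ((1 - t) * \<psi>r p + t * \<psi>r u) + (norm (?w - y))\<^sup>2 / 2"
      using psir_convex(2)[OF p u, of t] t eta_pos by simp
    also have "(norm (?w - y))\<^sup>2 = (norm ((p - y) + t *\<^sub>R (u - p)))\<^sup>2"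
      by (simp add: algebra_simps)
    also have "\<dots> = (norm (p - y))\<^sup>2 - 2 * t * i + t\<^sup>2 * (norm (u - p))\<^sup>2"
      unfolding power2_norm_eq_inner i_def
      by (simp add: algebra_simps inner_simps inner_commute power2_eq_square)
    finally have "0 \<le> t * (X + t * c)"
      by (simp add: X_def c_def algebra_simps power2_eq_square add_divide_distrib diff_divide_distrib)
    then show ?thesis using t by (simp add: zero_le_mult_iff)
  qed
  show False
  proof (cases "c = 0")
    case True
    then show False using key[of 1] X by simp
  next
    case False
    then have c: "0 < c" by (simp add: c_def)
    \<comment> \<open>With this t the second-order term is at most -X / 2, so the sum stays
      negative.\<close>
    define t where "t = min 1 (- X / (2 * c))"
    have "0 < t" "t \<le> 1" using X c by (auto simp: t_def field_simps)
    moreover have "t * c \<le> (- X / (2 * c)) * c" using c by (intro mult_right_mono) (auto simp: t_def)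
    ultimately show False using key[of t] X c by simp
  qed
qed

text \<open>The optimality conditions at y and z, each tested at the other prox point, are added.
  This yields continuity, hence measurability of the iterates, and the comparison of exact with
  estimated gradient steps.\<close>

lemma pr_nonexpansive: "norm (pr y - pr z) \<le> norm (y - z)"
proof -
  let ?d = "pr y - pr z"
  have "inner (y - pr y) (pr z - pr y) + inner (z - pr z) (pr y - pr z) \<le> 0"
    using pr_variational[of "pr z" y] pr_variational[of "pr y" z] pr_in_dom
    by (simp add: algebra_simps)
  then have "(norm ?d)\<^sup>2 \<le> inner (y - z) ?d"
    unfolding power2_norm_eq_inner by (simp add: inner_simps inner_commute)
  also have "\<dots> \<le> norm (y - z) * norm ?d" by (rule norm_cauchy_schwarz)
  finally have "norm ?d * norm ?d \<le> norm (y - z) * norm ?d" by (simp add: power2_eq_square)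
  then show ?thesis by (cases "norm ?d = 0") (auto simp: mult_le_cancel_right)
qed

lemma continuous_on_pr: "continuous_on UNIV pr"
  by (rule lipschitz_on_continuous_on[of 1], rule lipschitz_onI)
     (auto simp: dist_norm pr_nonexpansive)

lemma borel_measurable_pr [measurable]: "pr \<in> borel_measurable borel"
  by (rule borel_measurable_continuous_onI) (rule continuous_on_pr)

text \<open>Sublevel sets of \<psi> at real levels are slices of the closed epigraph, hence
  closed.\<close>

lemma borel_measurable_psir [measurable]: "\<psi>r \<in> borel_measurable borel"
proof -
  have "\<psi> \<in> borel_measurable borel"
  proof (rule borel_measurableI_le)
    fix y
    show "{x \<in> space borel. \<psi> x \<le> y} \<in> sets borel"
    proof (cases y)
      case (real r)
      have "{x. \<psi> x \<le> y} = (\<lambda>x. (x, r)) -` epi \<psi>" by (auto simp: epi_def real)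
      moreover have "closed ((\<lambda>x. (x, r)) -` epi \<psi>)"
        using pcc by (intro continuous_closed_vimage) (auto simp: proper_closed_convex_def intro!: continuous_intros)
      ultimately show ?thesis by simp
    next
      case PInf
      then show ?thesis by simp
    next
      case MInf
      then have "{x \<in> space borel. \<psi> x \<le> y} = {}" using pcc by (auto simp: proper_closed_convex_def)
      then show ?thesis by (metis sets.empty_sets)
    qed
  qed
  then have "(\<lambda>x. real_of_ereal (\<psi> x)) \<in> borel_measurable borel" by measurable
  then show ?thesis by (simp add: \<psi>r_def[abs_def])
qed

text \<open>The variational inequality is tested at the current point x and the cross term with v -
  \<open>grad f x\<close> is split by Young's inequality with weight L. This weight turns the
  coefficient of the squared step into \<delta> + L - L g for \<delta> = 2 / \<eta> - 2 L.\<close>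

lemma prox_step_descent:
  assumes f: "\<And>x. f differentiable (at x)"
    and lip: "\<And>u v. u \<in> eff_dom \<psi> \<Longrightarrow> v \<in> eff_dom \<psi> \<Longrightarrow> norm (grad f u - grad f v) \<le> L * norm (u - v)"
    and L: "0 < L" and x: "x \<in> eff_dom \<psi>" and g: "0 < g" "g \<le> 1"
    and xh: "xh = pr (x - \<eta> *\<^sub>R v)" and x': "x' = (1 - g) *\<^sub>R x + g *\<^sub>R xh"
  shows "f x' + \<psi>r x' + g / 2 * (2 / \<eta> - L - L * g) * (norm (xh - x))\<^sup>2
     \<le> f x + \<psi>r x + g / (2 * L) * (norm (v - grad f x))\<^sup>2"
proof -
  define d where "d = xh - x"
  have h: "xh \<in> eff_dom \<psi>" by (simp add: xh pr_in_dom)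
  have x'D: "x' \<in> eff_dom \<psi>" and c: "\<psi>r x' \<le> (1 - g) * \<psi>r x + g * \<psi>r xh"
    unfolding x' using psir_convex[OF x h, of g] g by auto
  have x'd: "x' - x = g *\<^sub>R d" by (simp add: x' d_def algebra_simps)
  have 1: "f x' \<le> f x + g * inner (grad f x) d + L / 2 * g\<^sup>2 * (norm d)\<^sup>2"
    using descent_lemma[OF f convex_dom x x'D lip] g by (simp add: x'd power_mult_distrib)
  have "inner ((x - \<eta> *\<^sub>R v) - xh) (x - xh) \<le> \<eta> * (\<psi>r x - \<psi>r xh)"
    unfolding xh by (rule pr_variational[OF x])
  moreover have "inner ((x - \<eta> *\<^sub>R v) - xh) (x - xh) = (norm d)\<^sup>2 + \<eta> * inner v d"
    unfolding power2_norm_eq_inner d_def by (simp add: inner_simps inner_commute algebra_simps)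
  ultimately have "\<psi>r xh \<le> \<psi>r x - (norm d)\<^sup>2 / \<eta> - inner v d"
    using eta_pos by (simp add: field_simps)
  then have 2: "g * \<psi>r xh \<le> g * (\<psi>r x - (norm d)\<^sup>2 / \<eta> - inner v d)"
    using g by (intro mult_left_mono) auto
  have 3: "g * inner (grad f x - v) d \<le> g * ((norm (v - grad f x))\<^sup>2 / (2 * L) + L / 2 * (norm d)\<^sup>2)"
  proof (intro mult_left_mono)
    have "0 \<le> (norm ((grad f x - v) - L *\<^sub>R d))\<^sup>2" by simp
    also have "\<dots> = (norm (v - grad f x))\<^sup>2 - 2 * L * inner (grad f x - v) d + L\<^sup>2 * (norm d)\<^sup>2"
      unfolding power2_norm_eq_inner
      by (simp add: inner_simps inner_commute algebra_simps power2_eq_square)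
    finally show "inner (grad f x - v) d \<le> (norm (v - grad f x))\<^sup>2 / (2 * L) + L / 2 * (norm d)\<^sup>2"
      using L by (simp add: field_simps power2_eq_square)
  qed (use g in auto)
  have "f x' + \<psi>r x' \<le> f x + \<psi>r x + g * inner (grad f x - v) d
      - g * (norm d)\<^sup>2 / \<eta> + L / 2 * g\<^sup>2 * (norm d)\<^sup>2"
    using 1 2 c by (simp add: algebra_simps inner_diff_left)
  also have "\<dots> \<le> f x + \<psi>r x + g * ((norm (v - grad f x))\<^sup>2 / (2 * L) + L / 2 * (norm d)\<^sup>2)
      - g * (norm d)\<^sup>2 / \<eta> + L / 2 * g\<^sup>2 * (norm d)\<^sup>2"
    using 3 by linarith
  finally show ?thesis
    using eta_pos L by (simp add: d_def[symmetric] field_simps power2_eq_square)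
qed

text \<open>The exact and the estimated prox point differ by at most \<eta> times the estimator
  error; then (p + q)^2 \<le> 2 p^2 + 2 q^2.\<close>

lemma gradient_mapping_bound:
  assumes xh: "xh = pr (x - \<eta> *\<^sub>R v)"
  shows "\<eta>\<^sup>2 * (norm (gradient_mapping f \<psi> \<eta> x))\<^sup>2
    \<le> 2 * (norm (xh - x))\<^sup>2 + 2 * \<eta>\<^sup>2 * (norm (v - grad f x))\<^sup>2"
proof -
  let ?p = "pr (x - \<eta> *\<^sub>R grad f x)"
  have "norm (?p - xh) \<le> norm ((x - \<eta> *\<^sub>R grad f x) - (x - \<eta> *\<^sub>R v))"
    unfolding xh by (rule pr_nonexpansive)
  also have "(x - \<eta> *\<^sub>R grad f x) - (x - \<eta> *\<^sub>R v) = \<eta> *\<^sub>R (v - grad f x)" by (simp add: algebra_simps)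
  finally have 1: "norm (?p - xh) \<le> \<eta> * norm (v - grad f x)" using eta_pos by simp
  have "\<eta> * norm (gradient_mapping f \<psi> \<eta> x) = norm (x - ?p)"
    using eta_pos by (simp add: gradient_mapping_def)
  also have "\<dots> \<le> norm (xh - x) + norm (?p - xh)"
    using norm_triangle_ineq[of "xh - x" "?p - xh"] by (simp add: norm_minus_commute)
  finally have "\<eta> * norm (gradient_mapping f \<psi> \<eta> x) \<le> norm (xh - x) + \<eta> * norm (v - grad f x)"
    using 1 by simp
  then have "(\<eta> * norm (gradient_mapping f \<psi> \<eta> x))\<^sup>2 \<le> (norm (xh - x) + \<eta> * norm (v - grad f x))\<^sup>2"
    using eta_pos by (intro power_mono) auto
  also have "\<dots> \<le> 2 * (norm (xh - x))\<^sup>2 + 2 * (\<eta> * norm (v - grad f x))\<^sup>2"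
    using zero_le_power2[of "norm (xh - x) - \<eta> * norm (v - grad f x)"]
    by (simp add: power2_eq_square algebra_simps)
  finally show ?thesis by (simp add: power_mult_distrib)
qed

end

section \<open>Second moments and independent samples\<close>

text \<open>The identity is a limit of simple functions. On their finite ranges measurability in w
  suffices, and continuity in x carries it to the limit. This makes sample gradients at random
  points measurable.\<close>

lemma measurable_caratheodory:
  fixes g :: "'w \<Rightarrow> 'a::{metric_space, second_countable_topology} \<Rightarrow> 'b::metric_space"
  assumes meas: "\<And>x. (\<lambda>w. g w x) \<in> borel_measurable P"
    and cont: "\<And>w. w \<in> space P \<Longrightarrow> continuous_on UNIV (g w)"
  shows "(\<lambda>(x, w). g w x) \<in> borel_measurable (borel \<Otimes>\<^sub>M P)"
proof -
  obtain s where s: "\<And>i. simple_function borel (s i)" "\<And>x. (\<lambda>i. s i x) \<longlonglongrightarrow> (x::'a)"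
    using borel_measurable_implies_sequence_metric[of "\<lambda>x. x" "borel :: 'a measure" undefined]
    by auto
  show ?thesis
  proof (rule borel_measurable_LIMSEQ_metric[where f = "\<lambda>i (x, w). g w (s i x)"])
    fix i
    have fin: "finite (range (s i))" using s(1)[of i] by (simp add: simple_function_def)
    have "s i \<in> measurable borel (count_space UNIV)" using s(1) by (rule measurable_simple_function)
    then have "s i \<in> measurable borel (count_space (range (s i)))"
      using fin by (auto simp: measurable_count_space_eq2 dest: measurable_sets)
    then have "(\<lambda>z. s i (fst z)) \<in> measurable (borel \<Otimes>\<^sub>M P) (count_space (range (s i)))"
      by (rule measurable_compose[OF measurable_fst])
    then have "(\<lambda>z. g (snd z) (s i (fst z))) \<in> borel_measurable (borel \<Otimes>\<^sub>M P)"
      by (rule measurable_compose_countable'[where f = "\<lambda>y z. g (snd z) y", rotated])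
         (use meas fin in \<open>auto intro: measurable_compose[OF measurable_snd] countable_finite\<close>)
    then show "(\<lambda>(x, w). g w (s i x)) \<in> borel_measurable (borel \<Otimes>\<^sub>M P)" by (simp add: case_prod_beta)
  next
    fix z :: "'a \<times> 'w" assume "z \<in> space (borel \<Otimes>\<^sub>M P)"
    then have "continuous_on UNIV (g (snd z))" using cont by (auto simp: space_pair_measure)
    then have "(\<lambda>i. g (snd z) (s i (fst z))) \<longlonglongrightarrow> g (snd z) (fst z)"
      by (rule continuous_on_tendsto_compose[OF _ s(2)]) auto
    then show "(\<lambda>i. case z of (x, w) \<Rightarrow> g w (s i x)) \<longlonglongrightarrow> (case z of (x, w) \<Rightarrow> g w x)"
      by (simp add: case_prod_beta)
  qed
qed

text \<open>The cross term has mean zero. The extended integral covers an infinite second moment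
  too: |\<phi>|^2 \<le> 2 |c + \<phi>|^2 + 2 |c|^2 then makes both sides infinite.\<close>

lemma (in prob_space) nn_integral_norm_shift:
  fixes \<phi> :: "'a \<Rightarrow> 'b::euclidean_space"
  assumes int: "integrable M \<phi>" and mean: "(\<integral>w. \<phi> w \<partial>M) = 0"
  shows "(\<integral>\<^sup>+w. ennreal ((norm (c + \<phi> w))\<^sup>2) \<partial>M) = ennreal ((norm c)\<^sup>2) + (\<integral>\<^sup>+w. ennreal ((norm (\<phi> w))\<^sup>2) \<partial>M)"
proof (cases "(\<integral>\<^sup>+w. ennreal ((norm (\<phi> w))\<^sup>2) \<partial>M) = \<infinity>")
  case True
  have [measurable]: "\<phi> \<in> borel_measurable M" using int by auto
  have "(\<integral>\<^sup>+w. ennreal ((norm (\<phi> w))\<^sup>2) \<partial>M)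
      \<le> (\<integral>\<^sup>+w. ennreal 2 * ennreal ((norm (c + \<phi> w))\<^sup>2) + ennreal (2 * (norm c)\<^sup>2) \<partial>M)"
  proof (rule nn_integral_mono)
    fix w
    have "norm (\<phi> w) \<le> norm (c + \<phi> w) + norm c"
      using norm_triangle_ineq4[of "c + \<phi> w" c] by simp
    then have "(norm (\<phi> w))\<^sup>2 \<le> (norm (c + \<phi> w) + norm c)\<^sup>2" by (intro power_mono) auto
    also have "\<dots> \<le> 2 * (norm (c + \<phi> w))\<^sup>2 + 2 * (norm c)\<^sup>2"
      using zero_le_power2[of "norm (c + \<phi> w) - norm c"] by (simp add: power2_eq_square algebra_simps)
    finally have "ennreal ((norm (\<phi> w))\<^sup>2) \<le> ennreal (2 * (norm (c + \<phi> w))\<^sup>2 + 2 * (norm c)\<^sup>2)"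
      by (rule ennreal_leI)
    also have "\<dots> = ennreal 2 * ennreal ((norm (c + \<phi> w))\<^sup>2) + ennreal (2 * (norm c)\<^sup>2)"
      by (simp add: ennreal_plus ennreal_mult)
    finally show "ennreal ((norm (\<phi> w))\<^sup>2)
        \<le> ennreal 2 * ennreal ((norm (c + \<phi> w))\<^sup>2) + ennreal (2 * (norm c)\<^sup>2)" .
  qed
  also have "\<dots> = ennreal 2 * (\<integral>\<^sup>+w. ennreal ((norm (c + \<phi> w))\<^sup>2) \<partial>M) + ennreal (2 * (norm c)\<^sup>2)"
    by (simp add: nn_integral_add nn_integral_cmult emeasure_space_1)
  finally have "(\<integral>\<^sup>+w. ennreal ((norm (c + \<phi> w))\<^sup>2) \<partial>M) = \<infinity>"
    using True by (auto simp: top_unique ennreal_mult_eq_top_iff)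
  with True show ?thesis by simp
next
  case False
  have [measurable]: "\<phi> \<in> borel_measurable M" using int by auto
  have sq: "integrable M (\<lambda>w. (norm (\<phi> w))\<^sup>2)"
    using False by (intro integrableI_bounded) (auto simp: less_top[symmetric])
  have ex: "(norm (c + \<phi> w))\<^sup>2 = (norm c)\<^sup>2 + 2 * inner c (\<phi> w) + (norm (\<phi> w))\<^sup>2" for w
    unfolding power2_norm_eq_inner by (simp add: inner_simps inner_commute)
  have ic: "integrable M (\<lambda>w. inner c (\<phi> w))" using int by simp
  have "(\<integral>w. inner c (\<phi> w) \<partial>M) = 0" using mean int by simp
  then have I: "(\<integral>w. (norm (c + \<phi> w))\<^sup>2 \<partial>M) = (norm c)\<^sup>2 + (\<integral>w. (norm (\<phi> w))\<^sup>2 \<partial>M)"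
    unfolding ex using sq ic by (simp add: prob_space)
  have "integrable M (\<lambda>w. (norm (c + \<phi> w))\<^sup>2)" unfolding ex using sq ic by simp
  then have "(\<integral>\<^sup>+w. ennreal ((norm (c + \<phi> w))\<^sup>2) \<partial>M) = ennreal (\<integral>w. (norm (c + \<phi> w))\<^sup>2 \<partial>M)"
    by (intro nn_integral_eq_integral) auto
  also have "\<dots> = ennreal ((norm c)\<^sup>2) + ennreal (\<integral>w. (norm (\<phi> w))\<^sup>2 \<partial>M)"
    unfolding I by (rule ennreal_plus) auto
  also have "ennreal (\<integral>w. (norm (\<phi> w))\<^sup>2 \<partial>M) = (\<integral>\<^sup>+w. ennreal ((norm (\<phi> w))\<^sup>2) \<partial>M)"
    using sq by (intro nn_integral_eq_integral[symmetric]) auto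
  finally show ?thesis .
qed

text \<open>Dropping one summand on the right gives Jensen's inequality, dropping the other bounds
  the variance by the second moment; both are used for gradient differences.\<close>

lemma (in prob_space) second_moment_decomposition:
  fixes \<phi> :: "'a \<Rightarrow> 'b::euclidean_space"
  assumes int: "integrable M \<phi>"
  shows "(\<integral>\<^sup>+w. ennreal ((norm (\<phi> w))\<^sup>2) \<partial>M) =
    ennreal ((norm (\<integral>w. \<phi> w \<partial>M))\<^sup>2) + (\<integral>\<^sup>+w. ennreal ((norm (\<phi> w - (\<integral>w. \<phi> w \<partial>M)))\<^sup>2) \<partial>M)"
  using nn_integral_norm_shift[of "\<lambda>w. \<phi> w - (\<integral>w. \<phi> w \<partial>M)" "\<integral>w. \<phi> w \<partial>M"] int
  by (simp add: prob_space)

text \<open>Independence makes the joint law the product of the marginals, so Fubini applies. This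
  stands in for conditioning on \<open>U\<close>, which is either the past or the random output
  index.\<close>

lemma (in prob_space) nn_integral_indep_set:
  assumes U: "U \<in> measurable M N" and Y: "Y \<in> measurable M K"
    and ind: "indep_set {U -` A \<inter> space M | A. A \<in> sets N} {Y -` B \<inter> space M | B. B \<in> sets K}"
    and H: "case_prod H \<in> borel_measurable (N \<Otimes>\<^sub>M K)"
  shows "(\<integral>\<^sup>+w. H (U w) (Y w) \<partial>M) = (\<integral>\<^sup>+w. (\<integral>\<^sup>+y. H (U w) y \<partial>distr M K Y) \<partial>M)"
proof -
  interpret N: prob_space "distr M N U" using U by (rule prob_space_distr)
  interpret K: prob_space "distr M K Y" using Y by (rule prob_space_distr)
  have D: "distr M N U \<Otimes>\<^sub>M distr M K Y = distr M (N \<Otimes>\<^sub>M K) (\<lambda>w. (U w, Y w))"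
  proof (rule pair_measure_eqI)
    fix A B assume "A \<in> sets (distr M N U)" "B \<in> sets (distr M K Y)"
    then have A: "A \<in> sets N" and B: "B \<in> sets K" by auto
    have "prob ((U -` A \<inter> space M) \<inter> (Y -` B \<inter> space M)) = prob (U -` A \<inter> space M) * prob (Y -` B \<inter> space M)"
      using A B by (intro indep_setD[OF ind]) auto
    moreover have "(\<lambda>w. (U w, Y w)) -` (A \<times> B) \<inter> space M = (U -` A \<inter> space M) \<inter> (Y -` B \<inter> space M)" by auto
    ultimately show "emeasure (distr M N U) A * emeasure (distr M K Y) B
        = emeasure (distr M (N \<Otimes>\<^sub>M K) (\<lambda>w. (U w, Y w))) (A \<times> B)"
      using A B U Y by (simp add: emeasure_distr emeasure_eq_measure ennreal_mult)
  qed (auto intro: N.sigma_finite_measure_axioms K.sigma_finite_measure_axioms)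
  have H': "case_prod H \<in> borel_measurable (distr M N U \<Otimes>\<^sub>M distr M K Y)"
    using H by (simp cong: measurable_cong_sets sets_pair_measure_cong)
  have H'': "case_prod H \<in> borel_measurable (N \<Otimes>\<^sub>M distr M K Y)"
    using H by (simp cong: measurable_cong_sets sets_pair_measure_cong)
  have "(\<integral>\<^sup>+w. H (U w) (Y w) \<partial>M) = (\<integral>\<^sup>+z. case_prod H z \<partial>distr M (N \<Otimes>\<^sub>M K) (\<lambda>w. (U w, Y w)))"
    using H U Y by (subst nn_integral_distr) auto
  also have "\<dots> = (\<integral>\<^sup>+u. \<integral>\<^sup>+y. H u y \<partial>distr M K Y \<partial>distr M N U)"
    unfolding D[symmetric] using K.nn_integral_fst[OF H'] by simp
  also have "\<dots> = (\<integral>\<^sup>+w. (\<integral>\<^sup>+y. H (U w) y \<partial>distr M K Y) \<partial>M)"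
    using U K.borel_measurable_nn_integral[OF H''] by (subst nn_integral_distr) auto
  finally show ?thesis .
qed

section \<open>Histories of samples and one fresh independent sample\<close>

locale iid_samples = prob_space M for M :: "'o measure" +
  fixes P :: "'w measure" and X :: "'i \<Rightarrow> 'o \<Rightarrow> 'w" and I :: "'i set"
  assumes indep: "indep_vars (\<lambda>_. P) X I"
    and law: "\<And>i. i \<in> I \<Longrightarrow> distr M P (X i) = P"
begin

text \<open>A sigma-algebra packaged as a measure only so that \<open>measurable\<close> accepts it;
  integrals are always taken over \<open>M\<close>.\<close>

definition hist :: "'i set \<Rightarrow> 'o measure" where
  "hist J = vimage_algebra (space M) (\<lambda>\<omega>. \<lambda>i\<in>J. X i \<omega>) (PiM J (\<lambda>_. P))"

lemma X_measurable: "i \<in> I \<Longrightarrow> X i \<in> measurable M P"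
  using indep by (auto simp: indep_vars_def)

lemma restrict_measurable: "J \<subseteq> I \<Longrightarrow> (\<lambda>\<omega>. \<lambda>i\<in>J. X i \<omega>) \<in> measurable M (PiM J (\<lambda>_. P))"
  by (intro measurable_restrict X_measurable) auto

lemma space_hist [simp]: "space (hist J) = space M"
  by (simp add: hist_def)

lemma sets_hist:
  "sets (hist J) = sigma_sets (space M) {(\<lambda>\<omega>. \<lambda>i\<in>J. X i \<omega>) -` B \<inter> space M | B. B \<in> sets (PiM J (\<lambda>_. P))}"
  by (simp add: hist_def sets_vimage_algebra)

lemma restrict_measurable_hist: "J \<subseteq> I \<Longrightarrow> (\<lambda>\<omega>. \<lambda>i\<in>J. X i \<omega>) \<in> measurable (hist J) (PiM J (\<lambda>_. P))"
  unfolding hist_def by (rule measurable_vimage_algebra1) (use restrict_measurable in \<open>auto dest: measurable_space\<close>)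

lemma X_measurable_hist: "i \<in> J \<Longrightarrow> J \<subseteq> I \<Longrightarrow> X i \<in> measurable (hist J) P"
  using measurable_compose[OF restrict_measurable_hist measurable_component_singleton, of J i] by simp

lemma sets_hist_mono: "J \<subseteq> K \<Longrightarrow> K \<subseteq> I \<Longrightarrow> sets (hist J) \<subseteq> sets (hist K)"
  unfolding hist_def[of J]
  by (rule sets_image_in_sets) (auto intro!: measurable_restrict X_measurable_hist)

lemma measurable_hist_mono: "f \<in> measurable (hist J) N \<Longrightarrow> J \<subseteq> K \<Longrightarrow> K \<subseteq> I \<Longrightarrow> f \<in> measurable (hist K) N"
  using measurable_mono[of N N "hist J" "hist K"] sets_hist_mono[of J K] by auto

lemma measurable_hist: "f \<in> measurable (hist J) N \<Longrightarrow> J \<subseteq> I \<Longrightarrow> f \<in> measurable M N"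
  using measurable_mono[of N N "hist J" M] sets_image_in_sets[of M "space M" "\<lambda>\<omega>. \<lambda>i\<in>J. X i \<omega>" "PiM J (\<lambda>_. P)"]
    restrict_measurable by (auto simp: hist_def)

text \<open>Grouping independent variables into the disjoint blocks J and {i} keeps independence,
  and \<open>U\<close> depends on the first block only.\<close>

lemma indep_set_hist:
  assumes J: "J \<subseteq> I" and i: "i \<in> I" "i \<notin> J" and U: "U \<in> measurable (hist J) N"
  shows "indep_set {U -` A \<inter> space M | A. A \<in> sets N} {X i -` B \<inter> space M | B. B \<in> sets P}"
proof -
  have "indep_var (PiM J (\<lambda>_. P)) (\<lambda>\<omega>. \<lambda>i\<in>J. X i \<omega>) (PiM {i} (\<lambda>_. P)) (\<lambda>\<omega>. \<lambda>i\<in>{i}. X i \<omega>)"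
    using J i by (intro indep_var_restrict[OF indep]) auto
  then have "indep_set (sets (hist J)) (sets (hist {i}))"
    unfolding indep_var_eq sets_hist by simp
  moreover have "{U -` A \<inter> space M | A. A \<in> sets N} \<subseteq> sets (hist J)"
    using measurable_sets[OF U] by auto
  moreover have "{X i -` B \<inter> space M | B. B \<in> sets P} \<subseteq> sets (hist {i})"
    using measurable_sets[OF X_measurable_hist[of i "{i}"]] i by auto
  ultimately show ?thesis
    unfolding indep_set_def by (elim indep_sets_mono_sets) (simp split: bool.split)
qed

text \<open>The past, which fixes \<open>g\<close> and the parameter \<open>z\<close>, is frozen
  while the new sample is integrated out. The increment is centered for each frozen parameter, so
  the cross term vanishes, and the variance bound may depend on the past.\<close>

lemma fresh_sample_second_moment:
  fixes g :: "'o \<Rightarrow> 'b::euclidean_space" and z :: "'o \<Rightarrow> 'c::{second_countable_topology, t2_space}"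
  assumes J: "J \<subseteq> I" and i: "i \<in> I" "i \<notin> J"
    and g: "g \<in> borel_measurable (hist J)" and z: "z \<in> borel_measurable (hist J)"
    and \<phi>: "case_prod \<phi> \<in> borel_measurable (borel \<Otimes>\<^sub>M P)"
    and int: "\<And>\<omega>. \<omega> \<in> space M \<Longrightarrow> integrable P (\<phi> (z \<omega>))"
    and mean: "\<And>\<omega>. \<omega> \<in> space M \<Longrightarrow> (\<integral>y. \<phi> (z \<omega>) y \<partial>P) = 0"
    and var: "\<And>\<omega>. \<omega> \<in> space M \<Longrightarrow> (\<integral>\<^sup>+y. ennreal ((norm (\<phi> (z \<omega>) y))\<^sup>2) \<partial>P) \<le> c \<omega>"
  shows "(\<integral>\<^sup>+\<omega>. ennreal ((norm (g \<omega> + \<phi> (z \<omega>) (X i \<omega>)))\<^sup>2) \<partial>M)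
      \<le> (\<integral>\<^sup>+\<omega>. ennreal ((norm (g \<omega>))\<^sup>2) \<partial>M) + (\<integral>\<^sup>+\<omega>. c \<omega> \<partial>M)"
proof -
  interpret P: prob_space P
    using prob_space_distr[OF X_measurable[OF i(1)]] by (simp add: law[OF i(1)])
  have [measurable]: "g \<in> borel_measurable M" using measurable_hist[OF g J] .
  let ?H = "\<lambda>u y. ennreal ((norm (fst u + \<phi> (snd u) y))\<^sup>2)"
  note [measurable] = \<phi>
  have H: "case_prod ?H \<in> borel_measurable ((borel \<Otimes>\<^sub>M borel) \<Otimes>\<^sub>M P)"
    by measurable
  have U: "(\<lambda>\<omega>. (g \<omega>, z \<omega>)) \<in> measurable (hist J) (borel \<Otimes>\<^sub>M borel)"
    using g z by (rule measurable_Pair)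
  have "(\<integral>\<^sup>+\<omega>. ennreal ((norm (g \<omega> + \<phi> (z \<omega>) (X i \<omega>)))\<^sup>2) \<partial>M)
      = (\<integral>\<^sup>+\<omega>. \<integral>\<^sup>+y. ennreal ((norm (g \<omega> + \<phi> (z \<omega>) y))\<^sup>2) \<partial>P \<partial>M)"
    using nn_integral_indep_set[OF measurable_hist[OF U J] X_measurable[OF i(1)] indep_set_hist[OF J i U] H] by (simp add: law[OF i(1)])
  also have "\<dots> = (\<integral>\<^sup>+\<omega>. ennreal ((norm (g \<omega>))\<^sup>2) + (\<integral>\<^sup>+y. ennreal ((norm (\<phi> (z \<omega>) y))\<^sup>2) \<partial>P) \<partial>M)"
    using int mean by (intro nn_integral_cong P.nn_integral_norm_shift) auto
  also have "\<dots> = (\<integral>\<^sup>+\<omega>. ennreal ((norm (g \<omega>))\<^sup>2) \<partial>M) + (\<integral>\<^sup>+\<omega>. (\<integral>\<^sup>+y. ennreal ((norm (\<phi> (z \<omega>) y))\<^sup>2) \<partial>P) \<partial>M)"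
  proof (rule nn_integral_add)
    have [measurable]: "z \<in> borel_measurable M" using measurable_hist[OF z J] .
    show "(\<lambda>\<omega>. \<integral>\<^sup>+y. ennreal ((norm (\<phi> (z \<omega>) y))\<^sup>2) \<partial>P) \<in> borel_measurable M" by measurable
  qed measurable
  also have "\<dots> \<le> (\<integral>\<^sup>+\<omega>. ennreal ((norm (g \<omega>))\<^sup>2) \<partial>M) + (\<integral>\<^sup>+\<omega>. c \<omega> \<partial>M)"
    using var by (intro add_left_mono nn_integral_mono) auto
  finally show ?thesis .
qed

end

section \<open>The restarted iteration\<close>

locale stochastic_composite = prox_setup \<psi> \<eta> + P: prob_space P
  for \<psi> :: "'a::euclidean_space \<Rightarrow> ereal" and \<eta> :: real and P :: "'w measure" +
  fixes fs :: "'w \<Rightarrow> 'a \<Rightarrow> real" and f :: "'a \<Rightarrow> real" and L \<sigma> :: real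
  assumes fs_smooth: "\<And>\<xi>. \<xi> \<in> space P \<Longrightarrow> continuously_differentiable (fs \<xi>)"
    and f_differentiable: "\<And>x. f differentiable (at x)"
    and grad_integrable: "\<And>x. integrable P (\<lambda>\<xi>. grad (fs \<xi>) x)"
    and unbiased: "\<And>x. (\<integral>\<xi>. grad (fs \<xi>) x \<partial>P) = grad f x"
    and L_pos: "0 < L"
    and mean_square_smooth: "\<And>x y. x \<in> eff_dom \<psi> \<Longrightarrow> y \<in> eff_dom \<psi> \<Longrightarrow>
        (\<integral>\<^sup>+ \<xi>. ennreal ((norm (grad (fs \<xi>) x - grad (fs \<xi>) y))\<^sup>2) \<partial>P) \<le> ennreal (L\<^sup>2 * (norm (x - y))\<^sup>2)"
    and sigma_nonneg: "0 \<le> \<sigma>"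
    and bounded_variance: "\<And>x. x \<in> eff_dom \<psi> \<Longrightarrow>
        (\<integral>\<^sup>+ \<xi>. ennreal ((norm (grad (fs \<xi>) x - grad f x))\<^sup>2) \<partial>P) \<le> ennreal (\<sigma>\<^sup>2)"
begin

lemma grad_fs_measurable: "(\<lambda>(x, \<xi>). grad (fs \<xi>) x) \<in> borel_measurable (borel \<Otimes>\<^sub>M P)"
  using grad_integrable fs_smooth
  by (intro measurable_caratheodory) (auto simp: continuously_differentiable_def)

lemma grad_fs_measurable' [measurable (raw)]:
  assumes "x \<in> borel_measurable N" "w \<in> measurable N P"
  shows "(\<lambda>z. grad (fs (w z)) (x z)) \<in> borel_measurable N"
  using measurable_compose[OF measurable_Pair[OF assms] grad_fs_measurable] by simp

text \<open>\<open>f\<close> is differentiable everywhere, but its gradient is controlled on the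
  domain only; measurability on the whole space comes from unbiasedness and Fubini.\<close>

lemma grad_f_measurable [measurable]: "grad f \<in> borel_measurable borel"
proof -
  have "(\<lambda>x. \<integral>\<xi>. grad (fs \<xi>) x \<partial>P) \<in> borel_measurable borel"
    by (rule P.borel_measurable_lebesgue_integral) (rule grad_fs_measurable)
  then show ?thesis by (simp add: unbiased)
qed

lemma f_measurable [measurable]: "f \<in> borel_measurable borel"
  using f_differentiable by (intro borel_measurable_continuous_onI continuous_at_imp_continuous_on)
    (auto intro: differentiable_imp_continuous_within)

definition \<Phi> :: "'a \<Rightarrow> real" where "\<Phi> u = f u + \<psi>r u"

lemma Phi_measurable [measurable]: "\<Phi> \<in> borel_measurable borel"
  unfolding \<Phi>_def[abs_def] by measurable

lemma gradient_mapping_measurable [measurable]: "gradient_mapping f \<psi> \<eta> \<in> borel_measurable borel"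
  unfolding gradient_mapping_def[abs_def] by measurable

lemma grad_diff_integrable: "integrable P (\<lambda>\<xi>. grad (fs \<xi>) x - grad (fs \<xi>) y)"
  by (intro Bochner_Integration.integrable_diff grad_integrable)

lemma grad_diff_mean: "(\<integral>\<xi>. grad (fs \<xi>) x - grad (fs \<xi>) y \<partial>P) = grad f x - grad f y"
  by (simp add: unbiased grad_integrable)

lemma grad_f_lipschitz:
  assumes "x \<in> eff_dom \<psi>" "y \<in> eff_dom \<psi>"
  shows "norm (grad f x - grad f y) \<le> L * norm (x - y)"
proof -
  have "ennreal ((norm (grad f x - grad f y))\<^sup>2)
      \<le> (\<integral>\<^sup>+ \<xi>. ennreal ((norm (grad (fs \<xi>) x - grad (fs \<xi>) y))\<^sup>2) \<partial>P)"
    using P.second_moment_decomposition[OF grad_diff_integrable, of x y] by (simp add: grad_diff_mean)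
  also have "\<dots> \<le> ennreal (L\<^sup>2 * (norm (x - y))\<^sup>2)" using assms by (rule mean_square_smooth)
  finally have "(norm (grad f x - grad f y))\<^sup>2 \<le> (L * norm (x - y))\<^sup>2"
    by (simp add: power_mult_distrib)
  then show ?thesis by (rule power2_le_imp_le) (use L_pos in auto)
qed

lemma grad_diff_variance:
  assumes "x \<in> eff_dom \<psi>" "y \<in> eff_dom \<psi>"
  shows "(\<integral>\<^sup>+ \<xi>. ennreal ((norm (grad (fs \<xi>) x - grad (fs \<xi>) y - (grad f x - grad f y)))\<^sup>2) \<partial>P)
    \<le> ennreal (L\<^sup>2 * (norm (x - y))\<^sup>2)"
proof -
  have "(\<integral>\<^sup>+ \<xi>. ennreal ((norm (grad (fs \<xi>) x - grad (fs \<xi>) y - (grad f x - grad f y)))\<^sup>2) \<partial>P)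
      \<le> (\<integral>\<^sup>+ \<xi>. ennreal ((norm (grad (fs \<xi>) x - grad (fs \<xi>) y))\<^sup>2) \<partial>P)"
    using P.second_moment_decomposition[OF grad_diff_integrable, of x y] by (simp add: grad_diff_mean)
  also have "\<dots> \<le> ennreal (L\<^sup>2 * (norm (x - y))\<^sup>2)" using assms by (rule mean_square_smooth)
  finally show ?thesis .
qed

end

lemma nn_integral_norm_scaleR:
  assumes "u \<in> borel_measurable N"
  shows "(\<integral>\<^sup>+w. ennreal ((norm (c *\<^sub>R u w))\<^sup>2) \<partial>N) = ennreal (c\<^sup>2) * (\<integral>\<^sup>+w. ennreal ((norm (u w))\<^sup>2) \<partial>N)"
proof -
  have "(\<integral>\<^sup>+w. ennreal ((norm (c *\<^sub>R u w))\<^sup>2) \<partial>N) = (\<integral>\<^sup>+w. ennreal (c\<^sup>2) * ennreal ((norm (u w))\<^sup>2) \<partial>N)"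
    by (intro nn_integral_cong) (simp add: power_mult_distrib ennreal_mult)
  also have "\<dots> = ennreal (c\<^sup>2) * (\<integral>\<^sup>+w. ennreal ((norm (u w))\<^sup>2) \<partial>N)"
    using assms by (intro nn_integral_cmult) measurable
  finally show ?thesis .
qed

text \<open>All samples of the stages before s and, within stage s, the first k batch samples and
  the pairs up to iteration t. The separate count k lets the batch be revealed one sample at a
  time.\<close>

definition past_indices :: "nat \<Rightarrow> nat \<Rightarrow> nat \<Rightarrow> nat \<Rightarrow> nat \<Rightarrow> sample_index set" where
  "past_indices b m s k t =
     {Batch r i | r i. (1 \<le> r \<and> r < s \<and> i < b) \<or> (r = s \<and> i < k)} \<union>
     {Xi r j | r j. 1 \<le> j \<and> ((1 \<le> r \<and> r < s \<and> j \<le> m) \<or> (r = s \<and> j \<le> t))} \<union>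
     {Zeta r j | r j. 1 \<le> j \<and> ((1 \<le> r \<and> r < s \<and> j \<le> m) \<or> (r = s \<and> j \<le> t))}"

lemma past_indices_subset:
  "1 \<le> s \<Longrightarrow> s \<le> S \<Longrightarrow> k \<le> b \<Longrightarrow> t \<le> m \<Longrightarrow> past_indices b m s k t \<subseteq> sample_indices S b m"
  unfolding past_indices_def sample_indices_def by auto

lemma past_indices_mono: "k \<le> k' \<Longrightarrow> t \<le> t' \<Longrightarrow> past_indices b m s k t \<subseteq> past_indices b m s k' t'"
  unfolding past_indices_def by auto

lemma past_indices_next_stage: "1 \<le> s \<Longrightarrow> past_indices b m s b m \<subseteq> past_indices b m (Suc s) 0 0"
  unfolding past_indices_def by auto

locale hsgd_rs = stochastic_composite \<psi> \<eta> P fs f L \<sigma> + iid_samples M P X "sample_indices S b m"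
  for \<psi> :: "'a::euclidean_space \<Rightarrow> ereal" and \<eta> :: real and P :: "'w measure"
    and fs :: "'w \<Rightarrow> 'a \<Rightarrow> real" and f :: "'a \<Rightarrow> real" and L \<sigma> :: real
    and M :: "'o measure" and X :: "sample_index \<Rightarrow> 'o \<Rightarrow> 'w" and S b m :: nat +
  fixes \<beta> \<delta> :: real and \<gamma> :: "nat \<Rightarrow> real" and x0 :: 'a and x v :: "nat \<Rightarrow> nat \<Rightarrow> 'o \<Rightarrow> 'a" and Fmin :: real
  assumes b_pos: "1 \<le> b" and beta: "0 < \<beta>" "\<beta> < 1"
    and delta: "\<delta> = 2 / \<eta> - 2 * L" and delta_pos: "0 < \<delta>"
    and gamma: "\<And>t. t \<le> m \<Longrightarrow> 0 < \<gamma> t" "\<And>t. t \<le> m \<Longrightarrow> \<gamma> t \<le> 1"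
    and x0_dom: "x0 \<in> eff_dom \<psi>"
    and lower: "\<And>u. u \<in> eff_dom \<psi> \<Longrightarrow> Fmin \<le> \<Phi> u"
    and x_first: "\<And>\<omega>. \<omega> \<in> space M \<Longrightarrow> x 1 0 \<omega> = x0"
    and x_next: "\<And>s \<omega>. \<omega> \<in> space M \<Longrightarrow> 1 \<le> s \<Longrightarrow> s < S \<Longrightarrow> x (Suc s) 0 \<omega> = x s (Suc m) \<omega>"
    and x_step: "\<And>s t \<omega>. \<omega> \<in> space M \<Longrightarrow> 1 \<le> s \<Longrightarrow> s \<le> S \<Longrightarrow> t \<le> m \<Longrightarrow>
      x s (Suc t) \<omega> = (1 - \<gamma> t) *\<^sub>R x s t \<omega> + \<gamma> t *\<^sub>R pr (x s t \<omega> - \<eta> *\<^sub>R v s t \<omega>)"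
    and v_first: "\<And>s \<omega>. \<omega> \<in> space M \<Longrightarrow> 1 \<le> s \<Longrightarrow> s \<le> S \<Longrightarrow>
      v s 0 \<omega> = (1 / real b) *\<^sub>R (\<Sum>i<b. grad (fs (X (Batch s i) \<omega>)) (x s 0 \<omega>))"
    and v_step: "\<And>s t \<omega>. \<omega> \<in> space M \<Longrightarrow> 1 \<le> s \<Longrightarrow> s \<le> S \<Longrightarrow> t < m \<Longrightarrow>
      v s (Suc t) \<omega> = \<beta> *\<^sub>R v s t \<omega>
        + \<beta> *\<^sub>R (grad (fs (X (Xi s (Suc t)) \<omega>)) (x s (Suc t) \<omega>) - grad (fs (X (Xi s (Suc t)) \<omega>)) (x s t \<omega>))
        + (1 - \<beta>) *\<^sub>R grad (fs (X (Zeta s (Suc t)) \<omega>)) (x s (Suc t) \<omega>)"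
begin

abbreviation past where "past \<equiv> past_indices b m"

abbreviation e where "e s t \<omega> \<equiv> v s t \<omega> - grad f (x s t \<omega>)"

abbreviation d where "d s t \<omega> \<equiv> pr (x s t \<omega> - \<eta> *\<^sub>R v s t \<omega>) - x s t \<omega>"

lemma iterates_in_dom:
  assumes "\<omega> \<in> space M" "1 \<le> s" "s \<le> S" "t \<le> Suc m"
  shows "x s t \<omega> \<in> eff_dom \<psi>"
proof -
  have stage: "x s t \<omega> \<in> eff_dom \<psi>" if "x s 0 \<omega> \<in> eff_dom \<psi>" "1 \<le> s" "s \<le> S" "t \<le> Suc m" for s t
    using that(4)
  proof (induction t)
    case 0
    then show ?case using that by simp
  next
    case (Suc t)
    then show ?case
      using x_step[OF assms(1) that(2,3), of t] psir_convex(1)[OF _ pr_in_dom, of "x s t \<omega>" "\<gamma> t"] gamma[of t]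
      by auto
  qed
  have "s \<le> S \<Longrightarrow> x s 0 \<omega> \<in> eff_dom \<psi>"
    using assms(2)
  proof (induction s rule: dec_induct)
    case base
    then show ?case using x_first[OF assms(1)] x0_dom by simp
  next
    case (step s)
    then show ?case
      using stage[of s "Suc m"] x_next[OF assms(1), of s] by simp
  qed
  then show ?thesis using stage assms by blast
qed

section \<open>Adaptedness of the iterates and second moments of the estimator error\<close>

lemma measurable_past_mono:
  assumes "u \<in> measurable (hist (past s k t)) N" "1 \<le> s" "s \<le> S" "k \<le> k'" "t \<le> t'" "k' \<le> b" "t' \<le> m"
  shows "u \<in> measurable (hist (past s k' t')) N"
  using assms by (intro measurable_hist_mono[OF assms(1)] past_indices_mono past_indices_subset)

text \<open>The third conjunct matters: \<open>x s (Suc t)\<close> is determined before the pair of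
  samples of iteration \<open>Suc t\<close> is drawn, which is what makes that pair fresh for the
  error recursion.\<close>

lemma stage_measurable:
  assumes s: "1 \<le> s" "s \<le> S" and x: "x s 0 \<in> borel_measurable (hist (past s 0 0))"
  shows "t \<le> m \<Longrightarrow> x s t \<in> borel_measurable (hist (past s b t)) \<and> v s t \<in> borel_measurable (hist (past s b t))
    \<and> x s (Suc t) \<in> borel_measurable (hist (past s b t))"
proof -
  have next_x: "x s (Suc t) \<in> borel_measurable (hist J)"
    if "x s t \<in> borel_measurable (hist J)" "v s t \<in> borel_measurable (hist J)" "t \<le> m" for t J
  proof -
    note [measurable] = that(1,2)
    have "(\<lambda>\<omega>. (1 - \<gamma> t) *\<^sub>R x s t \<omega> + \<gamma> t *\<^sub>R pr (x s t \<omega> - \<eta> *\<^sub>R v s t \<omega>)) \<in> borel_measurable (hist J)"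
      by measurable
    then show ?thesis
      by (subst measurable_cong[where g = "\<lambda>\<omega>. (1 - \<gamma> t) *\<^sub>R x s t \<omega> + \<gamma> t *\<^sub>R pr (x s t \<omega> - \<eta> *\<^sub>R v s t \<omega>)"])
         (use x_step s that(3) in auto)
  qed
  show "t \<le> m \<Longrightarrow> ?thesis"
  proof (induction t)
    case 0
    have [measurable]: "x s 0 \<in> borel_measurable (hist (past s b 0))"
      using x s by (rule measurable_past_mono) auto
    have X[measurable]: "X (Batch s i) \<in> measurable (hist (past s b 0)) P" if "i < b" for i
      using that s by (intro X_measurable_hist past_indices_subset) (auto simp: past_indices_def)
    have "(\<lambda>\<omega>. (1 / real b) *\<^sub>R (\<Sum>i<b. grad (fs (X (Batch s i) \<omega>)) (x s 0 \<omega>))) \<in> borel_measurable (hist (past s b 0))"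
      by (intro borel_measurable_scaleR borel_measurable_sum borel_measurable_const grad_fs_measurable') (use X in auto)
    then have "v s 0 \<in> borel_measurable (hist (past s b 0))"
      by (subst measurable_cong[where g = "\<lambda>\<omega>. (1 / real b) *\<^sub>R (\<Sum>i<b. grad (fs (X (Batch s i) \<omega>)) (x s 0 \<omega>))"])
         (use v_first s in auto)
    then show ?case using next_x[of 0] by auto
  next
    case (Suc t)
    let ?H = "hist (past s b (Suc t))"
    have [measurable]: "x s t \<in> borel_measurable ?H" "v s t \<in> borel_measurable ?H" "x s (Suc t) \<in> borel_measurable ?H"
      using Suc s by (auto intro: measurable_past_mono)
    have [measurable]: "X (Xi s (Suc t)) \<in> measurable ?H P" "X (Zeta s (Suc t)) \<in> measurable ?H P"
      using Suc.prems s past_indices_subset[of s S b b "Suc t" m]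
      by (auto intro!: X_measurable_hist) (auto simp: past_indices_def)
    let ?g = "\<lambda>\<omega>. \<beta> *\<^sub>R v s t \<omega>
        + \<beta> *\<^sub>R (grad (fs (X (Xi s (Suc t)) \<omega>)) (x s (Suc t) \<omega>) - grad (fs (X (Xi s (Suc t)) \<omega>)) (x s t \<omega>))
        + (1 - \<beta>) *\<^sub>R grad (fs (X (Zeta s (Suc t)) \<omega>)) (x s (Suc t) \<omega>)"
    have "?g \<in> borel_measurable ?H" by measurable
    then have "v s (Suc t) \<in> borel_measurable ?H"
      by (subst measurable_cong[where g = ?g]) (use v_step s Suc.prems in auto)
    then show ?case using next_x[of "Suc t"] Suc.prems by auto
  qed
qed

lemma x_first_measurable:
  assumes "1 \<le> s" "s \<le> S"
  shows "x s 0 \<in> borel_measurable (hist (past s 0 0))"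
  using assms
proof (induction s rule: dec_induct)
  case base
  have "(\<lambda>\<omega>. x0) \<in> borel_measurable (hist (past 1 0 0))" by simp
  then show ?case by (subst measurable_cong[where g = "\<lambda>\<omega>. x0"]) (use x_first in auto)
next
  case (step s)
  then have "x s (Suc m) \<in> borel_measurable (hist (past s b m))"
    using stage_measurable[of s m] by auto
  then have "x s (Suc m) \<in> borel_measurable (hist (past (Suc s) 0 0))"
    using step by (intro measurable_hist_mono[OF _ past_indices_next_stage past_indices_subset]) auto
  then show ?case by (subst measurable_cong[where g = "x s (Suc m)"]) (use x_next step in auto)
qed

lemma iterates_measurable:
  assumes "1 \<le> s" "s \<le> S" "t \<le> m"
  shows "x s t \<in> borel_measurable (hist (past s b t))" "v s t \<in> borel_measurable (hist (past s b t))"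
    "x s (Suc t) \<in> borel_measurable (hist (past s b t))"
  using stage_measurable[OF assms(1,2) x_first_measurable[OF assms(1,2)] assms(3)] by auto

lemma iterates_measurable_M:
  assumes "1 \<le> s" "s \<le> S" "t \<le> m"
  shows "x s t \<in> borel_measurable M" "v s t \<in> borel_measurable M" "x s (Suc t) \<in> borel_measurable M"
  using iterates_measurable[OF assms] past_indices_subset[OF assms(1,2) order_refl assms(3)] measurable_hist by blast+

text \<open>The starting point of a later stage is itself random, so the usual variance of a batch
  mean is obtained by adding one fresh sample at a time: k terms contribute at most k \<sigma>^2,
  and the mean divides by b^2.\<close>

lemma estimator_error_first:
  assumes s: "1 \<le> s" "s \<le> S"
  shows "(\<integral>\<^sup>+\<omega>. ennreal ((norm (e s 0 \<omega>))\<^sup>2) \<partial>M) \<le> ennreal (\<sigma>\<^sup>2 / real b)"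
proof -
  let ?\<phi> = "\<lambda>z y. grad (fs y) z - grad f z"
  let ?Q = "\<lambda>k \<omega>. \<Sum>i<k. ?\<phi> (x s 0 \<omega>) (X (Batch s i) \<omega>)"
  have \<phi>: "case_prod ?\<phi> \<in> borel_measurable (borel \<Otimes>\<^sub>M P)" by measurable
  have xm: "x s 0 \<in> borel_measurable (hist (past s k 0))" if "k \<le> b" for k
    using x_first_measurable[OF s] s by (rule measurable_past_mono) (use that in auto)
  have Qm: "?Q k \<in> borel_measurable (hist (past s k 0))" if "k \<le> b" for k
  proof (intro borel_measurable_sum borel_measurable_diff grad_fs_measurable')
    fix i assume "i \<in> {..<k}"
    then show "X (Batch s i) \<in> measurable (hist (past s k 0)) P"
      using that s by (intro X_measurable_hist past_indices_subset) (auto simp: past_indices_def)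
  qed (use xm[OF that] in \<open>auto intro: measurable_compose[OF _ grad_f_measurable]\<close>)
  have Q: "(\<integral>\<^sup>+\<omega>. ennreal ((norm (?Q k \<omega>))\<^sup>2) \<partial>M) \<le> ennreal (real k * \<sigma>\<^sup>2)" if "k \<le> b" for k
    using that
  proof (induction k)
    case 0
    then show ?case by simp
  next
    case (Suc k)
    have "(\<integral>\<^sup>+\<omega>. ennreal ((norm (?Q (Suc k) \<omega>))\<^sup>2) \<partial>M)
        = (\<integral>\<^sup>+\<omega>. ennreal ((norm (?Q k \<omega> + ?\<phi> (x s 0 \<omega>) (X (Batch s k) \<omega>)))\<^sup>2) \<partial>M)" by simp
    also have "\<dots> \<le> (\<integral>\<^sup>+\<omega>. ennreal ((norm (?Q k \<omega>))\<^sup>2) \<partial>M) + (\<integral>\<^sup>+\<omega>. ennreal (\<sigma>\<^sup>2) \<partial>M)"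
    proof (rule fresh_sample_second_moment[where J = "past s k 0" and z = "x s 0" and \<phi> = ?\<phi>])
      show "past s k 0 \<subseteq> sample_indices S b m" using s Suc.prems by (intro past_indices_subset) auto
      show "Batch s k \<in> sample_indices S b m" using s Suc.prems by (auto simp: sample_indices_def)
      show "Batch s k \<notin> past s k 0" by (auto simp: past_indices_def)
      show "?Q k \<in> borel_measurable (hist (past s k 0))" "x s 0 \<in> borel_measurable (hist (past s k 0))"
        using Qm xm Suc.prems by auto
      fix \<omega> assume \<omega>: "\<omega> \<in> space M"
      show "integrable P (?\<phi> (x s 0 \<omega>))" by (intro Bochner_Integration.integrable_diff grad_integrable) auto
      show "(\<integral>y. ?\<phi> (x s 0 \<omega>) y \<partial>P) = 0" by (simp add: grad_integrable unbiased P.prob_space)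
      show "(\<integral>\<^sup>+y. ennreal ((norm (?\<phi> (x s 0 \<omega>) y))\<^sup>2) \<partial>P) \<le> ennreal (\<sigma>\<^sup>2)"
        using iterates_in_dom[OF \<omega> s, of 0] by (intro bounded_variance) auto
    qed (rule \<phi>)
    also have "\<dots> \<le> ennreal (real k * \<sigma>\<^sup>2) + ennreal (\<sigma>\<^sup>2)"
      using Suc by (intro add_mono) (auto simp: emeasure_space_1)
    also have "\<dots> = ennreal (real (Suc k) * \<sigma>\<^sup>2)"
      by (subst ennreal_plus[symmetric]) (auto simp: algebra_simps)
    finally show ?case .
  qed
  have "e s 0 \<omega> = (1 / real b) *\<^sub>R ?Q b \<omega>" if "\<omega> \<in> space M" for \<omega>
    using b_pos by (simp add: v_first[OF that s] sum_subtractf scaleR_diff_right sum_constant_scaleR)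
  then have "(\<integral>\<^sup>+\<omega>. ennreal ((norm (e s 0 \<omega>))\<^sup>2) \<partial>M) = (\<integral>\<^sup>+\<omega>. ennreal ((norm ((1 / real b) *\<^sub>R ?Q b \<omega>))\<^sup>2) \<partial>M)"
    by (intro nn_integral_cong) simp
  also have "\<dots> = ennreal ((1 / real b)\<^sup>2) * (\<integral>\<^sup>+\<omega>. ennreal ((norm (?Q b \<omega>))\<^sup>2) \<partial>M)"
    using measurable_hist[OF Qm[of b] past_indices_subset[OF s]] by (intro nn_integral_norm_scaleR) auto
  also have "\<dots> \<le> ennreal ((1 / real b)\<^sup>2) * ennreal (real b * \<sigma>\<^sup>2)"
    using Q by (intro mult_left_mono) auto
  also have "\<dots> = ennreal (\<sigma>\<^sup>2 / real b)"
    using b_pos by (subst ennreal_mult[symmetric]) (auto simp: power2_eq_square)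
  finally show ?thesis .
qed

text \<open>Two applications of the fresh sample bound: the zeta sample is peeled off first, with
  the xi sample counted as history, and then the xi sample against the past alone.\<close>

lemma estimator_error_step:
  assumes s: "1 \<le> s" "s \<le> S" and t: "t < m"
  shows "(\<integral>\<^sup>+\<omega>. ennreal ((norm (e s (Suc t) \<omega>))\<^sup>2) \<partial>M)
    \<le> ennreal (\<beta>\<^sup>2) * (\<integral>\<^sup>+\<omega>. ennreal ((norm (e s t \<omega>))\<^sup>2) \<partial>M)
      + ennreal (\<beta>\<^sup>2 * L\<^sup>2 * (\<gamma> t)\<^sup>2) * (\<integral>\<^sup>+\<omega>. ennreal ((norm (d s t \<omega>))\<^sup>2) \<partial>M)
      + ennreal ((1 - \<beta>)\<^sup>2 * \<sigma>\<^sup>2)"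
proof -
  let ?J = "past s b t"
  let ?i = "Xi s (Suc t)" and ?j = "Zeta s (Suc t)"
  let ?K = "insert ?i ?J"
  have tm: "t \<le> m" using t by simp
  have J: "?J \<subseteq> sample_indices S b m" using s tm by (intro past_indices_subset) auto
  have i: "?i \<in> sample_indices S b m" and j: "?j \<in> sample_indices S b m"
    using s t by (auto simp: sample_indices_def)
  have iJ: "?i \<notin> ?J" and jK: "?j \<notin> ?K" by (auto simp: past_indices_def)
  have K: "?K \<subseteq> sample_indices S b m" using J i by simp
  note mJ[measurable] = iterates_measurable[OF s tm]
  note mK = mJ[THEN measurable_hist_mono, OF subset_insertI K]
  note mM = iterates_measurable_M[OF s tm]
  define \<phi> where "\<phi> = (\<lambda>z y. \<beta> *\<^sub>R (grad (fs y) (fst z) - grad (fs y) (snd z) - (grad f (fst z) - grad f (snd z))))"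
  define \<theta> where "\<theta> = (\<lambda>z y. (1 - \<beta>) *\<^sub>R (grad (fs y) z - grad f z))"
  define z where "z = (\<lambda>\<omega>. (x s (Suc t) \<omega>, x s t \<omega>))"
  define g where "g = (\<lambda>\<omega>. \<beta> *\<^sub>R e s t \<omega> + \<phi> (z \<omega>) (X ?i \<omega>))"
  \<comment> \<open>The true gradients subtracted in \<open>\<phi>\<close> and
    \<open>\<theta>\<close> combine with those in the two errors and cancel; \<beta> + (1 - \<beta>)
    = 1 leaves exactly one \<open>grad f\<close> at the new point.\<close>
  have dec: "e s (Suc t) \<omega> = g \<omega> + \<theta> (x s (Suc t) \<omega>) (X ?j \<omega>)" if "\<omega> \<in> space M" for \<omega>
    by (simp add: g_def \<phi>_def \<theta>_def z_def v_step[OF that s t] algebra_simps)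
  have "(\<integral>\<^sup>+\<omega>. ennreal ((norm (e s (Suc t) \<omega>))\<^sup>2) \<partial>M)
      = (\<integral>\<^sup>+\<omega>. ennreal ((norm (g \<omega> + \<theta> (x s (Suc t) \<omega>) (X ?j \<omega>)))\<^sup>2) \<partial>M)"
    using dec by (intro nn_integral_cong) simp
  also have "\<dots> \<le> (\<integral>\<^sup>+\<omega>. ennreal ((norm (g \<omega>))\<^sup>2) \<partial>M) + (\<integral>\<^sup>+\<omega>. ennreal ((1 - \<beta>)\<^sup>2 * \<sigma>\<^sup>2) \<partial>M)"
  proof (rule fresh_sample_second_moment[OF K j jK, where z = "x s (Suc t)" and \<phi> = \<theta>])
    note [measurable] = mK X_measurable_hist[OF insertI1 K]
    show "g \<in> borel_measurable (hist ?K)" unfolding g_def z_def \<phi>_def fst_conv snd_conv by measurable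
    show "x s (Suc t) \<in> borel_measurable (hist ?K)" by (rule mK)
    show "case_prod \<theta> \<in> borel_measurable (borel \<Otimes>\<^sub>M P)" unfolding \<theta>_def by measurable
    fix \<omega> assume \<omega>: "\<omega> \<in> space M"
    let ?x = "x s (Suc t) \<omega>"
    show "integrable P (\<theta> ?x)" unfolding \<theta>_def
      by (intro integrable_scaleR_right Bochner_Integration.integrable_diff grad_integrable) auto
    show "(\<integral>y. \<theta> ?x y \<partial>P) = 0" by (simp add: \<theta>_def grad_integrable unbiased P.prob_space)
    have "(\<integral>\<^sup>+y. ennreal ((norm (\<theta> ?x y))\<^sup>2) \<partial>P)
        = ennreal ((1 - \<beta>)\<^sup>2) * (\<integral>\<^sup>+y. ennreal ((norm (grad (fs y) ?x - grad f ?x))\<^sup>2) \<partial>P)"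
      unfolding \<theta>_def by (intro nn_integral_norm_scaleR) measurable
    also have "\<dots> \<le> ennreal ((1 - \<beta>)\<^sup>2) * ennreal (\<sigma>\<^sup>2)"
      using iterates_in_dom[OF \<omega> s, of "Suc t"] t by (intro mult_left_mono bounded_variance) auto
    finally show "(\<integral>\<^sup>+y. ennreal ((norm (\<theta> ?x y))\<^sup>2) \<partial>P) \<le> ennreal ((1 - \<beta>)\<^sup>2 * \<sigma>\<^sup>2)"
      by (simp add: ennreal_mult)
  qed
  also have "(\<integral>\<^sup>+\<omega>. ennreal ((norm (g \<omega>))\<^sup>2) \<partial>M) \<le> (\<integral>\<^sup>+\<omega>. ennreal ((norm (\<beta> *\<^sub>R e s t \<omega>))\<^sup>2) \<partial>M)
      + (\<integral>\<^sup>+\<omega>. ennreal (\<beta>\<^sup>2 * L\<^sup>2 * (\<gamma> t)\<^sup>2) * ennreal ((norm (d s t \<omega>))\<^sup>2) \<partial>M)"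
    unfolding g_def
  proof (rule fresh_sample_second_moment[OF J i iJ, where z = z and \<phi> = \<phi>])
    show "(\<lambda>\<omega>. \<beta> *\<^sub>R e s t \<omega>) \<in> borel_measurable (hist ?J)" by measurable
    show "z \<in> borel_measurable (hist ?J)" unfolding z_def by measurable
    show "case_prod \<phi> \<in> borel_measurable (borel \<Otimes>\<^sub>M P)" unfolding \<phi>_def borel_prod[symmetric] by measurable
    fix \<omega> assume \<omega>: "\<omega> \<in> space M"
    let ?x = "x s (Suc t) \<omega>" and ?y = "x s t \<omega>"
    let ?u = "\<lambda>y. grad (fs y) ?x - grad (fs y) ?y - (grad f ?x - grad f ?y)"
    show "integrable P (\<phi> (z \<omega>))" unfolding \<phi>_def z_def fst_conv snd_conv
      by (intro integrable_scaleR_right Bochner_Integration.integrable_diff grad_integrable) auto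
    show "(\<integral>y. \<phi> (z \<omega>) y \<partial>P) = 0"
      by (simp add: \<phi>_def z_def grad_integrable unbiased P.prob_space)
    have "(\<integral>\<^sup>+y. ennreal ((norm (\<phi> (z \<omega>) y))\<^sup>2) \<partial>P) = ennreal (\<beta>\<^sup>2) * (\<integral>\<^sup>+y. ennreal ((norm (?u y))\<^sup>2) \<partial>P)"
      unfolding \<phi>_def z_def fst_conv snd_conv by (intro nn_integral_norm_scaleR) measurable
    also have "\<dots> \<le> ennreal (\<beta>\<^sup>2) * ennreal (L\<^sup>2 * (norm (?x - ?y))\<^sup>2)"
      using iterates_in_dom[OF \<omega> s] t by (intro mult_left_mono grad_diff_variance) auto
    also have "?x - ?y = \<gamma> t *\<^sub>R d s t \<omega>"
      by (simp add: x_step[OF \<omega> s tm] algebra_simps)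
    also have "ennreal (\<beta>\<^sup>2) * ennreal (L\<^sup>2 * (norm (\<gamma> t *\<^sub>R d s t \<omega>))\<^sup>2)
        = ennreal (\<beta>\<^sup>2 * L\<^sup>2 * (\<gamma> t)\<^sup>2) * ennreal ((norm (d s t \<omega>))\<^sup>2)"
      by (simp add: ennreal_mult[symmetric] power_mult_distrib mult.assoc)
    finally show "(\<integral>\<^sup>+y. ennreal ((norm (\<phi> (z \<omega>) y))\<^sup>2) \<partial>P)
        \<le> ennreal (\<beta>\<^sup>2 * L\<^sup>2 * (\<gamma> t)\<^sup>2) * ennreal ((norm (d s t \<omega>))\<^sup>2)" .
  qed
  also have "(\<integral>\<^sup>+\<omega>. ennreal ((norm (\<beta> *\<^sub>R e s t \<omega>))\<^sup>2) \<partial>M) = ennreal (\<beta>\<^sup>2) * (\<integral>\<^sup>+\<omega>. ennreal ((norm (e s t \<omega>))\<^sup>2) \<partial>M)"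
  proof (intro nn_integral_norm_scaleR)
    note [measurable] = mM
    show "(\<lambda>\<omega>. e s t \<omega>) \<in> borel_measurable M" by measurable
  qed
  also have "(\<integral>\<^sup>+\<omega>. ennreal (\<beta>\<^sup>2 * L\<^sup>2 * (\<gamma> t)\<^sup>2) * ennreal ((norm (d s t \<omega>))\<^sup>2) \<partial>M)
      = ennreal (\<beta>\<^sup>2 * L\<^sup>2 * (\<gamma> t)\<^sup>2) * (\<integral>\<^sup>+\<omega>. ennreal ((norm (d s t \<omega>))\<^sup>2) \<partial>M)"
  proof (intro nn_integral_cmult)
    note [measurable] = mM
    show "(\<lambda>\<omega>. ennreal ((norm (d s t \<omega>))\<^sup>2)) \<in> borel_measurable M" by measurable
  qed
  finally show ?thesis by (simp add: emeasure_space_1)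
qed

section \<open>Pathwise descent, integrability along the run, and summation over stages\<close>

lemma step_pathwise:
  assumes "\<omega> \<in> space M" "1 \<le> s" "s \<le> S" "t \<le> m"
  shows "\<Phi> (x s (Suc t) \<omega>) + \<gamma> t / 2 * (\<delta> + L - L * \<gamma> t) * (norm (d s t \<omega>))\<^sup>2
    \<le> \<Phi> (x s t \<omega>) + \<gamma> t / (2 * L) * (norm (e s t \<omega>))\<^sup>2"
proof -
  have "\<delta> + L - L * \<gamma> t = 2 / \<eta> - L - L * \<gamma> t" by (simp add: delta)
  then show ?thesis
    unfolding \<Phi>_def using prox_step_descent[OF f_differentiable grad_f_lipschitz L_pos iterates_in_dom[OF assms(1-3)]
        gamma(1)[OF assms(4)] gamma(2)[OF assms(4)] refl x_step[OF assms]] assms(4)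
    by (simp only: le_Suc_eq simp_thms)
qed

text \<open>After subtracting \<open>Fmin\<close>, both terms on the left of the pathwise descent
  are nonnegative, so each is dominated by the integrable right side. The coefficient
  \<open>?c\<close> is positive because \<gamma> t \<le> 1 and \<delta> > 0.\<close>

lemma step_integrable:
  assumes s: "1 \<le> s" "s \<le> S" and t: "t \<le> m"
    and int: "integrable M (\<lambda>\<omega>. \<Phi> (x s t \<omega>))" "integrable M (\<lambda>\<omega>. (norm (e s t \<omega>))\<^sup>2)"
  shows "integrable M (\<lambda>\<omega>. (norm (d s t \<omega>))\<^sup>2)" "integrable M (\<lambda>\<omega>. \<Phi> (x s (Suc t) \<omega>))"
proof -
  note [measurable] = iterates_measurable_M[OF s t]
  let ?c = "\<gamma> t / 2 * (\<delta> + L - L * \<gamma> t)"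
  let ?u = "\<lambda>\<omega>. \<Phi> (x s t \<omega>) - Fmin + \<gamma> t / (2 * L) * (norm (e s t \<omega>))\<^sup>2"
  have "L * \<gamma> t \<le> L" using gamma[OF t] L_pos by simp
  then have c: "0 < ?c" using gamma[OF t] delta_pos by (intro mult_pos_pos) auto
  have u: "integrable M ?u" using int by simp
  have low: "Fmin \<le> \<Phi> (x s (Suc t) \<omega>)" if "\<omega> \<in> space M" for \<omega>
    using iterates_in_dom[OF that s, of "Suc t"] t by (intro lower) auto
  have bd: "?c * (norm (d s t \<omega>))\<^sup>2 \<le> ?u \<omega>" "\<Phi> (x s (Suc t) \<omega>) - Fmin \<le> ?u \<omega>" if "\<omega> \<in> space M" for \<omega>
  proof -
    have "0 \<le> ?c * (norm (d s t \<omega>))\<^sup>2" using c by simp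
    then show "\<Phi> (x s (Suc t) \<omega>) - Fmin \<le> ?u \<omega>" using step_pathwise[OF that s t] by linarith
    show "?c * (norm (d s t \<omega>))\<^sup>2 \<le> ?u \<omega>" using step_pathwise[OF that s t] low[OF that] by linarith
  qed
  have "integrable M (\<lambda>\<omega>. ?c * (norm (d s t \<omega>))\<^sup>2)"
  proof (rule Bochner_Integration.integrable_bound[OF u])
    show "AE \<omega> in M. norm (?c * (norm (d s t \<omega>))\<^sup>2) \<le> norm (?u \<omega>)"
    proof (rule AE_I2)
      fix \<omega> assume "\<omega> \<in> space M"
      moreover have "0 \<le> ?c * (norm (d s t \<omega>))\<^sup>2" using c by simp
      ultimately show "norm (?c * (norm (d s t \<omega>))\<^sup>2) \<le> norm (?u \<omega>)"
        using bd(1)[of \<omega>] unfolding real_norm_def by linarith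
    qed
  qed measurable
  then have "integrable M (\<lambda>\<omega>. inverse ?c * (?c * (norm (d s t \<omega>))\<^sup>2))" by (rule integrable_mult_right)
  moreover have "inverse c * (c * y) = y" if "0 < c" for c y :: real using that by simp
  ultimately show "integrable M (\<lambda>\<omega>. (norm (d s t \<omega>))\<^sup>2)" by (simp only: c)
  have "integrable M (\<lambda>\<omega>. \<Phi> (x s (Suc t) \<omega>) - Fmin)"
  proof (rule Bochner_Integration.integrable_bound[OF u])
    show "AE \<omega> in M. norm (\<Phi> (x s (Suc t) \<omega>) - Fmin) \<le> norm (?u \<omega>)"
    proof (rule AE_I2)
      fix \<omega> assume "\<omega> \<in> space M"
      then show "norm (\<Phi> (x s (Suc t) \<omega>) - Fmin) \<le> norm (?u \<omega>)"
        using bd(2)[of \<omega>] low[of \<omega>] unfolding real_norm_def by linarith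
    qed
  qed measurable
  then have "integrable M (\<lambda>\<omega>. (\<Phi> (x s (Suc t) \<omega>) - Fmin) + Fmin)" by (rule Bochner_Integration.integrable_add) simp
  then show "integrable M (\<lambda>\<omega>. \<Phi> (x s (Suc t) \<omega>))" by simp
qed

text \<open>Descent and error recursion alternate: integrability at t gives a finite second moment
  of the prox step, which bounds the next error.\<close>

lemma stage_integrable:
  assumes s: "1 \<le> s" "s \<le> S" and int: "integrable M (\<lambda>\<omega>. \<Phi> (x s 0 \<omega>))" and t: "t \<le> m"
  shows "integrable M (\<lambda>\<omega>. \<Phi> (x s t \<omega>)) \<and> integrable M (\<lambda>\<omega>. (norm (e s t \<omega>))\<^sup>2)"
  using t
proof (induction t)
  case 0
  note [measurable] = iterates_measurable_M[OF s 0]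
  have "(\<integral>\<^sup>+\<omega>. ennreal ((norm (e s 0 \<omega>))\<^sup>2) \<partial>M) < \<infinity>"
    using estimator_error_first[OF s] by (rule le_less_trans) simp
  then have "integrable M (\<lambda>\<omega>. (norm (e s 0 \<omega>))\<^sup>2)" by (intro integrableI_nonneg) auto
  then show ?case using int by simp
next
  case (Suc t)
  then have t: "t \<le> m" "t < m" by auto
  note [measurable] = iterates_measurable_M[OF s Suc.prems]
  have IH: "integrable M (\<lambda>\<omega>. \<Phi> (x s t \<omega>))" "integrable M (\<lambda>\<omega>. (norm (e s t \<omega>))\<^sup>2)" using Suc by auto
  note d = step_integrable[OF s t(1) IH]
  have "(\<integral>\<^sup>+\<omega>. ennreal ((norm (e s (Suc t) \<omega>))\<^sup>2) \<partial>M) < \<infinity>"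
    using estimator_error_step[OF s t(2)]
    by (rule le_less_trans)
       (use nn_integral_eq_integral[OF IH(2)] nn_integral_eq_integral[OF d(1)] in
         \<open>simp add: ennreal_mult_less_top\<close>)
  then have "integrable M (\<lambda>\<omega>. (norm (e s (Suc t) \<omega>))\<^sup>2)" by (intro integrableI_nonneg) auto
  then show ?case using d(2) by simp
qed

lemma first_integrable:
  assumes "1 \<le> s" "s \<le> S"
  shows "integrable M (\<lambda>\<omega>. \<Phi> (x s 0 \<omega>))"
  using assms
proof (induction s rule: dec_induct)
  case base
  show ?case by (subst Bochner_Integration.integrable_cong[OF refl, where g = "\<lambda>_. \<Phi> x0"]) (use x_first in auto)
next
  case (step s)
  then have "integrable M (\<lambda>\<omega>. \<Phi> (x s (Suc m) \<omega>))"
    using stage_integrable[of s m] step_integrable(2)[of s m] by simp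
  then show ?case
    by (subst Bochner_Integration.integrable_cong[OF refl, where g = "\<lambda>\<omega>. \<Phi> (x s (Suc m) \<omega>)"]) (use x_next step in auto)
qed

lemma all_integrable:
  assumes s: "1 \<le> s" "s \<le> S" and t: "t \<le> m"
  shows "integrable M (\<lambda>\<omega>. \<Phi> (x s t \<omega>))" "integrable M (\<lambda>\<omega>. (norm (e s t \<omega>))\<^sup>2)"
    "integrable M (\<lambda>\<omega>. (norm (d s t \<omega>))\<^sup>2)" "integrable M (\<lambda>\<omega>. \<Phi> (x s (Suc t) \<omega>))"
    "integrable M (\<lambda>\<omega>. (norm (gradient_mapping f \<psi> \<eta> (x s t \<omega>)))\<^sup>2)"
proof -
  show 1: "integrable M (\<lambda>\<omega>. \<Phi> (x s t \<omega>))" "integrable M (\<lambda>\<omega>. (norm (e s t \<omega>))\<^sup>2)"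
    using stage_integrable[OF s first_integrable[OF s] t] by auto
  show 2: "integrable M (\<lambda>\<omega>. (norm (d s t \<omega>))\<^sup>2)" "integrable M (\<lambda>\<omega>. \<Phi> (x s (Suc t) \<omega>))"
    using step_integrable[OF s t 1] by auto
  note [measurable] = iterates_measurable_M[OF s t]
  have "integrable M (\<lambda>\<omega>. 2 * (norm (d s t \<omega>))\<^sup>2 + 2 * \<eta>\<^sup>2 * (norm (e s t \<omega>))\<^sup>2)" using 1 2 by simp
  then have "integrable M (\<lambda>\<omega>. \<eta>\<^sup>2 * (norm (gradient_mapping f \<psi> \<eta> (x s t \<omega>)))\<^sup>2)"
    by (rule Bochner_Integration.integrable_bound)
       (measurable, use gradient_mapping_bound[OF refl] in \<open>auto intro!: AE_I2\<close>)
  then show "integrable M (\<lambda>\<omega>. (norm (gradient_mapping f \<psi> \<eta> (x s t \<omega>)))\<^sup>2)" using eta_pos by simp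
qed

text \<open>\<open>stage_descent\<close> for expected values, with \<nu> = (1 - \<beta>)^2
  \<sigma>^2. The error bounds hold for extended integrals and become real inequalities once
  integrability is known.\<close>

lemma stage_bound:
  assumes s: "1 \<le> s" "s \<le> S" and k: "\<kappa> = 1 + L\<^sup>2 * \<eta>\<^sup>2"
    and g: "\<And>t. t \<le> m \<Longrightarrow> L * \<gamma> t * (1 + \<kappa> * (\<beta>\<^sup>2 * discounted_tail \<beta> \<gamma> m (Suc t))) = \<delta>"
  shows "L * \<eta>\<^sup>2 / 4 * (\<Sum>t\<le>m. \<gamma> t * (\<integral>\<omega>. (norm (gradient_mapping f \<psi> \<eta> (x s t \<omega>)))\<^sup>2 \<partial>M))
       + (\<integral>\<omega>. \<Phi> (x s (Suc m) \<omega>) \<partial>M)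
    \<le> (\<integral>\<omega>. \<Phi> (x s 0 \<omega>) \<partial>M)
       + \<kappa> / (2 * L) * (discounted_tail \<beta> \<gamma> m 0 * (\<sigma>\<^sup>2 / real b)
           + (1 - \<beta>)\<^sup>2 * \<sigma>\<^sup>2 * (\<Sum>t\<le>m. discounted_tail \<beta> \<gamma> m (Suc t)))"
proof -
  define E where "E t = (\<integral>\<omega>. (norm (e s t \<omega>))\<^sup>2 \<partial>M)" for t
  define D where "D t = (\<integral>\<omega>. (norm (d s t \<omega>))\<^sup>2 \<partial>M)" for t
  define G where "G t = (\<integral>\<omega>. (norm (gradient_mapping f \<psi> \<eta> (x s t \<omega>)))\<^sup>2 \<partial>M)" for t
  define V where "V t = (\<integral>\<omega>. \<Phi> (x s t \<omega>) \<partial>M)" for t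
  note int = all_integrable[OF s]
  have nn_e: "(\<integral>\<^sup>+\<omega>. ennreal ((norm (e s t \<omega>))\<^sup>2) \<partial>M) = ennreal (E t)" if "t \<le> m" for t
    unfolding E_def using int(2)[OF that] by (intro nn_integral_eq_integral) auto
  have nn_d: "(\<integral>\<^sup>+\<omega>. ennreal ((norm (d s t \<omega>))\<^sup>2) \<partial>M) = ennreal (D t)" if "t \<le> m" for t
    unfolding D_def using int(3)[OF that] by (intro nn_integral_eq_integral) auto
  have E0: "0 \<le> E t" and D0: "0 \<le> D t" for t by (auto simp: E_def D_def)
  have first: "E 0 \<le> \<sigma>\<^sup>2 / real b"
    using estimator_error_first[OF s] nn_e[of 0] by (simp add: ennreal_le_iff)
  have descent: "L * \<eta>\<^sup>2 / 4 * (\<Sum>t\<le>m. \<gamma> t * G t) + V (Suc m)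
     \<le> V 0 + \<kappa> / (2 * L) * (discounted_tail \<beta> \<gamma> m 0 * E 0
         + (1 - \<beta>)\<^sup>2 * \<sigma>\<^sup>2 * (\<Sum>t\<le>m. discounted_tail \<beta> \<gamma> m (Suc t)))"
  proof (rule stage_descent[OF L_pos eta_pos beta gamma(1) g k])
    fix t assume t: "t \<le> m"
    have "(\<integral>\<omega>. \<Phi> (x s (Suc t) \<omega>) + \<gamma> t / 2 * (\<delta> + L - L * \<gamma> t) * (norm (d s t \<omega>))\<^sup>2 \<partial>M)
        \<le> (\<integral>\<omega>. \<Phi> (x s t \<omega>) + \<gamma> t / (2 * L) * (norm (e s t \<omega>))\<^sup>2 \<partial>M)"
      using int(1-4)[OF t] step_pathwise[OF _ s t]
      by (intro integral_mono Bochner_Integration.integrable_add integrable_mult_right) auto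
    then show "V (Suc t) + \<gamma> t / 2 * (\<delta> + L - L * \<gamma> t) * D t \<le> V t + \<gamma> t / (2 * L) * E t"
      unfolding V_def D_def E_def
      using int(1-4)[OF t]
      by (simp only: Bochner_Integration.integral_add integrable_mult_right integral_mult_right_zero)
    have "(\<integral>\<omega>. \<eta>\<^sup>2 * (norm (gradient_mapping f \<psi> \<eta> (x s t \<omega>)))\<^sup>2 \<partial>M)
        \<le> (\<integral>\<omega>. 2 * (norm (d s t \<omega>))\<^sup>2 + 2 * \<eta>\<^sup>2 * (norm (e s t \<omega>))\<^sup>2 \<partial>M)"
      using int(2,3,5)[OF t] gradient_mapping_bound[OF refl]
      by (intro integral_mono Bochner_Integration.integrable_add integrable_mult_right) auto
    then show "\<eta>\<^sup>2 * G t \<le> 2 * D t + 2 * \<eta>\<^sup>2 * E t"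
      unfolding G_def D_def E_def
      using int(2,3,5)[OF t]
      by (simp only: Bochner_Integration.integral_add integrable_mult_right integral_mult_right_zero)
  next
    fix t assume t: "t < m"
    let ?r = "\<beta>\<^sup>2 * E t + \<beta>\<^sup>2 * L\<^sup>2 * (\<gamma> t)\<^sup>2 * D t + (1 - \<beta>)\<^sup>2 * \<sigma>\<^sup>2"
    have "ennreal (E (Suc t)) \<le> ennreal (\<beta>\<^sup>2) * ennreal (E t) + ennreal (\<beta>\<^sup>2 * L\<^sup>2 * (\<gamma> t)\<^sup>2) * ennreal (D t)
        + ennreal ((1 - \<beta>)\<^sup>2 * \<sigma>\<^sup>2)"
      using estimator_error_step[OF s t] nn_e[of t] nn_e[of "Suc t"] nn_d[of t] t by simp
    also have "\<dots> = ennreal ?r"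
      using E0[of t] D0[of t] by (simp add: ennreal_mult ennreal_plus)
    finally show "E (Suc t) \<le> ?r" using E0[of t] D0[of t] by (subst (asm) ennreal_le_iff) auto
  qed
  have "0 \<le> discounted_tail \<beta> \<gamma> m 0"
    using gamma(1) beta by (intro discounted_tail_nonneg) (auto intro: less_imp_le)
  then have "\<kappa> / (2 * L) * (discounted_tail \<beta> \<gamma> m 0 * E 0) \<le> \<kappa> / (2 * L) * (discounted_tail \<beta> \<gamma> m 0 * (\<sigma>\<^sup>2 / real b))"
    using first L_pos k by (intro mult_left_mono) auto
  then show ?thesis using descent unfolding V_def G_def by (simp add: distrib_left)
qed

text \<open>The objective values telescope across stages, since a stage starts where the previous
  one ends. Each stage restarts its estimator from a new batch, so the noise cost C recurs per stage
  instead of compounding.\<close>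

lemma restart_bound:
  assumes k: "\<kappa> = 1 + L\<^sup>2 * \<eta>\<^sup>2" and S: "1 \<le> S"
    and g: "\<And>t. t \<le> m \<Longrightarrow> L * \<gamma> t * (1 + \<kappa> * (\<beta>\<^sup>2 * discounted_tail \<beta> \<gamma> m (Suc t))) = \<delta>"
    and C: "\<kappa> / (2 * L) * (discounted_tail \<beta> \<gamma> m 0 * (\<sigma>\<^sup>2 / real b)
           + (1 - \<beta>)\<^sup>2 * \<sigma>\<^sup>2 * (\<Sum>t\<le>m. discounted_tail \<beta> \<gamma> m (Suc t))) \<le> C"
  shows "L * \<eta>\<^sup>2 / 4 * (\<Sum>s=1..S. \<Sum>t\<le>m. \<gamma> t * (\<integral>\<omega>. (norm (gradient_mapping f \<psi> \<eta> (x s t \<omega>)))\<^sup>2 \<partial>M))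
    \<le> \<Phi> x0 - Fmin + real S * C"
proof -
  define g where "g s = (\<Sum>t\<le>m. \<gamma> t * (\<integral>\<omega>. (norm (gradient_mapping f \<psi> \<eta> (x s t \<omega>)))\<^sup>2 \<partial>M))" for s
  have stage: "L * \<eta>\<^sup>2 / 4 * g s + (\<integral>\<omega>. \<Phi> (x s (Suc m) \<omega>) \<partial>M) \<le> (\<integral>\<omega>. \<Phi> (x s 0 \<omega>) \<partial>M) + C"
    if "1 \<le> s" "s \<le> S" for s
    unfolding g_def using stage_bound[OF that k assms(3)] C by linarith
  have "n \<le> S \<Longrightarrow> L * \<eta>\<^sup>2 / 4 * (\<Sum>s=1..n. g s) + (\<integral>\<omega>. \<Phi> (x n (Suc m) \<omega>) \<partial>M) \<le> \<Phi> x0 + real n * C"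
    if "1 \<le> n" for n
    using that
  proof (induction n rule: dec_induct)
    case base
    have "(\<integral>\<omega>. \<Phi> (x 1 0 \<omega>) \<partial>M) = (\<integral>\<omega>. \<Phi> x0 \<partial>M)"
      using x_first by (intro Bochner_Integration.integral_cong) auto
    then show ?case using stage[of 1] base by (simp add: prob_space)
  next
    case (step n)
    have "(\<integral>\<omega>. \<Phi> (x (Suc n) 0 \<omega>) \<partial>M) = (\<integral>\<omega>. \<Phi> (x n (Suc m) \<omega>) \<partial>M)"
      using x_next[of _ n] step by (intro Bochner_Integration.integral_cong) auto
    then have "L * \<eta>\<^sup>2 / 4 * (\<Sum>s=1..n. g s) + L * \<eta>\<^sup>2 / 4 * g (Suc n) + (\<integral>\<omega>. \<Phi> (x (Suc n) (Suc m) \<omega>) \<partial>M)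
        \<le> \<Phi> x0 + real n * C + C"
      using stage[of "Suc n"] step by simp
    then show ?case using step by (simp add: distrib_left distrib_right)
  qed
  note this[OF S order_refl]
  moreover have "Fmin \<le> (\<integral>\<omega>. \<Phi> (x S (Suc m) \<omega>) \<partial>M)"
  proof -
    have "(\<integral>\<omega>. Fmin \<partial>M) \<le> (\<integral>\<omega>. \<Phi> (x S (Suc m) \<omega>) \<partial>M)"
      using all_integrable(4)[OF S order_refl order_refl] iterates_in_dom[OF _ S order_refl order_refl]
      by (intro integral_mono lower) auto
    then show ?thesis by (simp add: prob_space)
  qed
  ultimately show ?thesis unfolding g_def by linarith
qed

text \<open>The integrand is split by the value of \<open>T\<close>. Each iterate is a function of
  the samples, of which \<open>T\<close> is independent, so the probability factors out.
  \<open>p_sum\<close> excludes values of \<open>T\<close> outside the range of the iterates almost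
  surely.\<close>

lemma random_output:
  assumes T: "T \<in> measurable M (count_space UNIV)"
    and ind: "indep_set {T -` A \<inter> space M | A. A \<in> sets (count_space UNIV)}
       {(\<lambda>\<omega>. \<lambda>i\<in>sample_indices S b m. X i \<omega>) -` B \<inter> space M | B. B \<in> sets (PiM (sample_indices S b m) (\<lambda>_. P))}"
    and p: "\<And>s t. s \<in> {1..S} \<Longrightarrow> t \<le> m \<Longrightarrow> prob {\<omega> \<in> space M. T \<omega> = (s, t)} = p s t"
    and p_sum: "(\<Sum>s=1..S. \<Sum>t\<le>m. p s t) = 1"
  shows "expected_sq_gradient_mapping M f \<psi> \<eta> x T =
    ennreal (\<Sum>s=1..S. \<Sum>t\<le>m. p s t * (\<integral>\<omega>. (norm (gradient_mapping f \<psi> \<eta> (x s t \<omega>)))\<^sup>2 \<partial>M))"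
proof -
  define h where "h r \<omega> = ennreal ((norm (gradient_mapping f \<psi> \<eta> (x (fst r) (snd r) \<omega>)))\<^sup>2)" for r \<omega>
  define R where "R = {1..S} \<times> {..m}"
  have [simp]: "finite R" by (simp add: R_def)
  note [measurable] = T
  have hm: "h r \<in> borel_measurable M" if "r \<in> R" for r
  proof -
    have [measurable]: "x (fst r) (snd r) \<in> borel_measurable M"
      using that iterates_measurable_M(1) by (auto simp: R_def)
    show ?thesis unfolding h_def by measurable
  qed
  have pr_T: "prob {\<omega> \<in> space M. T \<omega> = r} = p (fst r) (snd r)" if "r \<in> R" for r
    using that p[of "fst r" "snd r"] by (auto simp: R_def)
  have "prob {\<omega> \<in> space M. T \<omega> \<in> R} = prob (\<Union>r\<in>R. {\<omega> \<in> space M. T \<omega> = r})"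
    by (intro arg_cong[where f = prob]) auto
  also have "\<dots> = (\<Sum>r\<in>R. prob {\<omega> \<in> space M. T \<omega> = r})"
    by (intro finite_measure_finite_Union) (auto simp: disjoint_family_on_def)
  also have "\<dots> = (\<Sum>r\<in>R. p (fst r) (snd r))" using pr_T by (intro sum.cong) auto
  also have "\<dots> = 1" using p_sum by (simp add: R_def sum.cartesian_product case_prod_beta)
  finally have "AE \<omega> in M. T \<omega> \<in> R" by (subst (asm) prob_Collect_eq_1) auto
  then have "expected_sq_gradient_mapping M f \<psi> \<eta> x T = (\<integral>\<^sup>+\<omega>. (\<Sum>r\<in>R. indicator {r} (T \<omega>) * h r \<omega>) \<partial>M)"
    unfolding expected_sq_gradient_mapping_def
  proof (intro nn_integral_cong_AE, elim AE_mp, intro AE_I2 impI)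
    fix \<omega> assume "T \<omega> \<in> R"
    then have "(\<Sum>r\<in>R. indicator {r} (T \<omega>) * h r \<omega>) = (\<Sum>r\<in>{T \<omega>}. indicator {r} (T \<omega>) * h r \<omega>)"
      by (intro sum.mono_neutral_right) (auto simp: indicator_def)
    then show "ennreal ((norm (gradient_mapping f \<psi> \<eta> (x (fst (T \<omega>)) (snd (T \<omega>)) \<omega>)))\<^sup>2)
        = (\<Sum>r\<in>R. indicator {r} (T \<omega>) * h r \<omega>)" by (simp add: h_def)
  qed
  also have "\<dots> = (\<Sum>r\<in>R. \<integral>\<^sup>+\<omega>. indicator {r} (T \<omega>) * h r \<omega> \<partial>M)"
    using hm measurable_compose[OF T, of "indicator {_}" borel]
    by (intro nn_integral_sum borel_measurable_times_ennreal) auto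
  also have "\<dots> = (\<Sum>r\<in>R. ennreal (p (fst r) (snd r) * (\<integral>\<omega>. (norm (gradient_mapping f \<psi> \<eta> (x (fst r) (snd r) \<omega>)))\<^sup>2 \<partial>M)))"
  proof (intro sum.cong refl)
    fix r assume r: "r \<in> R"
    obtain s t where st: "r = (s, t)" by (cases r)
    have s: "1 \<le> s" "s \<le> S" and t: "t \<le> m" using r by (auto simp: R_def st)
    let ?I = "sample_indices S b m"
    let ?H = "\<lambda>u y. indicator {r} u * ennreal ((norm (gradient_mapping f \<psi> \<eta> y))\<^sup>2) :: ennreal"
    have xI: "x s t \<in> borel_measurable (hist ?I)"
      using iterates_measurable(1)[OF s t] 
      by (rule measurable_hist_mono) (use s t in \<open>simp_all add: past_indices_subset\<close>)
    \<comment> \<open>The preimages already form a sigma-algebra, so the family in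
      \<open>ind\<close> contains every event determined by an iterate.\<close>
    have "sets (hist ?I) = {(\<lambda>\<omega>. \<lambda>i\<in>?I. X i \<omega>) -` B \<inter> space M | B. B \<in> sets (PiM ?I (\<lambda>_. P))}"
      unfolding hist_def by (rule sets_vimage_algebra2) (use restrict_measurable[of ?I] in \<open>auto dest: measurable_space\<close>)
    then have sub: "{x s t -` B \<inter> space M | B. B \<in> sets borel}
        \<subseteq> {(\<lambda>\<omega>. \<lambda>i\<in>?I. X i \<omega>) -` B \<inter> space M | B. B \<in> sets (PiM ?I (\<lambda>_. P))}"
      using measurable_sets[OF xI] by auto
    have ind': "indep_set {T -` A \<inter> space M | A. A \<in> sets (count_space UNIV)} {x s t -` B \<inter> space M | B. B \<in> sets borel}"
      using ind sub unfolding indep_set_def by (elim indep_sets_mono_sets) (simp split: bool.split)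
    have xM: "x s t \<in> borel_measurable M" by (rule iterates_measurable_M[OF s t])
    have "(\<lambda>z. indicator {r} (fst z) :: ennreal) \<in> borel_measurable (count_space UNIV \<Otimes>\<^sub>M borel)"
      by (rule measurable_compose[OF measurable_fst]) simp
    moreover have "(\<lambda>z. ennreal ((norm (gradient_mapping f \<psi> \<eta> (snd z)))\<^sup>2)) \<in> borel_measurable (count_space UNIV \<Otimes>\<^sub>M borel)"
      by (rule measurable_compose[OF measurable_snd]) measurable
    ultimately have H: "case_prod ?H \<in> borel_measurable (count_space UNIV \<Otimes>\<^sub>M borel)"
      unfolding case_prod_beta by (rule borel_measurable_times_ennreal)
    have "(\<integral>\<^sup>+\<omega>. indicator {r} (T \<omega>) * h r \<omega> \<partial>M)
        = (\<integral>\<^sup>+\<omega>. (\<integral>\<^sup>+y. indicator {r} (T \<omega>) * ennreal ((norm (gradient_mapping f \<psi> \<eta> y))\<^sup>2) \<partial>distr M borel (x s t)) \<partial>M)"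
      using nn_integral_indep_set[OF T xM ind' H] by (simp add: h_def st)
    also have "\<dots> = (\<integral>\<^sup>+\<omega>. indicator {r} (T \<omega>) * (\<integral>\<^sup>+\<omega>. h r \<omega> \<partial>M) \<partial>M)"
      using xM by (intro nn_integral_cong) (simp add: nn_integral_cmult nn_integral_distr h_def st)
    also have "\<dots> = (\<integral>\<^sup>+\<omega>. indicator {\<omega> \<in> space M. T \<omega> = r} \<omega> * (\<integral>\<^sup>+\<omega>. h r \<omega> \<partial>M) \<partial>M)"
      by (intro nn_integral_cong) (auto simp: indicator_def)
    also have "\<dots> = emeasure M {\<omega> \<in> space M. T \<omega> = r} * (\<integral>\<^sup>+\<omega>. h r \<omega> \<partial>M)"
      by (subst nn_integral_multc) auto
    also have "emeasure M {\<omega> \<in> space M. T \<omega> = r} = ennreal (p s t)"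
      using pr_T[OF r] by (simp add: emeasure_eq_measure st)
    also have "(\<integral>\<^sup>+\<omega>. h r \<omega> \<partial>M) = ennreal (\<integral>\<omega>. (norm (gradient_mapping f \<psi> \<eta> (x s t \<omega>)))\<^sup>2 \<partial>M)"
      unfolding h_def st using all_integrable(5)[OF s t] by (simp add: nn_integral_eq_integral)
    also have "ennreal (p s t) * \<dots> = ennreal (p s t * (\<integral>\<omega>. (norm (gradient_mapping f \<psi> \<eta> (x s t \<omega>)))\<^sup>2 \<partial>M))"
      using pr_T[OF r] by (intro ennreal_mult[symmetric]) (auto simp: st intro: order_trans[OF measure_nonneg eq_refl])
    finally show "(\<integral>\<^sup>+\<omega>. indicator {r} (T \<omega>) * h r \<omega> \<partial>M)
        = ennreal (p (fst r) (snd r) * (\<integral>\<omega>. (norm (gradient_mapping f \<psi> \<eta> (x (fst r) (snd r) \<omega>)))\<^sup>2 \<partial>M))"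
      by (simp add: st)
  qed
  also have "\<dots> = ennreal (\<Sum>r\<in>R. p (fst r) (snd r) * (\<integral>\<omega>. (norm (gradient_mapping f \<psi> \<eta> (x (fst r) (snd r) \<omega>)))\<^sup>2 \<partial>M))"
  proof (intro sum_ennreal)
    fix r assume "r \<in> R"
    then have "0 \<le> p (fst r) (snd r)" using pr_T[of r] by (metis measure_nonneg)
    then show "0 \<le> p (fst r) (snd r) * (\<integral>\<omega>. (norm (gradient_mapping f \<psi> \<eta> (x (fst r) (snd r) \<omega>)))\<^sup>2 \<partial>M)" by simp
  qed
  finally show ?thesis by (simp add: R_def sum.cartesian_product case_prod_beta)
qed

end

section \<open>Rates and complexity\<close>

text \<open>Where the two noise sources are balanced: by \<open>q\<close>, 1 / bs equals (1 -
  \<beta>)^2 (m + 1), and (m + 1) h is at most the sum of the steps. Both weights become multiples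
  of (1 - \<beta>)^2 times that sum.\<close>

lemma step_sizes_summary:
  fixes a \<kappa> \<beta> bs :: real
  assumes a: "0 < a" "a \<le> 1" and k: "1 \<le> \<kappa>" "\<kappa> \<le> 2" and b: "0 < \<beta>" "\<beta> < 1"
    and bs: "0 < bs" and q: "(1 - \<beta>)\<^sup>2 * (bs * real (m + 1)) = 1"
    and g0: "\<And>t. t \<le> m \<Longrightarrow> 0 < \<gamma> t"
    and g: "\<And>t. t \<le> m \<Longrightarrow> \<gamma> t = a / (1 + \<kappa> * (\<beta>\<^sup>2 * discounted_tail \<beta> \<gamma> m (Suc t)))"
  shows "discounted_tail \<beta> \<gamma> m 0 / bs + (1 - \<beta>)\<^sup>2 * (\<Sum>t\<le>m. discounted_tail \<beta> \<gamma> m (Suc t))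
      \<le> 2 * (1 - \<beta>) * (\<Sum>t\<le>m. \<gamma> t)"
    and "real (m + 1) * (a * sqrt (1 - \<beta>) / (1 + sqrt a)) \<le> (\<Sum>t\<le>m. \<gamma> t)"
proof -
  obtain h where h: "0 < h" "\<And>t. t \<le> m \<Longrightarrow> h \<le> \<gamma> t" "a * sqrt (1 - \<beta>) / (1 + sqrt a) \<le> h"
    "(1 - \<beta>\<^sup>2) * discounted_tail \<beta> \<gamma> m 0 \<le> (1 + 2 * \<beta>) * h"
    using step_sizes_lower_bound[OF a k b g0 g] by blast
  let ?G = "\<Sum>t\<le>m. \<gamma> t" and ?Z = "discounted_tail \<beta> \<gamma> m 0" and ?Y = "\<Sum>t\<le>m. discounted_tail \<beta> \<gamma> m (Suc t)"
  have Nh: "real (m + 1) * h \<le> ?G"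
    using sum_bounded_below[of "{..m}" h \<gamma>] h(2) by simp
  have "real (m + 1) * (a * sqrt (1 - \<beta>) / (1 + sqrt a)) \<le> real (m + 1) * h"
    using h(3) by (intro mult_left_mono) auto
  then show "real (m + 1) * (a * sqrt (1 - \<beta>) / (1 + sqrt a)) \<le> ?G" using Nh by linarith
  have Y0: "0 \<le> ?Z" using discounted_tail_nonneg[of m \<gamma> \<beta> 0] g0 b by (force intro: less_imp_le)
  have Ns: "1 / bs = (1 - \<beta>)\<^sup>2 * real (m + 1)" using q bs by (simp add: field_simps)
  have "(1 - \<beta>\<^sup>2) * (?Z / bs) = ((1 - \<beta>\<^sup>2) * ?Z) * (1 / bs)" by simp
  also have "\<dots> \<le> ((1 + 2 * \<beta>) * h) * (1 / bs)" using h(4) bs by (intro mult_right_mono) auto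
  also have "\<dots> = (1 + 2 * \<beta>) * (1 - \<beta>)\<^sup>2 * (real (m + 1) * h)" unfolding Ns by (simp only: mult_ac)
  also have "\<dots> \<le> (1 + 2 * \<beta>) * (1 - \<beta>)\<^sup>2 * ?G" using Nh b by (intro mult_left_mono) auto
  finally have 1: "(1 - \<beta>\<^sup>2) * (?Z / bs) \<le> (1 + 2 * \<beta>) * (1 - \<beta>)\<^sup>2 * ?G" .
  have "(1 - \<beta>\<^sup>2) * ?Y \<le> ?G" using sum_discounted_tail[of \<gamma> m \<beta>] Y0 by linarith
  then have 2: "(1 - \<beta>)\<^sup>2 * ((1 - \<beta>\<^sup>2) * ?Y) \<le> (1 - \<beta>)\<^sup>2 * ?G" by (intro mult_left_mono) auto
  have "(1 - \<beta>\<^sup>2) * (?Z / bs + (1 - \<beta>)\<^sup>2 * ?Y) \<le> (1 + 2 * \<beta>) * (1 - \<beta>)\<^sup>2 * ?G + (1 - \<beta>)\<^sup>2 * ?G"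
    using 1 2 by (simp only: distrib_left mult.left_commute[of "1 - \<beta>\<^sup>2" "(1 - \<beta>)\<^sup>2"])
  \<comment> \<open>(1 + 2 \<beta>) + 1 = 2 (1 + \<beta>): the constant 1 + 2 \<beta> carried
    through the step size bounds is the one that restores the factor 1 - \<beta>^2.\<close>
  also have "\<dots> = (1 - \<beta>\<^sup>2) * (2 * (1 - \<beta>) * ?G)" by (simp add: power2_eq_square algebra_simps)
  finally show "?Z / bs + (1 - \<beta>)\<^sup>2 * ?Y \<le> 2 * (1 - \<beta>) * ?G"
    using b by (subst (asm) mult_le_cancel_left_pos) (auto simp: power_less_one_iff)
qed

text \<open>The left side is the reciprocal of the lower bound for the sum of the steps, with 1 -
  \<beta> = 1 / sqrt (bs n). Its square root is a fourth root, and n / n powr (1/4) = n powr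
  (3/4).\<close>

lemma inverse_step_sum_bound:
  fixes L \<delta> bs n :: real
  assumes "0 < L" "0 < \<delta>" "0 < bs" "0 < n"
  shows "1 / (n * (\<delta> / L * sqrt (1 / sqrt (bs * n)) / (1 + sqrt (\<delta> / L))))
     = bs powr (1/4) * (L + sqrt (L * \<delta>)) / (\<delta> * n powr (3/4))"
proof -
  have "sqrt (1 / sqrt (bs * n)) = 1 / (((bs * n) powr (1/2)) powr (1/2))"
    using assms by (simp add: real_sqrt_divide powr_half_sqrt)
  also have "\<dots> = 1 / (bs powr (1/4) * n powr (1/4))" using assms by (simp add: powr_powr powr_mult)
  finally have 1: "sqrt (1 / sqrt (bs * n)) = 1 / (bs powr (1/4) * n powr (1/4))" .
  have 2: "n powr (1/4) * n powr (3/4) = n" using assms powr_add[of n "1/4" "3/4"] by simp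
  have "sqrt (\<delta> / L) = sqrt (L * \<delta>) / L"
    using assms by (simp add: real_sqrt_divide real_sqrt_mult field_simps)
  then have 3: "1 + sqrt (\<delta> / L) = (L + sqrt (L * \<delta>)) / L" using assms by (simp add: field_simps)
  have 4: "0 < n powr (1/4)" "0 < n powr (3/4)" "0 < bs powr (1/4)" "0 < L + sqrt (L * \<delta>)"
    using assms by (auto intro: add_pos_nonneg)
  have "n * (\<delta> / L * sqrt (1 / sqrt (bs * n)) / (1 + sqrt (\<delta> / L)))
      = (n powr (1/4) * n powr (3/4)) * (\<delta> / L * (1 / (bs powr (1/4) * n powr (1/4))) / ((L + sqrt (L * \<delta>)) / L))"
    unfolding 1 3 2 ..
  also have "\<dots> = \<delta> * n powr (3/4) / (bs powr (1/4) * (L + sqrt (L * \<delta>)))"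
  proof -
    have "(u * w) * (\<delta> / L * (1 / (c * u)) / (K / L)) = \<delta> * w / (c * K)" if "0 < u" "0 < c" "0 < K" for u w c K :: real
      using that assms by (simp add: field_simps)
    then show ?thesis using 4 by blast
  qed
  finally show ?thesis by simp
qed

text \<open>
  The constant 4 is smaller than the claimed \<open>8 * sqrt 2\<close>; the difference pays for rounding the
  batch size, the epoch length and the number of stages to integers.
\<close>

lemma (in hsgd_rs) expected_gradient_mapping_bound:
  assumes S: "1 \<le> S" and dL: "\<delta> \<le> L" and Le: "L * \<eta> \<le> 1"
    and beta_eq: "\<beta> = 1 - 1 / sqrt (real b * real (m + 1))"
    and g: "\<And>t. t \<le> m \<Longrightarrow>
        \<gamma> t = \<delta> / (L + L * (1 + L\<^sup>2 * \<eta>\<^sup>2) * (\<beta>\<^sup>2 * discounted_tail \<beta> \<gamma> m (Suc t)))"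
    and T: "T \<in> measurable M (count_space UNIV)"
    and ind: "indep_set {T -` A \<inter> space M | A. A \<in> sets (count_space UNIV)}
       {(\<lambda>\<omega>. \<lambda>i\<in>sample_indices S b m. X i \<omega>) -` B \<inter> space M | B. B \<in> sets (PiM (sample_indices S b m) (\<lambda>_. P))}"
    and p: "\<And>s t. s \<in> {1..S} \<Longrightarrow> t \<le> m \<Longrightarrow>
        prob {\<omega> \<in> space M. T \<omega> = (s, t)} = \<gamma> t / (real S * (\<Sum>j\<le>m. \<gamma> j))"
  shows "expected_sq_gradient_mapping M f \<psi> \<eta> x T
    \<le> ennreal (4 * real b powr (1/4) * (L + sqrt (L * \<delta>))
          / (L * \<delta> * \<eta>\<^sup>2 * real S * real (m + 1) powr (3/4)) * (\<Phi> x0 - Fmin)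
        + 8 * \<sigma>\<^sup>2 / (L\<^sup>2 * \<eta>\<^sup>2 * sqrt (real b * real (m + 1))))"
proof -
  define \<kappa> where "\<kappa> = 1 + L\<^sup>2 * \<eta>\<^sup>2"
  define N where "N = real (m + 1)"
  define \<Gamma> where "\<Gamma> = (\<Sum>t\<le>m. \<gamma> t)"
  define q where "q = 1 / sqrt (real b * N)"
  define G where "G s t = (\<integral>\<omega>. (norm (gradient_mapping f \<psi> \<eta> (x s t \<omega>)))\<^sup>2 \<partial>M)" for s t
  have N: "0 < N" and b0: "0 < real b" using b_pos by (auto simp: N_def)
  have q: "1 - \<beta> = q" "0 < q" using beta_eq N b0 by (auto simp: q_def N_def)
  have q2: "(1 - \<beta>)\<^sup>2 * (real b * real (m + 1)) = 1"
    unfolding q using N b0 by (simp add: q_def N_def power_divide)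
  have "(L * \<eta>)\<^sup>2 \<le> 1" using Le L_pos eta_pos by (simp add: power_le_one)
  then have k: "1 \<le> \<kappa>" "\<kappa> \<le> 2" by (auto simp: \<kappa>_def power_mult_distrib)
  let ?Y = "discounted_tail \<beta> \<gamma> m"
  have Y: "0 \<le> \<kappa> * (\<beta>\<^sup>2 * ?Y (Suc t))" for t
    using k discounted_tail_nonneg[of m \<gamma> \<beta> "Suc t"] gamma(1) beta by (force intro: less_imp_le)
  have g1: "\<gamma> t = \<delta> / L / (1 + \<kappa> * (\<beta>\<^sup>2 * ?Y (Suc t)))" if "t \<le> m" for t
    using g[OF that] by (simp add: \<kappa>_def[symmetric] distrib_left mult.assoc)
  have g2: "L * \<gamma> t * (1 + \<kappa> * (\<beta>\<^sup>2 * ?Y (Suc t))) = \<delta>" if "t \<le> m" for t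
    using g1[OF that] Y[of t] L_pos by simp
  have a: "0 < \<delta> / L" "\<delta> / L \<le> 1" using delta_pos L_pos dL by auto
  note sizes = step_sizes_summary[OF a k beta b0 q2 gamma(1) g1]
  have \<Gamma>: "0 < \<Gamma>" unfolding \<Gamma>_def using gamma(1) by (intro sum_pos) auto
  have C: "\<kappa> / (2 * L) * (?Y 0 * (\<sigma>\<^sup>2 / real b) + (1 - \<beta>)\<^sup>2 * \<sigma>\<^sup>2 * (\<Sum>t\<le>m. ?Y (Suc t))) \<le> 2 * \<sigma>\<^sup>2 * q * \<Gamma> / L"
  proof -
    have "\<kappa> / (2 * L) * (?Y 0 * (\<sigma>\<^sup>2 / real b) + (1 - \<beta>)\<^sup>2 * \<sigma>\<^sup>2 * (\<Sum>t\<le>m. ?Y (Suc t)))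
        = \<kappa> / (2 * L) * \<sigma>\<^sup>2 * (?Y 0 / real b + (1 - \<beta>)\<^sup>2 * (\<Sum>t\<le>m. ?Y (Suc t)))"
      by (simp add: algebra_simps)
    also have "\<dots> \<le> \<kappa> / (2 * L) * \<sigma>\<^sup>2 * (2 * (1 - \<beta>) * \<Gamma>)"
      using sizes(1) k L_pos unfolding \<Gamma>_def by (intro mult_left_mono) auto
    also have "\<dots> = \<kappa> * (\<sigma>\<^sup>2 * q * \<Gamma> / L)" unfolding q by simp
    also have "\<dots> \<le> 2 * (\<sigma>\<^sup>2 * q * \<Gamma> / L)" using k q \<Gamma> L_pos by (intro mult_right_mono) auto
    finally show ?thesis by simp
  qed
  have main: "L * \<eta>\<^sup>2 / 4 * (\<Sum>s=1..S. \<Sum>t\<le>m. \<gamma> t * G s t) \<le> \<Phi> x0 - Fmin + real S * (2 * \<sigma>\<^sup>2 * q * \<Gamma> / L)"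
    unfolding G_def by (rule restart_bound[OF \<kappa>_def S g2 C])
  have Le2: "0 < L * \<eta>\<^sup>2 / 4" using L_pos eta_pos by simp
  have S\<Gamma>: "0 < real S * \<Gamma>" using S \<Gamma> by simp
  have gap: "0 \<le> \<Phi> x0 - Fmin" using lower[OF x0_dom] by simp
  have "(\<Sum>s=1..S. \<Sum>t\<le>m. \<gamma> t / (real S * \<Gamma>)) = 1"
    using S\<Gamma> S \<Gamma> by (simp add: sum_divide_distrib[symmetric] \<Gamma>_def[symmetric])
  then have "expected_sq_gradient_mapping M f \<psi> \<eta> x T
      = ennreal (\<Sum>s=1..S. \<Sum>t\<le>m. \<gamma> t / (real S * \<Gamma>) * G s t)"
    unfolding G_def by (intro random_output[OF T ind]) (use p in \<open>auto simp: \<Gamma>_def\<close>)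
  also have "\<dots> \<le> ennreal (4 * real b powr (1/4) * (L + sqrt (L * \<delta>))
          / (L * \<delta> * \<eta>\<^sup>2 * real S * N powr (3/4)) * (\<Phi> x0 - Fmin)
        + 8 * \<sigma>\<^sup>2 / (L\<^sup>2 * \<eta>\<^sup>2 * sqrt (real b * N)))"
  proof (rule ennreal_leI)
    have "(\<Sum>s=1..S. \<Sum>t\<le>m. \<gamma> t / (real S * \<Gamma>) * G s t) = (\<Sum>s=1..S. \<Sum>t\<le>m. \<gamma> t * G s t) / (real S * \<Gamma>)"
      by (simp add: sum_divide_distrib)
    also have "\<dots> \<le> ((\<Phi> x0 - Fmin + real S * (2 * \<sigma>\<^sup>2 * q * \<Gamma> / L)) / (L * \<eta>\<^sup>2 / 4)) / (real S * \<Gamma>)"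
      using main Le2 S\<Gamma> by (intro divide_right_mono) (auto simp: pos_le_divide_eq mult.commute)
    \<comment> \<open>The noise is proportional to S times the sum of the steps, so normalizing by
      exactly this quantity removes both; only the initial gap keeps the factor 1 /
      \<Gamma>.\<close>
    also have "\<dots> = 4 / (L * \<eta>\<^sup>2 * real S) * (1 / \<Gamma>) * (\<Phi> x0 - Fmin) + 8 * \<sigma>\<^sup>2 * q / (L\<^sup>2 * \<eta>\<^sup>2)"
      using L_pos eta_pos S \<Gamma> by (simp add: field_simps power2_eq_square)
    also have "\<dots> \<le> 4 / (L * \<eta>\<^sup>2 * real S) * (real b powr (1/4) * (L + sqrt (L * \<delta>)) / (\<delta> * N powr (3/4))) * (\<Phi> x0 - Fmin)
        + 8 * \<sigma>\<^sup>2 * q / (L\<^sup>2 * \<eta>\<^sup>2)"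
    proof (intro add_right_mono mult_right_mono[OF mult_left_mono])
      let ?l = "N * (\<delta> / L * sqrt q / (1 + sqrt (\<delta> / L)))"
      have "?l \<le> \<Gamma>" using sizes(2) unfolding q N_def \<Gamma>_def .
      moreover have "0 < ?l" using N delta_pos L_pos q(2) by (auto intro!: mult_pos_pos divide_pos_pos add_pos_nonneg)
      ultimately have "1 / \<Gamma> \<le> 1 / ?l" by (intro frac_le) auto
      also have "\<dots> = real b powr (1/4) * (L + sqrt (L * \<delta>)) / (\<delta> * N powr (3/4))"
        unfolding q_def by (rule inverse_step_sum_bound) (use L_pos delta_pos b0 N in auto)
      finally show "1 / \<Gamma> \<le> real b powr (1/4) * (L + sqrt (L * \<delta>)) / (\<delta> * N powr (3/4))" .
    qed (use gap L_pos in auto)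
    finally show "(\<Sum>s=1..S. \<Sum>t\<le>m. \<gamma> t / (real S * \<Gamma>) * G s t)
      \<le> 4 * real b powr (1/4) * (L + sqrt (L * \<delta>)) / (L * \<delta> * \<eta>\<^sup>2 * real S * N powr (3/4)) * (\<Phi> x0 - Fmin)
        + 8 * \<sigma>\<^sup>2 / (L\<^sup>2 * \<eta>\<^sup>2 * sqrt (real b * N))"
      by (simp add: q_def mult_ac)
  qed
  finally show ?thesis unfolding N_def .
qed

text \<open>The algorithm predicate asserts some estimator separately for each realization. This
  recursion computes it from the iterates and samples, giving one function of the outcome whose
  measurability can be proved.\<close>

primrec hybrid_estimator ::
    "('w \<Rightarrow> 'a::euclidean_space \<Rightarrow> real) \<Rightarrow> nat \<Rightarrow> real \<Rightarrow> (nat \<Rightarrow> 'w) \<Rightarrow> (nat \<Rightarrow> 'w) \<Rightarrow> (nat \<Rightarrow> 'w) \<Rightarrow>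
     (nat \<Rightarrow> 'a) \<Rightarrow> nat \<Rightarrow> 'a" where
  "hybrid_estimator fs b \<beta> bt xi zeta x 0 = (1 / real b) *\<^sub>R (\<Sum>i<b. grad (fs (bt i)) (x 0))"
| "hybrid_estimator fs b \<beta> bt xi zeta x (Suc t) = \<beta> *\<^sub>R hybrid_estimator fs b \<beta> bt xi zeta x t
      + \<beta> *\<^sub>R (grad (fs (xi (Suc t))) (x (Suc t)) - grad (fs (xi (Suc t))) (x t))
      + (1 - \<beta>) *\<^sub>R grad (fs (zeta (Suc t))) (x (Suc t))"

lemma prox_hsgd_step:
  assumes "prox_hsgd fs \<psi> b m (\<lambda>_. \<beta>) \<gamma> (\<lambda>_. \<eta>) bt xi zeta x0 x"
  shows "x 0 = x0"
    and "t \<le> m \<Longrightarrow> x (Suc t) = (1 - \<gamma> t) *\<^sub>R x t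
      + \<gamma> t *\<^sub>R prox (\<lambda>u. ereal \<eta> * \<psi> u) (x t - \<eta> *\<^sub>R hybrid_estimator fs b \<beta> bt xi zeta x t)"
proof -
  obtain v xhat where run: "x 0 = x0" "v 0 = (1 / real b) *\<^sub>R (\<Sum>i<b. grad (fs (bt i)) x0)"
    "\<And>t. t \<in> {1..m} \<Longrightarrow> v t = \<beta> *\<^sub>R v (t - 1)
       + \<beta> *\<^sub>R (grad (fs (xi t)) (x t) - grad (fs (xi t)) (x (t - 1))) + (1 - \<beta>) *\<^sub>R grad (fs (zeta t)) (x t)"
    "\<And>t. t \<in> {0..m} \<Longrightarrow> xhat (t + 1) = prox (\<lambda>u. ereal \<eta> * \<psi> u) (x t - \<eta> *\<^sub>R v t)"
    "\<And>t. t \<in> {0..m} \<Longrightarrow> x (t + 1) = (1 - \<gamma> t) *\<^sub>R x t + \<gamma> t *\<^sub>R xhat (t + 1)"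
    using assms unfolding prox_hsgd_def by blast
  show "x 0 = x0" by (rule run)
  have "t \<le> m \<Longrightarrow> v t = hybrid_estimator fs b \<beta> bt xi zeta x t" for t
  proof (induction t)
    case 0
    then show ?case using run by simp
  next
    case (Suc t)
    then show ?case using run(3)[of "Suc t"] by simp
  qed
  then show "x (Suc t) = (1 - \<gamma> t) *\<^sub>R x t
      + \<gamma> t *\<^sub>R prox (\<lambda>u. ereal \<eta> * \<psi> u) (x t - \<eta> *\<^sub>R hybrid_estimator fs b \<beta> bt xi zeta x t)" if "t \<le> m"
    using run(4,5)[of t] that by simp
qed

section \<open>Complexity with rounded parameters\<close>

lemma max_one_square:
  assumes "0 \<le> (\<sigma>::real)"
  shows "max 1 (\<sigma>\<^sup>2) = (max 1 \<sigma>)\<^sup>2"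
proof (cases "\<sigma> \<le> 1")
  case True
  then have "\<sigma>\<^sup>2 \<le> 1" using assms by (simp add: power_le_one)
  then show ?thesis using True by (simp add: max_absorb1)
next
  case False
  then show ?thesis using one_le_power[of \<sigma> 2] by (simp add: max_absorb2)
qed

text \<open>With A = (4 max 1 \<sigma> / (L \<eta> \<epsilon>))^2 the prescribed batch is c1 A and
  the epoch A / c1, and each error term gets half of \<epsilon>^2. Doubling the batch costs 2 powr
  (1/4) \<le> sqrt 2 and halving the stages costs 2, which together is the gap between 4 and 8 sqrt
  2. The epoch length occurs only in denominators, so rounding it up is free.\<close>

lemma rounded_choice_bound:
  fixes L \<eta> \<delta> \<Delta> \<epsilon> c1 \<sigma> bs n S :: real
  assumes pos: "0 < L" "0 < \<eta>" "0 < \<delta>" "0 \<le> \<Delta>" "0 < \<epsilon>" "0 < c1" "0 \<le> \<sigma>" "0 < S"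
    and B: "batch_choice c1 L \<eta> \<sigma> \<epsilon> \<le> bs" "bs \<le> 2 * batch_choice c1 L \<eta> \<sigma> \<epsilon>"
    and E: "epoch_choice c1 L \<eta> \<sigma> \<epsilon> \<le> n"
    and S: "outer_bound c1 L \<eta> \<delta> \<Delta> \<epsilon> / max 1 \<sigma> \<le> 2 * S"
  shows "4 * bs powr (1/4) * (L + sqrt (L * \<delta>)) / (L * \<delta> * \<eta>\<^sup>2 * S * n powr (3/4)) * \<Delta>
        + 8 * \<sigma>\<^sup>2 / (L\<^sup>2 * \<eta>\<^sup>2 * sqrt (bs * n)) \<le> \<epsilon>\<^sup>2"
proof -
  define \<mu> where "\<mu> = max 1 \<sigma>"
  define A where "A = (4 * \<mu> / (L * \<eta> * \<epsilon>))\<^sup>2"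
  define K where "K = L + sqrt (L * \<delta>)"
  have mu: "1 \<le> \<mu>" "\<sigma> \<le> \<mu>" by (auto simp: \<mu>_def)
  have A: "0 < A" "sqrt A = 4 * \<mu> / (L * \<eta> * \<epsilon>)" using pos mu by (auto simp: A_def)
  have K: "0 < K" using pos by (simp add: K_def add_pos_nonneg)
  have Bc: "batch_choice c1 L \<eta> \<sigma> \<epsilon> = c1 * A" and Ec: "epoch_choice c1 L \<eta> \<sigma> \<epsilon> = A / c1"
    unfolding batch_choice_def epoch_choice_def A_def max_one_square[OF pos(7)] \<mu>_def[symmetric]
    by (simp_all add: power_divide power_mult_distrib)
  have Ac: "0 < c1 * A" "0 < A / c1" using A pos by auto
  have bn: "0 < bs" "0 < n" using B E Ac unfolding Bc Ec by auto
  have "A * A = (c1 * A) * (A / c1)" using pos by simp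
  also have "\<dots> \<le> bs * n" using B(1) E Ac bn unfolding Bc Ec by (intro mult_mono) auto
  finally have An: "A \<le> sqrt (bs * n)" by (intro real_le_rsqrt) (simp add: power2_eq_square)
  have "8 * \<sigma>\<^sup>2 / (L\<^sup>2 * \<eta>\<^sup>2 * sqrt (bs * n)) \<le> 8 * \<mu>\<^sup>2 / (L\<^sup>2 * \<eta>\<^sup>2 * A)"
    using An A pos mu bn by (intro frac_le mult_mono power_mono mult_left_mono) auto
  also have "\<dots> = \<epsilon>\<^sup>2 / 2" using pos mu by (simp add: A_def power_divide power_mult_distrib)
  finally have noise: "8 * \<sigma>\<^sup>2 / (L\<^sup>2 * \<eta>\<^sup>2 * sqrt (bs * n)) \<le> \<epsilon>\<^sup>2 / 2" .
  have "bs powr (1/4) / n powr (3/4) \<le> (2 * (c1 * A)) powr (1/4) / (A / c1) powr (3/4)"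
    using B E Ac bn unfolding Bc Ec by (intro frac_le powr_mono2) auto
  also have "\<dots> = 2 powr (1/4) * (c1 powr (1/4) * c1 powr (3/4)) * (A powr (1/4) / A powr (3/4))"
    using A pos by (simp add: powr_mult powr_divide)
  also have "c1 powr (1/4) * c1 powr (3/4) = c1" using pos powr_add[of c1 "1/4" "3/4"] by simp
  also have "A powr (1/4) / A powr (3/4) = 1 / sqrt A"
  proof -
    have "A powr (1/4) / A powr (3/4) = A powr - (1/2)" using powr_diff[of A "1/4" "3/4"] by simp
    also have "\<dots> = 1 / sqrt A" using A(1) by (simp only: powr_minus_divide) (simp add: powr_half_sqrt)
    finally show ?thesis .
  qed
  also have "2 powr (1/4) * c1 * (1 / sqrt A) \<le> sqrt 2 * c1 * (1 / sqrt A)"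
    using pos A(1) powr_mono[of "1/4" "1/2" "2::real"] by (intro mult_right_mono) (auto simp: powr_half_sqrt)
  finally have ratio: "bs powr (1/4) / n powr (3/4) \<le> sqrt 2 * c1 * (1 / sqrt A)" .
  have "4 * bs powr (1/4) * K / (L * \<delta> * \<eta>\<^sup>2 * S * n powr (3/4)) * \<Delta>
      = (bs powr (1/4) / n powr (3/4)) * (4 * K * \<Delta> / (L * \<delta> * \<eta>\<^sup>2 * S))" by (simp add: mult_ac)
  also have "\<dots> \<le> sqrt 2 * c1 * (1 / sqrt A) * (4 * K * \<Delta> / (L * \<delta> * \<eta>\<^sup>2 * S))"
    using ratio pos K by (intro mult_right_mono) auto
  also have "\<dots> = (outer_bound c1 L \<eta> \<delta> \<Delta> \<epsilon> / \<mu>) * (\<epsilon>\<^sup>2 / (4 * S))"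
    unfolding A(2) outer_bound_def K_def[symmetric] using pos mu by (simp add: field_simps power2_eq_square)
  also have "\<dots> \<le> 2 * S * (\<epsilon>\<^sup>2 / (4 * S))" using S pos unfolding \<mu>_def by (intro mult_right_mono) auto
  also have "\<dots> = \<epsilon>\<^sup>2 / 2" using pos by simp
  finally show ?thesis using noise unfolding K_def by linarith
qed

text \<open>Dividing the outer bound by \<open>max 1 \<sigma>\<close> turns the factor
  \<open>max 1 (\<sigma>\<^sup>2)\<close> of the epoch length into \<open>max 1 \<sigma>\<close>;
  this singles out the number of stages that matches the claimed totals.\<close>

lemma T_prox_eq:
  assumes "0 < L" "0 < \<eta>" "0 < \<delta>" "0 < \<epsilon>" "0 < c1" "0 \<le> \<sigma>"
  shows "T_prox L \<eta> \<delta> \<Delta> \<sigma> \<epsilon> = epoch_choice c1 L \<eta> \<sigma> \<epsilon> * (outer_bound c1 L \<eta> \<delta> \<Delta> \<epsilon> / max 1 \<sigma>)"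
proof -
  define \<mu> where "\<mu> = max 1 \<sigma>"
  have "0 < \<mu>" by (simp add: \<mu>_def)
  then show ?thesis
    unfolding T_prox_def epoch_choice_def outer_bound_def max_one_square[OF assms(6)] \<mu>_def[symmetric]
    using assms by (simp add: field_simps power2_eq_square power3_eq_cube)
qed

text \<open>The batch is c1^2 times the epoch length, whence the factor c1^2 + 3.\<close>

lemma T_grad_eq:
  assumes "0 < L" "0 < \<eta>" "0 < \<delta>" "0 < \<epsilon>" "0 < c1" "0 \<le> \<sigma>"
  shows "T_grad c1 L \<eta> \<delta> \<Delta> \<sigma> \<epsilon>
     = (batch_choice c1 L \<eta> \<sigma> \<epsilon> + 3 * epoch_choice c1 L \<eta> \<sigma> \<epsilon>) * (outer_bound c1 L \<eta> \<delta> \<Delta> \<epsilon> / max 1 \<sigma>)"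
proof -
  have "batch_choice c1 L \<eta> \<sigma> \<epsilon> = c1\<^sup>2 * epoch_choice c1 L \<eta> \<sigma> \<epsilon>"
    using assms by (simp add: batch_choice_def epoch_choice_def power2_eq_square[of c1] mult_ac)
  then have "(batch_choice c1 L \<eta> \<sigma> \<epsilon> + 3 * epoch_choice c1 L \<eta> \<sigma> \<epsilon>) * (outer_bound c1 L \<eta> \<delta> \<Delta> \<epsilon> / max 1 \<sigma>)
      = (c1\<^sup>2 + 3) * (epoch_choice c1 L \<eta> \<sigma> \<epsilon> * (outer_bound c1 L \<eta> \<delta> \<Delta> \<epsilon> / max 1 \<sigma>))"
    by (simp only: distrib_right mult.assoc)
  also have "\<dots> = T_grad c1 L \<eta> \<delta> \<Delta> \<sigma> \<epsilon>"
    unfolding T_prox_eq[OF assms, symmetric] by (simp add: T_prox_def T_grad_def)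
  finally show ?thesis by simp
qed

lemma bigo_of_scaled:
  fixes u g :: "'x \<Rightarrow> real"
  assumes "\<And>z. u z = K * g z"
  shows "u \<in> O[A](g)"
  by (rule bigoI[where c = "\<bar>K\<bar>"]) (simp add: assms abs_mult)

text \<open>In (b) the run uses the batch size and epoch length rounded up, while costs are counted
  with the unrounded values. \<open>N\<close> may be 0 although a run has at least one stage; the
  last conjunct of (b) records that the claimed proximal budget is then below one epoch.\<close>

theorem theorem3:
  fixes P :: "'w measure"
    and fs :: "'w \<Rightarrow> 'a::euclidean_space \<Rightarrow> real"
    and f :: "'a \<Rightarrow> real"
    and \<psi> F :: "'a \<Rightarrow> ereal"
    and L \<sigma> \<eta> \<delta> \<beta> \<Delta> :: real
    and \<gamma> :: "nat \<Rightarrow> real"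
    and b m :: nat
    and x0 :: 'a
  assumes P: "prob_space P"
    and fs_integrable: "\<And>x. integrable P (\<lambda>\<xi>. fs \<xi> x)"
    and fs_smooth: "\<And>\<xi>. \<xi> \<in> space P \<Longrightarrow> continuously_differentiable (fs \<xi>)"
    and f_def: "f = (\<lambda>x. \<integral>\<xi>. fs \<xi> x \<partial>P)"
    and f_differentiable: "\<And>x. f differentiable (at x)"
    and grad_integrable: "\<And>x. integrable P (\<lambda>\<xi>. grad (fs \<xi>) x)"
    and unbiased: "\<And>x. (\<integral>\<xi>. grad (fs \<xi>) x \<partial>P) = grad f x"
    and F_def: "F = (\<lambda>x. ereal (f x) + \<psi> x)"
    and A1_psi: "proper_closed_convex \<psi>"
    and A1_dom: "eff_dom F \<noteq> {}"
    and A1_inf: "(INF x. F x) > -\<infinity>"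
    and L_pos: "L > 0"
    and A2: "\<And>x y. x \<in> eff_dom F \<Longrightarrow> y \<in> eff_dom F \<Longrightarrow>
        (\<integral>\<^sup>+ \<xi>. ennreal ((norm (grad (fs \<xi>) x - grad (fs \<xi>) y))\<^sup>2) \<partial>P)
          \<le> ennreal (L\<^sup>2 * (norm (x - y))\<^sup>2)"
    and sigma_nonneg: "\<sigma> \<ge> 0"
    and A3: "\<And>x. x \<in> eff_dom F \<Longrightarrow>
        (\<integral>\<^sup>+ \<xi>. ennreal ((norm (grad (fs \<xi>) x - grad f x))\<^sup>2) \<partial>P) \<le> ennreal (\<sigma>\<^sup>2)"
    and b_pos: "b \<ge> 1"
    and beta_def: "\<beta> = 1 - 1 / sqrt (real b * real (m + 1))"
    and beta_range: "\<beta> \<in> {0<..<1}"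
    and eta_range: "\<eta> \<in> {0<..<1 / L}"
    and delta_def: "\<delta> = 2 / \<eta> - 2 * L"
    and gamma_m: "\<gamma> m = \<delta> / L"
    and gamma_rec: "\<And>t. t < m \<Longrightarrow>
        \<gamma> t = \<delta> / (L + L * (1 + L\<^sup>2 * \<eta>\<^sup>2) * (\<Sum>j=t+1..m. \<beta> ^ (2 * (j - t)) * \<gamma> j))"
    and gamma_range: "\<And>t. t \<le> m \<Longrightarrow> \<gamma> t \<in> {0<..1}"
    and x0_dom: "x0 \<in> eff_dom F"
    and Delta_def: "\<Delta> = real_of_ereal (F x0) - real_of_ereal (INF x. F x)"
  shows
    "(\<forall>(M :: 'o measure) S X x T.
        S \<ge> 1 \<longrightarrow>
        prox_hsgd_rs_run M P fs \<psi> S b m (\<lambda>_. \<beta>) \<gamma> (\<lambda>_. \<eta>) x0 X x T \<longrightarrow>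
        expected_sq_gradient_mapping M f \<psi> \<eta> x T
          \<le> ennreal (8 * sqrt 2 * real b powr (1/4) * (L + sqrt (L * \<delta>))
                        / (L * \<delta> * \<eta>\<^sup>2 * real S * real (m + 1) powr (3/4)) * \<Delta>
                     + 8 * \<sigma>\<^sup>2 / (L\<^sup>2 * \<eta>\<^sup>2 * sqrt (real b * real (m + 1)))))
     \<and>
     (\<forall>c1 \<epsilon>.
        \<epsilon> > 0 \<longrightarrow> c1 \<ge> 1 / real (m + 1) \<longrightarrow>
        batch_choice c1 L \<eta> \<sigma> \<epsilon> \<ge> 1 \<longrightarrow>
        int b = \<lceil>batch_choice c1 L \<eta> \<sigma> \<epsilon>\<rceil> \<longrightarrow>
        int (m + 1) = \<lceil>epoch_choice c1 L \<eta> \<sigma> \<epsilon>\<rceil> \<longrightarrow>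
        (\<exists>N::nat.
           int N \<le> \<lfloor>outer_bound c1 L \<eta> \<delta> \<Delta> \<epsilon>\<rfloor> \<and>
           (\<forall>(M :: 'o measure) S X x T.
              S \<ge> 1 \<longrightarrow> S \<ge> N \<longrightarrow>
              prox_hsgd_rs_run M P fs \<psi> S b m (\<lambda>_. \<beta>) \<gamma> (\<lambda>_. \<eta>) x0 X x T \<longrightarrow>
              expected_sq_gradient_mapping M f \<psi> \<eta> x T \<le> ennreal (\<epsilon>\<^sup>2)) \<and>
           (batch_choice c1 L \<eta> \<sigma> \<epsilon> + 3 * epoch_choice c1 L \<eta> \<sigma> \<epsilon>) * real N
             \<le> T_grad c1 L \<eta> \<delta> \<Delta> \<sigma> \<epsilon> \<and>
           epoch_choice c1 L \<eta> \<sigma> \<epsilon> * real N \<le> T_prox L \<eta> \<delta> \<Delta> \<sigma> \<epsilon> \<and>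
           (N = 0 \<longrightarrow> T_prox L \<eta> \<delta> \<Delta> \<sigma> \<epsilon> < epoch_choice c1 L \<eta> \<sigma> \<epsilon>)))
     \<and>
     (\<forall>c1. (\<lambda>(\<sigma>', \<epsilon>'). T_grad c1 L \<eta> \<delta> \<Delta> \<sigma>' \<epsilon>')
            \<in> O[principal ({0..} \<times> {0<..})](\<lambda>(\<sigma>', \<epsilon>'). max \<sigma>' 1 / \<epsilon>' ^ 3))
     \<and>
     (\<lambda>(\<sigma>', \<epsilon>'). T_prox L \<eta> \<delta> \<Delta> \<sigma>' \<epsilon>')
       \<in> O[principal ({0..} \<times> {0<..})](\<lambda>(\<sigma>', \<epsilon>'). max \<sigma>' 1 / \<epsilon>' ^ 3)"
proof -
  have eta: "0 < \<eta>" "L * \<eta> < 1" using eta_range L_pos by (auto simp: field_simps)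
  have delta: "0 < \<delta>" using eta L_pos by (simp add: delta_def field_simps)
  have dL: "\<delta> \<le> L" using gamma_range[of m] L_pos by (simp add: gamma_m)
  \<comment> \<open>At \<open>t = m\<close> the tail is empty, so the terminal step size is an
    instance of the same formula.\<close>
  have gam: "\<gamma> t = \<delta> / (L + L * (1 + L\<^sup>2 * \<eta>\<^sup>2) * (\<beta>\<^sup>2 * discounted_tail \<beta> \<gamma> m (Suc t)))" if "t \<le> m" for t
  proof (cases "t = m")
    case True
    then show ?thesis by (simp add: gamma_m discounted_tail_Suc_eq_0)
  next
    case False
    then show ?thesis using gamma_rec[of t] that unfolding discounted_tail_shift by simp
  qed
  have dom: "eff_dom F = eff_dom \<psi>"
    by (auto simp: eff_dom_def F_def)
  interpret P: prob_space P by (rule P)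
  interpret stochastic_composite \<psi> \<eta> P fs f L \<sigma>
    by unfold_locales (use A1_psi eta fs_smooth f_differentiable grad_integrable unbiased L_pos A2 sigma_nonneg A3 in
      \<open>auto simp: dom\<close>)
  define Fmin where "Fmin = real_of_ereal (INF x. F x)"
  have F_eq: "F u = ereal (\<Phi> u)" if "u \<in> eff_dom \<psi>" for u
    using psi_eq_psir[OF that] by (simp add: F_def \<Phi>_def)
  have x0: "x0 \<in> eff_dom \<psi>" using x0_dom dom by simp
  have "(INF x. F x) \<le> F x0" by (rule INF_lower) simp
  \<comment> \<open>The infimum is finite, from above by the value at x0 and from below by
    \<open>A1_inf\<close>, so the conversions to real in \<Delta> lose nothing.\<close>
  then have INF_eq: "(INF x. F x) = ereal Fmin"
    using A1_inf F_eq[OF x0] unfolding Fmin_def by (cases "INF x. F x") auto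
  have low: "Fmin \<le> \<Phi> u" if "u \<in> eff_dom \<psi>" for u
  proof -
    have "ereal Fmin \<le> F u" unfolding INF_eq[symmetric] by (rule INF_lower) simp
    then show ?thesis using F_eq[OF that] by simp
  qed
  have Delta: "\<Delta> = \<Phi> x0 - Fmin" using F_eq[OF x0] by (simp add: Delta_def Fmin_def)
  have gap: "0 \<le> \<Delta>" using low[OF x0] Delta by simp
  have main: "expected_sq_gradient_mapping M f \<psi> \<eta> x T
      \<le> ennreal (4 * real b powr (1/4) * (L + sqrt (L * \<delta>))
                  / (L * \<delta> * \<eta>\<^sup>2 * real S * real (m + 1) powr (3/4)) * \<Delta>
                 + 8 * \<sigma>\<^sup>2 / (L\<^sup>2 * \<eta>\<^sup>2 * sqrt (real b * real (m + 1))))"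
    if S: "S \<ge> 1" and run: "prox_hsgd_rs_run M P fs \<psi> S b m (\<lambda>_. \<beta>) \<gamma> (\<lambda>_. \<eta>) x0 X x T"
    for M :: "'o measure" and S X x T
  proof -
    define v where "v s t \<omega> = hybrid_estimator fs b \<beta> (\<lambda>i. X (Batch s i) \<omega>) (\<lambda>t. X (Xi s t) \<omega>)
        (\<lambda>t. X (Zeta s t) \<omega>) (\<lambda>t. x s t \<omega>) t" for s t \<omega>
    have M: "prob_space M" and ind: "prob_space.indep_vars M (\<lambda>_. P) X (sample_indices S b m)"
      and law: "\<And>i. i \<in> sample_indices S b m \<Longrightarrow> distr M P (X i) = P"
      and alg: "\<And>\<omega>. \<omega> \<in> space M \<Longrightarrow>
        prox_hsgd_rs fs \<psi> S b m (\<lambda>_. \<beta>) \<gamma> (\<lambda>_. \<eta>) (\<lambda>i. X i \<omega>) x0 (\<lambda>s t. x s t \<omega>)"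
      and T: "T \<in> measurable M (count_space UNIV)"
      and indT: "prob_space.indep_set M {T -` A \<inter> space M | A. A \<in> sets (count_space UNIV)}
       {(\<lambda>\<omega>. \<lambda>i\<in>sample_indices S b m. X i \<omega>) -` B \<inter> space M | B. B \<in> sets (PiM (sample_indices S b m) (\<lambda>_. P))}"
      and pT: "\<And>s t. s \<in> {1..S} \<Longrightarrow> t \<le> m \<Longrightarrow>
        measure M {\<omega> \<in> space M. T \<omega> = (s, t)} = \<gamma> t / (real S * (\<Sum>j=0..m. \<gamma> j))"
      using run unfolding prox_hsgd_rs_run_def by auto
    have init: "x 1 0 \<omega> = x0" and restart: "1 \<le> s \<Longrightarrow> s < S \<Longrightarrow> x (Suc s) 0 \<omega> = x s (Suc m) \<omega>"
      and step: "1 \<le> s \<Longrightarrow> s \<le> S \<Longrightarrow> t \<le> m \<Longrightarrow>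
        x s (Suc t) \<omega> = (1 - \<gamma> t) *\<^sub>R x s t \<omega> + \<gamma> t *\<^sub>R pr (x s t \<omega> - \<eta> *\<^sub>R v s t \<omega>)"
      if \<omega>: "\<omega> \<in> space M" for s t \<omega>
    proof -
      obtain xbar where xbar: "xbar 0 = x0" "\<And>s. s \<in> {1..S} \<Longrightarrow> prox_hsgd fs \<psi> b m (\<lambda>_. \<beta>) \<gamma> (\<lambda>_. \<eta>)
             (\<lambda>i. X (Batch s i) \<omega>) (\<lambda>t. X (Xi s t) \<omega>) (\<lambda>t. X (Zeta s t) \<omega>) (xbar (s - 1)) (\<lambda>t. x s t \<omega>)"
        "\<And>s. s \<in> {1..S} \<Longrightarrow> xbar s = x s (m + 1) \<omega>"
        using alg[OF \<omega>] unfolding prox_hsgd_rs_def by auto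
      show "x 1 0 \<omega> = x0" using prox_hsgd_step(1)[OF xbar(2)[of 1]] xbar(1) S by simp
      show "x (Suc s) 0 \<omega> = x s (Suc m) \<omega>" if "1 \<le> s" "s < S"
        using prox_hsgd_step(1)[OF xbar(2)[of "Suc s"]] xbar(3)[of s] that by simp
      show "x s (Suc t) \<omega> = (1 - \<gamma> t) *\<^sub>R x s t \<omega> + \<gamma> t *\<^sub>R pr (x s t \<omega> - \<eta> *\<^sub>R v s t \<omega>)"
        if "1 \<le> s" "s \<le> S" "t \<le> m"
        unfolding v_def using prox_hsgd_step(2)[OF xbar(2)[of s] that(3)] that by simp
    qed
    interpret M: prob_space M by (rule M)
    interpret iid: iid_samples M P X "sample_indices S b m"
      by unfold_locales (use ind law in auto)
    interpret R: hsgd_rs \<psi> \<eta> P fs f L \<sigma> M X S b m \<beta> \<delta> \<gamma> x0 x v Fmin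
      by unfold_locales
        (use b_pos beta_range delta_def delta gamma_range x0 low init restart step in \<open>auto simp: v_def\<close>)
    show ?thesis
      unfolding Delta
      by (rule R.expected_gradient_mapping_bound)
        (use S dL eta beta_def gam T indT pT in \<open>auto simp: atLeast0AtMost\<close>)
  qed
  have part_a: "expected_sq_gradient_mapping M f \<psi> \<eta> x T
      \<le> ennreal (8 * sqrt 2 * real b powr (1/4) * (L + sqrt (L * \<delta>))
                  / (L * \<delta> * \<eta>\<^sup>2 * real S * real (m + 1) powr (3/4)) * \<Delta>
                 + 8 * \<sigma>\<^sup>2 / (L\<^sup>2 * \<eta>\<^sup>2 * sqrt (real b * real (m + 1))))"
    if "S \<ge> 1" "prox_hsgd_rs_run M P fs \<psi> S b m (\<lambda>_. \<beta>) \<gamma> (\<lambda>_. \<eta>) x0 X x T"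
    for M :: "'o measure" and S X x T
  proof -
    define K where "K = real b powr (1/4) * (L + sqrt (L * \<delta>)) / (L * \<delta> * \<eta>\<^sup>2 * real S * real (m + 1) powr (3/4)) * \<Delta>"
    have "0 \<le> L + sqrt (L * \<delta>)" using L_pos delta by (simp add: add_nonneg_nonneg)
    then have "0 \<le> K" unfolding K_def using gap L_pos delta by (intro mult_nonneg_nonneg divide_nonneg_nonneg) auto
    moreover have "4 \<le> 8 * sqrt 2" using real_sqrt_ge_1_iff[of 2] by linarith
    ultimately have "4 * K \<le> 8 * sqrt 2 * K" by (intro mult_right_mono)
    then have "4 * K + 8 * \<sigma>\<^sup>2 / (L\<^sup>2 * \<eta>\<^sup>2 * sqrt (real b * real (m + 1)))
        \<le> 8 * sqrt 2 * K + 8 * \<sigma>\<^sup>2 / (L\<^sup>2 * \<eta>\<^sup>2 * sqrt (real b * real (m + 1)))" by linarith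
    from order_trans[OF main[OF that] ennreal_leI] this show ?thesis
      unfolding K_def by (simp add: mult.assoc)
  qed
  have part_b: "\<exists>N::nat.
           int N \<le> \<lfloor>outer_bound c1 L \<eta> \<delta> \<Delta> \<epsilon>\<rfloor> \<and>
           (\<forall>(M :: 'o measure) S X x T.
              S \<ge> 1 \<longrightarrow> S \<ge> N \<longrightarrow>
              prox_hsgd_rs_run M P fs \<psi> S b m (\<lambda>_. \<beta>) \<gamma> (\<lambda>_. \<eta>) x0 X x T \<longrightarrow>
              expected_sq_gradient_mapping M f \<psi> \<eta> x T \<le> ennreal (\<epsilon>\<^sup>2)) \<and>
           (batch_choice c1 L \<eta> \<sigma> \<epsilon> + 3 * epoch_choice c1 L \<eta> \<sigma> \<epsilon>) * real N
             \<le> T_grad c1 L \<eta> \<delta> \<Delta> \<sigma> \<epsilon> \<and>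
           epoch_choice c1 L \<eta> \<sigma> \<epsilon> * real N \<le> T_prox L \<eta> \<delta> \<Delta> \<sigma> \<epsilon> \<and>
           (N = 0 \<longrightarrow> T_prox L \<eta> \<delta> \<Delta> \<sigma> \<epsilon> < epoch_choice c1 L \<eta> \<sigma> \<epsilon>)"
    if eps: "\<epsilon> > 0" and c1: "c1 \<ge> 1 / real (m + 1)" and B1: "batch_choice c1 L \<eta> \<sigma> \<epsilon> \<ge> 1"
      and bB: "int b = \<lceil>batch_choice c1 L \<eta> \<sigma> \<epsilon>\<rceil>" and mE: "int (m + 1) = \<lceil>epoch_choice c1 L \<eta> \<sigma> \<epsilon>\<rceil>"
    for c1 \<epsilon>
  proof -
    let ?B = "batch_choice c1 L \<eta> \<sigma> \<epsilon>" and ?E = "epoch_choice c1 L \<eta> \<sigma> \<epsilon>"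
    have c0: "0 < c1" using c1 by (rule less_le_trans[rotated]) simp
    have E0: "0 < ?E" using c0 L_pos eta eps
      by (auto simp: epoch_choice_def intro!: mult_pos_pos divide_pos_pos)
    have W0: "0 \<le> outer_bound c1 L \<eta> \<delta> \<Delta> \<epsilon>"
      unfolding outer_bound_def using c0 L_pos delta eta eps gap
      by (intro mult_nonneg_nonneg divide_nonneg_nonneg add_nonneg_nonneg) auto
    \<comment> \<open>Already sufficient as a threshold, and smaller than the outer bound by the
      factor \<open>max 1 \<sigma>\<close>. Taking \<open>N\<close> from \<open>V\<close> meets the
      claimed stage count and both claimed totals at once.\<close>
    define V where "V = outer_bound c1 L \<eta> \<delta> \<Delta> \<epsilon> / max 1 \<sigma>"
    define N where "N = nat \<lfloor>V\<rfloor>"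
    have V0: "0 \<le> V" using W0 by (simp add: V_def)
    have VW: "V \<le> outer_bound c1 L \<eta> \<delta> \<Delta> \<epsilon>"
      using W0 by (simp add: V_def divide_le_eq mult_left_mono[of 1 "max 1 \<sigma>", simplified])
    have NV: "int N = \<lfloor>V\<rfloor>" "real N \<le> V" "V < real N + 1" using V0 by (auto simp: N_def)
    \<comment> \<open>Rounding up adds less than 1, hence at most doubles a value that is at least
      1.\<close>
    have bb: "?B \<le> real b" "real b \<le> 2 * ?B"
      using bB B1 by linarith+
    have mm: "?E \<le> real (m + 1)" using mE by linarith
    have eqs: "T_grad c1 L \<eta> \<delta> \<Delta> \<sigma> \<epsilon> = (?B + 3 * ?E) * V" "T_prox L \<eta> \<delta> \<Delta> \<sigma> \<epsilon> = ?E * V"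
      unfolding V_def by (intro T_grad_eq T_prox_eq L_pos eta(1) delta eps c0 sigma_nonneg)+
    show ?thesis
    proof (intro exI[of _ N] conjI allI impI)
      show "int N \<le> \<lfloor>outer_bound c1 L \<eta> \<delta> \<Delta> \<epsilon>\<rfloor>" using NV(1) floor_mono[OF VW] by simp
      show "(?B + 3 * ?E) * real N \<le> T_grad c1 L \<eta> \<delta> \<Delta> \<sigma> \<epsilon>"
        unfolding eqs using NV(2) B1 E0 by (intro mult_left_mono) auto
      show "?E * real N \<le> T_prox L \<eta> \<delta> \<Delta> \<sigma> \<epsilon>"
        unfolding eqs using NV(2) E0 by (intro mult_left_mono) auto
      show "T_prox L \<eta> \<delta> \<Delta> \<sigma> \<epsilon> < ?E" if "N = 0"
        unfolding eqs using NV(3) that E0 by simp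
    next
      fix M :: "'o measure" and S :: nat and X x T
      assume S: "1 \<le> S" "N \<le> S" and run: "prox_hsgd_rs_run M P fs \<psi> S b m (\<lambda>_. \<beta>) \<gamma> (\<lambda>_. \<eta>) x0 X x T"
      \<comment> \<open>V < N + 1 \<le> 2 S, because S is at least both N and 1; this covers N = 0
        as well.\<close>
      have "V \<le> 2 * real S" using NV(3) S by linarith
      then have "4 * real b powr (1/4) * (L + sqrt (L * \<delta>))
                  / (L * \<delta> * \<eta>\<^sup>2 * real S * real (m + 1) powr (3/4)) * \<Delta>
                 + 8 * \<sigma>\<^sup>2 / (L\<^sup>2 * \<eta>\<^sup>2 * sqrt (real b * real (m + 1))) \<le> \<epsilon>\<^sup>2"
        using L_pos eta(1) delta gap eps c0 sigma_nonneg S(1) bb mm unfolding V_def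
        by (intro rounded_choice_bound[where ?c1.0 = c1]) auto
      then show "expected_sq_gradient_mapping M f \<psi> \<eta> x T \<le> ennreal (\<epsilon>\<^sup>2)"
        using order_trans[OF main[OF S(1) run] ennreal_leI] by blast
    qed
  qed
  \<comment> \<open>\<open>T_grad\<close> is an exact constant multiple of the comparison function,
    with a constant free of both arguments, so the estimate holds uniformly on the whole
    quadrant.\<close>
  have O_grad: "(\<lambda>(\<sigma>', \<epsilon>'). T_grad c1 L \<eta> \<delta> \<Delta> \<sigma>' \<epsilon>')
            \<in> O[principal ({0..} \<times> {0<..})](\<lambda>(\<sigma>', \<epsilon>'). max \<sigma>' 1 / \<epsilon>' ^ 3)" for c1
    by (rule bigo_of_scaled[where K = "64 * sqrt 2 * (c1\<^sup>2 + 3) * (L + sqrt (L * \<delta>)) / (L\<^sup>2 * \<eta>^3 * \<delta>) * \<Delta>"])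
       (simp add: T_grad_def case_prod_beta max.commute mult_ac)
  have O_prox: "(\<lambda>(\<sigma>', \<epsilon>'). T_prox L \<eta> \<delta> \<Delta> \<sigma>' \<epsilon>')
       \<in> O[principal ({0..} \<times> {0<..})](\<lambda>(\<sigma>', \<epsilon>'). max \<sigma>' 1 / \<epsilon>' ^ 3)"
    by (rule bigo_of_scaled[where K = "64 * sqrt 2 * (L + sqrt (L * \<delta>)) / (L\<^sup>2 * \<eta>^3 * \<delta>) * \<Delta>"])
       (simp add: T_prox_def case_prod_beta max.commute mult_ac)
  show ?thesis
    using part_a part_b O_grad O_prox by (intro conjI allI impI) simp_all
qed

end
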